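(* Let $(X_1,L_1)$ and $(X_2,L_2)$ be polarized toric manifolds, and set $X=X_1\times X_2$ and $L=L_1\boxtimes L_2$. If $(X_1,L_1)$ and $(X_2,L_2)$ are uniformly relatively K-polystable, then so is $(X,L)$.
   Context: An $n$-dimensional polarized toric manifold $(X,L)$ corresponds to an integral Delzant polytope $P=\{x\in\mathbf{R}^n\mid\langle\lambda_j,x\rangle+d_j\ge0\ (j=1,\dots,r)\}$, with $r$ the number of facets, $\lambda_j\in\mathbf{Z}^n$ primitive, $d_j\in\mathbf{Z}$, facets $F_j=\{x\in P\mid\langle\lambda_j,x\rangle+d_j=0\}$. (For the product $(X_1\times X_2,L_1\boxtimes L_2)$ the polytope is $P_1\times P_2$.) $\sigma$ is the Borel measure on $\partial P$ equal on $F_j$ to $|\lambda_j|^{-1}$ times $(n-1)$-dimensional Lebesgue measure; $\overline{s}=\sigma(\partial P)/\mathrm{vol}(P)$; $V$ is the unique affine function on $P$ such that $\int_{\partial P}\ell\,d\sigma=\int_P(\overline{s}+V)\ell\,dx$ for every affine $\ell$ (it corresponds to the extremal Kähler vector field). $L_V(f)=\int_{\partial P}f\,d\sigma-\int_P(\overline{s}+V)f\,dx$. $\mathcal{C}_{PL}^{\mathbf{Q}}$ is the set of rational piecewise affine convex functions on $P$ (maxima of finitely many affine functions with rational coefficients). $\|f\|_J=\inf_{\xi\ \mathrm{affine}}\big(\frac1{\mathrm{vol}(P)}\int_P(f+\xi)\,dx-\inf_P(f+\xi)\big)$. $(X,L)$ is uniformly relatively K-polystable if there exists $\delta>0$ such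 that $L_V(f)\ge\delta\|f\|_J$ for all $f\in\mathcal{C}_{PL}^{\mathbf{Q}}$. *)

theory Defs
  imports "HOL-Analysis.Analysis"
begin

text \<open>
  A polarized toric manifold is represented by its integral Delzant polytope, a subset of a
  Euclidean space \<open>'a\<close> in the role of \<open>R\<^sup>n\<close>, with \<open>Basis\<close> as the standard basis. The basis of
  \<open>'a \<times> 'b\<close> is the union of the two bases, so the polytope of a product of manifolds is
  literally \<open>P1 \<times> P2\<close>.
\<close>

definition int_lattice :: "'a::euclidean_space set" where
  "int_lattice = {x. \<forall>b\<in>Basis. x \<bullet> b \<in> \<int>}"

definition primitive :: "'a::euclidean_space \<Rightarrow> bool" where
  "primitive l \<longleftrightarrow> l \<in> int_lattice \<and> l \<noteq> 0 \<and>
     (\<forall>k::nat. \<forall>m\<in>int_lattice. l = real k *\<^sub>R m \<longrightarrow> k = 1)"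

definition lattice_basis :: "'a::euclidean_space set \<Rightarrow> bool" where
  "lattice_basis S \<longleftrightarrow> S \<subseteq> int_lattice \<and> independent S \<and>
     (\<forall>z\<in>int_lattice. \<exists>c::'a \<Rightarrow> int. z = (\<Sum>l\<in>S. of_int (c l) *\<^sub>R l))"

definition hyperplane :: "'a::euclidean_space \<Rightarrow> int \<Rightarrow> 'a set" where
  "hyperplane l d = {x. l \<bullet> x + of_int d = 0}"

text \<open>
  The pairs \<open>(\<lambda>\<^sub>j, d\<^sub>j)\<close>, read off from \<open>P\<close>: primitive inward conormals of facets whose constant term
  is an integer. A full-dimensional polytope has at most one such pair for each facet, and
  \<open>integral_delzant\<close> below forces every facet to have one.
\<close>

definition facet_data :: "'a::euclidean_space set \<Rightarrow> ('a \<times> int) set" where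
  "facet_data P = {(l, d). primitive l \<and> (\<forall>x\<in>P. l \<bullet> x + of_int d \<ge> 0) \<and>
     (P \<inter> hyperplane l d) facet_of P}"

definition integral_delzant :: "'a::euclidean_space set \<Rightarrow> bool" where
  "integral_delzant P \<longleftrightarrow> polytope P \<and> interior P \<noteq> {} \<and>
     P = {x. \<forall>(l, d)\<in>facet_data P. l \<bullet> x + of_int d \<ge> 0} \<and>
     (\<forall>v. v extreme_point_of P \<longrightarrow>
        lattice_basis {l. \<exists>d. (l, d) \<in> facet_data P \<and> v \<in> hyperplane l d})"

text \<open>
  Lebesgue measure of dimension \<open>dim H\<close> on an affine subspace \<open>H\<close>, as a Borel measure on the ambient
  space: the image of Lebesgue measure under orthonormal affine coordinates on \<open>H\<close>. The choice of
  coordinates is immaterial, since two choices differ by a Euclidean isometry. If \<open>H\<close> is a point, the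
  product over the empty index set makes this a Dirac measure.
\<close>

definition flat_lborel :: "'a::euclidean_space set \<Rightarrow> 'a measure" where
  "flat_lborel H =
     (let (p, B) = (SOME (p, B). pairwise orthogonal B \<and> (\<forall>b\<in>B. norm b = 1) \<and>
                                 H = (+) p ` span B)
      in distr (\<Pi>\<^sub>M b\<in>B. (lborel :: real measure)) borel (\<lambda>c. p + (\<Sum>b\<in>B. c b *\<^sub>R b)))"

text \<open>
  The measure \<open>\<sigma>\<close>, extended by zero from \<open>frontier P\<close> to the whole space. Distinct facets meet in null
  sets, so summing over the facets does not count anything twice.
\<close>

definition bd_measure :: "'a::euclidean_space set \<Rightarrow> 'a measure" where
  "bd_measure P = measure_of UNIV (sets borel)
     (\<lambda>A. \<Sum>(l, d)\<in>facet_data P.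
        ennreal (1 / norm l) * emeasure (flat_lborel (hyperplane l d)) (A \<inter> (P \<inter> hyperplane l d)))"

definition sbar :: "'a::euclidean_space set \<Rightarrow> real" where
  "sbar P = measure (bd_measure P) (frontier P) / measure lborel P"

definition affine_fun :: "('a::euclidean_space \<Rightarrow> real) \<Rightarrow> bool" where
  "affine_fun f \<longleftrightarrow> (\<exists>a c. f = (\<lambda>x. a \<bullet> x + c))"

definition rat_affine_fun :: "('a::euclidean_space \<Rightarrow> real) \<Rightarrow> bool" where
  "rat_affine_fun f \<longleftrightarrow> (\<exists>a c. (\<forall>b\<in>Basis. a \<bullet> b \<in> \<rat>) \<and> c \<in> \<rat> \<and> f = (\<lambda>x. a \<bullet> x + c))"

text \<open>An affine function on a full-dimensional \<open>P\<close> is identified with its extension to the space.\<close>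

definition extremal_fun :: "'a::euclidean_space set \<Rightarrow> 'a \<Rightarrow> real" where
  "extremal_fun P = (THE V. affine_fun V \<and>
     (\<forall>l. affine_fun l \<longrightarrow>
        (LINT x:frontier P|bd_measure P. l x) = (LINT x:P|lborel. (sbar P + V x) * l x)))"

definition L_V :: "'a::euclidean_space set \<Rightarrow> ('a \<Rightarrow> real) \<Rightarrow> real" where
  "L_V P f = (LINT x:frontier P|bd_measure P. f x)
     - (LINT x:P|lborel. (sbar P + extremal_fun P x) * f x)"

definition C_PL_rat :: "'a::euclidean_space set \<Rightarrow> ('a \<Rightarrow> real) set" where
  "C_PL_rat P = {f. \<exists>S. finite S \<and> S \<noteq> {} \<and> (\<forall>l\<in>S. rat_affine_fun l) \<and>
     (\<forall>x\<in>P. f x = Max ((\<lambda>l. l x) ` S))}"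

definition J_norm :: "'a::euclidean_space set \<Rightarrow> ('a \<Rightarrow> real) \<Rightarrow> real" where
  "J_norm P f = (INF \<xi>\<in>{\<xi>. affine_fun \<xi>}.
     1 / measure lborel P * (LINT x:P|lborel. f x + \<xi> x) - (INF x\<in>P. f x + \<xi> x))"

definition uniformly_relatively_K_polystable :: "'a::euclidean_space set \<Rightarrow> bool" where
  "uniformly_relatively_K_polystable P \<longleftrightarrow>
     (\<exists>\<delta>>0. \<forall>f\<in>C_PL_rat P. L_V P f \<ge> \<delta> * J_norm P f)"

end

theory Submission
  imports Defs
begin

text \<open>
  Let \<open>h\<^sub>i\<close> be the density \<open>s + V\<close> of \<open>P\<^sub>i\<close>. The facets of \<open>P\<^sub>1 \<times> P\<^sub>2\<close> are the products of a facet of one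
  factor with the other factor, so \<open>\<sigma>\<close> splits as \<open>\<sigma>\<^sub>1 \<otimes> dy + dx \<otimes> \<sigma>\<^sub>2\<close>, and \<open>h\<^sub>1(x) + h\<^sub>2(y)\<close> is the
  density of the product. Hence \<open>L\<^sub>V(f)\<close> is the integral over \<open>y\<close> of \<open>L\<^sub>V(f(\<cdot>, y))\<close> plus the integral over
  \<open>x\<close> of \<open>L\<^sub>V(f(x, \<cdot>))\<close>. For convex piecewise affine \<open>f\<close> the norm \<open>\<parallel>f\<parallel>\<^sub>J\<close> is the mean of \<open>f\<close> minus its
  value at the barycenter, and a convexity argument bounds this excess for \<open>f\<close> by the averages over
  \<open>x\<close> and \<open>y\<close> of the excesses of the slices.
\<close>

subsection \<open>Lebesgue measure in orthonormal coordinates\<close>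

text \<open>The direct splitting of the excess of f at (b1, b2) is the average over y of the excess
  of f(., y) plus the excess of the single slice f(b1, .). The last term is the obstacle: the
  hypotheses bound only integrals of slice excesses, and one slice has measure zero. Evaluating f
  along a contraction of \<open>P2\<close> towards b2 leaves half of the total excess on the
  right-hand side instead, where it can be absorbed. With n the dimension of the second factor, the
  resulting stability constant is min(\<delta>1 vol(P2) / 2^(n+1), \<delta>2 vol(P1) / 2).

  Two features of the definitions shape the rest. The measure on a facet is given through an
  arbitrary choice of orthonormal coordinates, so it can be split along a product only after it is
  known not to depend on the choice. And stability is tested on functions with rational
  coefficients, whereas the slice of such a function at a point with irrational coordinates may have
  irrational constants.\<close>

interpretation lborel_product: product_sigma_finite "\<lambda>_. lborel :: real measure"
  by standard

definition orthonormal :: "'a::euclidean_space set \<Rightarrow> bool" where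
  "orthonormal B \<longleftrightarrow> pairwise orthogonal B \<and> (\<forall>b\<in>B. norm b = 1)"

text \<open>This is \<open>flat_lborel\<close> for one given choice of orthonormal coordinates, with
  origin \<open>p\<close> and axes \<open>B\<close>. Naming the choice makes it possible to compare
  two of them.\<close>

definition frame_lborel :: "'a::euclidean_space \<Rightarrow> 'a set \<Rightarrow> 'a measure" where
  "frame_lborel p B =
     distr (\<Pi>\<^sub>M b\<in>B. (lborel :: real measure)) borel (\<lambda>c. p + (\<Sum>b\<in>B. c b *\<^sub>R b))"

lemma orthonormal_independent: "orthonormal B \<Longrightarrow> independent B"
  unfolding orthonormal_def by (metis norm_zero pairwise_orthogonal_independent zero_neq_one)

lemma orthonormal_finite: "orthonormal B \<Longrightarrow> finite B"
  by (simp add: orthonormal_independent independent_imp_finite)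

lemma norm_orthonormal_sum:
  assumes "orthonormal B"
  shows "norm (\<Sum>b\<in>B. c b *\<^sub>R b) ^ 2 = (\<Sum>b\<in>B. (c b)^2)"
proof -
  have "norm (\<Sum>b\<in>B. c b *\<^sub>R b) ^ 2 = (\<Sum>b\<in>B. (norm (c b *\<^sub>R b))^2)"
    using assms orthonormal_finite[OF assms]
    by (intro norm_sum_Pythagorean)
       (auto simp: orthonormal_def pairwise_def orthogonal_def)
  then show ?thesis using assms by (simp add: orthonormal_def)
qed

lemma frame_measurable:
  "(\<lambda>c. p + (\<Sum>b\<in>B. c b *\<^sub>R b)) \<in> borel_measurable (\<Pi>\<^sub>M b\<in>B. (lborel :: real measure))"
  for p :: "'a::euclidean_space"
  by (intro borel_measurable_add borel_measurable_const borel_measurable_sum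
      borel_measurable_scaleR) (simp_all add: measurable_component_singleton)

lemma sets_frame_lborel [simp, measurable_cong]: "sets (frame_lborel p B) = sets borel"
  by (simp add: frame_lborel_def)

lemma space_frame_lborel [simp]: "space (frame_lborel p B) = UNIV"
  by (simp add: frame_lborel_def)

lemma nn_integral_frame_lborel:
  assumes "g \<in> borel_measurable borel"
  shows "(\<integral>\<^sup>+x. g x \<partial>frame_lborel p B) =
    (\<integral>\<^sup>+c. g (p + (\<Sum>b\<in>B. c b *\<^sub>R b)) \<partial>(\<Pi>\<^sub>M b\<in>B. (lborel :: real measure)))"
  unfolding frame_lborel_def using assms by (intro nn_integral_distr frame_measurable) auto

lemma emeasure_frame_lborel:
  assumes "A \<in> sets borel"
  shows "emeasure (frame_lborel p B) A =
    emeasure (\<Pi>\<^sub>M b\<in>B. (lborel :: real measure))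
      {c \<in> space (\<Pi>\<^sub>M b\<in>B. (lborel :: real measure)). p + (\<Sum>b\<in>B. c b *\<^sub>R b) \<in> A}"
  unfolding frame_lborel_def using assms
  by (subst emeasure_distr[OF frame_measurable]) (auto intro!: arg_cong2[where f=emeasure])

text \<open>The coordinates of a frame are indexed by its own basis vectors, so even two frames of
  the same flat live on different product spaces. A bijection of the index sets identifies these
  spaces; agreement of the measures is checked on boxes.\<close>

lemma PiM_lborel_reindex:
  assumes "bij_betw \<pi> I J" "finite I"
  shows "distr (\<Pi>\<^sub>M j\<in>J. (lborel :: real measure)) (\<Pi>\<^sub>M i\<in>I. (lborel :: real measure)) (\<lambda>c. \<lambda>i\<in>I. c (\<pi> i))
    = (\<Pi>\<^sub>M i\<in>I. (lborel :: real measure))"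
proof (rule lborel_product.PiM_eqI)
  have J: "J = \<pi> ` I" and inj: "inj_on \<pi> I" using assms by (auto simp: bij_betw_def)
  have finJ: "finite J" using J assms by simp
  have m: "(\<lambda>c. \<lambda>i\<in>I. c (\<pi> i)) \<in> measurable (\<Pi>\<^sub>M j\<in>J. (lborel :: real measure)) (\<Pi>\<^sub>M i\<in>I. (lborel :: real measure))"
    using J by (intro measurable_restrict measurable_component_singleton) auto
  fix A :: "'a \<Rightarrow> real set" assume A: "\<And>i. i \<in> I \<Longrightarrow> A i \<in> sets lborel"
  define A' where "A' j = A (inv_into I \<pi> j)" for j
  have A': "A' (\<pi> i) = A i" if "i \<in> I" for i using that inj by (simp add: A'_def)
  have "(\<lambda>c. \<lambda>i\<in>I. c (\<pi> i)) -` (Pi\<^sub>E I A) \<inter> space (\<Pi>\<^sub>M j\<in>J. (lborel :: real measure)) = Pi\<^sub>E J A'"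
    unfolding J space_PiM using A' by (auto simp: PiE_def Pi_def)
  then have "emeasure (distr (\<Pi>\<^sub>M j\<in>J. lborel) (\<Pi>\<^sub>M i\<in>I. (lborel :: real measure)) (\<lambda>c. \<lambda>i\<in>I. c (\<pi> i))) (Pi\<^sub>E I A)
      = emeasure (\<Pi>\<^sub>M j\<in>J. (lborel :: real measure)) (Pi\<^sub>E J A')"
    using A assms(2) by (subst emeasure_distr[OF m]) (auto intro!: sets_PiM_I_finite)
  also have "\<dots> = (\<Prod>j\<in>J. emeasure lborel (A' j))"
    using A A' finJ by (intro lborel_product.emeasure_PiM) (auto simp: J)
  also have "\<dots> = (\<Prod>i\<in>I. emeasure lborel (A i))"
    unfolding J using inj A' by (subst prod.reindex) auto
  finally show "emeasure (distr (\<Pi>\<^sub>M j\<in>J. lborel) (\<Pi>\<^sub>M i\<in>I. lborel) (\<lambda>c. \<lambda>i\<in>I. c (\<pi> i))) (Pi\<^sub>E I A)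
      = (\<Prod>i\<in>I. emeasure lborel (A i))" .
qed (use assms in auto)

lemma PiM_lborel_translate:
  fixes d :: "'i \<Rightarrow> real"
  assumes "finite I"
  shows "distr (\<Pi>\<^sub>M i\<in>I. (lborel :: real measure)) (\<Pi>\<^sub>M i\<in>I. (lborel :: real measure)) (\<lambda>c. \<lambda>i\<in>I. c i + d i)
    = (\<Pi>\<^sub>M i\<in>I. (lborel :: real measure))"
proof (rule lborel_product.PiM_eqI)
  have m: "(\<lambda>c. \<lambda>i\<in>I. c i + d i) \<in> measurable (\<Pi>\<^sub>M i\<in>I. (lborel :: real measure)) (\<Pi>\<^sub>M i\<in>I. (lborel :: real measure))"
    by (intro measurable_restrict) simp
  fix A :: "'i \<Rightarrow> real set" assume A: "\<And>i. i \<in> I \<Longrightarrow> A i \<in> sets lborel"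
  have "(\<lambda>c. \<lambda>i\<in>I. c i + d i) -` (Pi\<^sub>E I A) \<inter> space (\<Pi>\<^sub>M i\<in>I. (lborel :: real measure))
      = Pi\<^sub>E I (\<lambda>i. (\<lambda>x. x + d i) -` A i)"
    unfolding space_PiM by (auto simp: PiE_def Pi_def)
  then have "emeasure (distr (\<Pi>\<^sub>M i\<in>I. lborel) (\<Pi>\<^sub>M i\<in>I. (lborel :: real measure)) (\<lambda>c. \<lambda>i\<in>I. c i + d i)) (Pi\<^sub>E I A)
      = emeasure (\<Pi>\<^sub>M i\<in>I. (lborel :: real measure)) (Pi\<^sub>E I (\<lambda>i. (\<lambda>x. x + d i) -` A i))"
    using A assms by (subst emeasure_distr[OF m]) (auto intro!: sets_PiM_I_finite)
  also have "\<dots> = (\<Prod>i\<in>I. emeasure lborel ((\<lambda>x. x + d i) -` A i))"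
  proof (intro lborel_product.emeasure_PiM assms)
    fix i assume "i \<in> I"
    then show "(\<lambda>x. x + d i) -` A i \<in> sets lborel"
      using measurable_sets[of "\<lambda>x. x + d i" borel borel "A i"] A by auto
  qed
  also have "\<dots> = (\<Prod>i\<in>I. emeasure lborel (A i))"
  proof (rule prod.cong[OF refl])
    fix i assume "i \<in> I"
    then have "emeasure lborel (A i) = emeasure (distr lborel borel ((+) (d i))) (A i)"
      by (simp add: lborel_distr_plus)
    also have "\<dots> = emeasure lborel ((\<lambda>x. x + d i) -` A i)"
      using A \<open>i \<in> I\<close> by (subst emeasure_distr) (auto simp: add.commute[of _ "d i"])
    finally show "emeasure lborel ((\<lambda>x. x + d i) -` A i) = emeasure lborel (A i)" by simp
  qed
  finally show "emeasure (distr (\<Pi>\<^sub>M i\<in>I. lborel) (\<Pi>\<^sub>M i\<in>I. lborel) (\<lambda>c. \<lambda>i\<in>I. c i + d i)) (Pi\<^sub>E I A)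
      = (\<Prod>i\<in>I. emeasure lborel (A i))" .
qed (use assms in auto)

text \<open>A shift by a vector of \<open>span B\<close> is a shift of the coordinates, which
  preserves the product measure. Invariance is available only along the flat.\<close>

lemma nn_integral_frame_translate:
  assumes B: "finite B" and v: "v \<in> span B" and g [measurable]: "g \<in> borel_measurable borel"
  shows "(\<integral>\<^sup>+x. g (x + v) \<partial>frame_lborel p B) = (\<integral>\<^sup>+x. g x \<partial>frame_lborel p B)"
proof -
  obtain d where d: "v = (\<Sum>b\<in>B. d b *\<^sub>R b)" using v B by (auto simp: span_finite)
  let ?M = "\<Pi>\<^sub>M b\<in>B. (lborel :: real measure)"
  note frame_measurable[measurable]
  have m: "(\<lambda>c. \<lambda>i\<in>B. c i + d i) \<in> measurable ?M ?M"
    by (intro measurable_restrict) simp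
  have "(\<integral>\<^sup>+x. g x \<partial>frame_lborel p B) = (\<integral>\<^sup>+c. g (p + (\<Sum>b\<in>B. c b *\<^sub>R b)) \<partial>?M)"
    by (simp add: nn_integral_frame_lborel)
  also have "\<dots> = (\<integral>\<^sup>+c. g (p + (\<Sum>b\<in>B. c b *\<^sub>R b)) \<partial>distr ?M ?M (\<lambda>c. \<lambda>i\<in>B. c i + d i))"
    by (simp add: PiM_lborel_translate[OF B])
  also have "\<dots> = (\<integral>\<^sup>+c. g (p + (\<Sum>b\<in>B. (c b + d b) *\<^sub>R b)) \<partial>?M)"
    by (subst nn_integral_distr[OF m]) (auto cong: sum.cong)
  also have "\<dots> = (\<integral>\<^sup>+c. g (p + (\<Sum>b\<in>B. c b *\<^sub>R b) + v) \<partial>?M)"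
    by (simp add: d scaleR_left_distrib sum.distrib add.assoc)
  also have "\<dots> = (\<integral>\<^sup>+x. g (x + v) \<partial>frame_lborel p B)"
    by (simp add: nn_integral_frame_lborel)
  finally show ?thesis by simp
qed

text \<open>The measure lives on the flat through \<open>p\<close>. Since invariance holds only
  along \<open>span B\<close>, substitutions that translate by x - p are justified at points of the
  flat, hence almost everywhere.\<close>

lemma AE_frame_lborel:
  assumes "finite B"
  shows "AE x in frame_lborel p B. x - p \<in> span B"
proof -
  have "closed ((\<lambda>x. x - p) -` span B)"
    by (intro closed_vimage closed_subspace subspace_span continuous_intros)
  then have "{x. x - p \<in> span B} \<in> sets borel"
    by (metis borel_closed vimage_def)
  then show ?thesis
    unfolding frame_lborel_def using assms
    by (subst AE_distr_iff[OF frame_measurable])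
       (auto intro!: span_sum span_scale AE_I2 intro: span_base)
qed

section \<open>Mass of balls: finiteness and normalization\<close>

text \<open>By Pythagoras each coordinate of a point is bounded by the norm, so the ball pulls back
  into a cube of finite volume.\<close>

lemma emeasure_frame_cball_finite:
  assumes B: "orthonormal B"
  shows "emeasure (frame_lborel p B) (cball q r) < \<infinity>"
proof -
  let ?M = "\<Pi>\<^sub>M b\<in>B. (lborel :: real measure)"
  define R where "R = r + norm (q - p)"
  have fin: "finite B" using B by (rule orthonormal_finite)
  have "\<bar>c b\<bar> \<le> R" if "p + (\<Sum>b\<in>B. c b *\<^sub>R b) \<in> cball q r" "b \<in> B" for c b
  proof -
    have "(c b)^2 \<le> (\<Sum>b\<in>B. (c b)^2)"
      using fin that(2) by (intro member_le_sum) auto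
    then have "(c b)^2 \<le> norm (\<Sum>b\<in>B. c b *\<^sub>R b) ^ 2"
      using norm_orthonormal_sum[OF B, of c] by simp
    then have "\<bar>c b\<bar> \<le> norm (\<Sum>b\<in>B. c b *\<^sub>R b)"
      by (metis norm_ge_zero power2_abs power2_le_imp_le)
    also have "\<dots> \<le> norm (p + (\<Sum>b\<in>B. c b *\<^sub>R b) - q) + norm (q - p)"
      using norm_triangle_ineq[of "p + (\<Sum>b\<in>B. c b *\<^sub>R b) - q" "q - p"] by simp
    also have "\<dots> \<le> R" using that(1) by (simp add: R_def dist_norm norm_minus_commute)
    finally show ?thesis .
  qed
  note bnd = this
  have "{c \<in> space ?M. p + (\<Sum>b\<in>B. c b *\<^sub>R b) \<in> cball q r} \<subseteq> Pi\<^sub>E B (\<lambda>_. {-R..R})"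
  proof
    fix c assume c: "c \<in> {c \<in> space ?M. p + (\<Sum>b\<in>B. c b *\<^sub>R b) \<in> cball q r}"
    then have "c \<in> extensional B" by (simp add: space_PiM PiE_def)
    moreover have "c b \<in> {-R..R}" if "b \<in> B" for b
      using bnd[of c b] c that by (simp add: abs_le_iff)
    ultimately show "c \<in> Pi\<^sub>E B (\<lambda>_. {-R..R})" by (simp add: PiE_def Pi_def)
  qed
  then have "emeasure (frame_lborel p B) (cball q r) \<le> emeasure ?M (Pi\<^sub>E B (\<lambda>_. {-R..R}))"
    unfolding emeasure_frame_lborel[OF borel_closed[OF closed_cball]]
    by (rule emeasure_mono) (rule sets_PiM_I_finite[OF fin], simp)
  also have "\<dots> = (\<Prod>b\<in>B. emeasure lborel {-R..R})"
    by (intro lborel_product.emeasure_PiM fin) auto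
  also have "\<dots> < \<infinity>"
    by (simp add: emeasure_lborel_Icc_eq power_less_top_ennreal)
  finally show ?thesis .
qed

lemma emeasure_frame_bounded_finite:
  assumes "orthonormal B" "bounded A"
  shows "emeasure (frame_lborel p B) A < \<infinity>"
proof -
  obtain q r where "A \<subseteq> cball q r" using assms(2) by (auto simp: bounded_subset_cball)
  then have "emeasure (frame_lborel p B) A \<le> emeasure (frame_lborel p B) (cball q r)"
    by (rule emeasure_mono) simp
  then show ?thesis using emeasure_frame_cball_finite[OF assms(1)] by (rule le_less_trans)
qed

lemma sigma_finite_frame_lborel:
  assumes B: "orthonormal B"
  shows "sigma_finite_measure (frame_lborel p B)"
proof
  have "\<Union>(range (\<lambda>n::nat. cball 0 (real n))) = (UNIV :: 'a set)"
    by (auto simp: real_arch_simple)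
  then show "\<exists>A. countable A \<and> A \<subseteq> sets (frame_lborel p B) \<and> \<Union>A = space (frame_lborel p B) \<and>
      (\<forall>a\<in>A. emeasure (frame_lborel p B) a \<noteq> \<infinity>)"
    using emeasure_frame_cball_finite[OF B, of p 0]
    by (intro exI[of _ "range (\<lambda>n::nat. cball 0 (real n))"]) (auto simp: less_top)
qed

lemma emeasure_frame_ball_pos:
  assumes B: "orthonormal B"
  shows "emeasure (frame_lborel p B) (ball p 1) > 0"
proof -
  let ?M = "\<Pi>\<^sub>M b\<in>B. (lborel :: real measure)"
  \<comment> \<open>The sum of the norms is at most \<open>card B * e\<close>, which is below 1. The
    added 1 also covers an empty \<open>B\<close>, where the measure is a unit point mass.\<close>
  define e where "e = 1 / (real (card B) + 1)"
  have e: "e > 0" by (simp add: e_def)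
  have fin: "finite B" using B by (rule orthonormal_finite)
  have "p + (\<Sum>b\<in>B. c b *\<^sub>R b) \<in> ball p 1" if "\<And>b. b \<in> B \<Longrightarrow> \<bar>c b\<bar> \<le> e" for c
  proof -
    have "norm (\<Sum>b\<in>B. c b *\<^sub>R b) \<le> (\<Sum>b\<in>B. norm (c b *\<^sub>R b))" by (rule norm_sum)
    also have "\<dots> \<le> (\<Sum>b\<in>B. e)"
      using that B by (intro sum_mono) (auto simp: orthonormal_def)
    also have "\<dots> < 1" by (simp add: e_def field_simps)
    finally show ?thesis by (simp add: dist_norm)
  qed
  then have "Pi\<^sub>E B (\<lambda>_. {-e..e}) \<subseteq> {c \<in> space ?M. p + (\<Sum>b\<in>B. c b *\<^sub>R b) \<in> ball p 1}"
    by (auto simp: space_PiM PiE_def Pi_def abs_le_iff minus_le_iff)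
  then have "emeasure ?M (Pi\<^sub>E B (\<lambda>_. {-e..e})) \<le> emeasure (frame_lborel p B) (ball p 1)"
    unfolding emeasure_frame_lborel[OF borel_open[OF open_ball]]
    by (rule emeasure_mono)
       (use measurable_sets[OF frame_measurable borel_open[OF open_ball], of p B p 1]
        in \<open>simp add: vimage_def Int_def conj_commute\<close>)
  moreover have "emeasure ?M (Pi\<^sub>E B (\<lambda>_. {-e..e})) = (\<Prod>b\<in>B. emeasure lborel {-e..e})"
    by (intro lborel_product.emeasure_PiM fin) auto
  moreover have "\<dots> = ennreal ((2 * e) ^ card B)"
    using e by (simp add: ennreal_power)
  ultimately show ?thesis using e
    by (metis ennreal_less_zero_iff less_le_trans mult_pos_pos zero_less_numeral zero_less_power)
qed

lemma emeasure_frame_ball: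
  assumes "orthonormal B"
  shows "emeasure (frame_lborel p B) (ball p 1) =
    emeasure (\<Pi>\<^sub>M b\<in>B. (lborel :: real measure))
      {c \<in> space (\<Pi>\<^sub>M b\<in>B. (lborel :: real measure)). (\<Sum>b\<in>B. (c b)^2) < (1::real)}"
proof -
  have "p + (\<Sum>b\<in>B. c b *\<^sub>R b) \<in> ball p 1 \<longleftrightarrow> (\<Sum>b\<in>B. (c b)^2) < 1" for c
    using norm_orthonormal_sum[OF assms, of c] abs_square_less_1[of "norm (\<Sum>b\<in>B. c b *\<^sub>R b)"]
    by (simp add: dist_norm)
  then show ?thesis
    by (simp add: emeasure_frame_lborel)
qed

text \<open>In orthonormal coordinates the unit ball is the set where the sum of squares is below 1,
  so its mass depends on the dimension alone. This normalization removes the free factor in the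
  uniqueness of an invariant measure.\<close>

lemma emeasure_frame_ball_eq:
  assumes B: "orthonormal B" and B': "orthonormal B'" and c: "card B = card B'"
  shows "emeasure (frame_lborel p B) (ball p 1) = emeasure (frame_lborel p' B') (ball p' 1)"
proof -
  let ?M = "\<lambda>B. \<Pi>\<^sub>M b\<in>B. (lborel :: real measure)"
  let ?D = "\<lambda>B. {c \<in> space (?M B). (\<Sum>b\<in>B. (c b)^2) < (1::real)}"
  have fin: "finite B" "finite B'" using B B' orthonormal_finite by auto

  obtain \<pi> where \<pi>: "bij_betw \<pi> B B'" using c fin finite_same_card_bij by blast
  have m: "(\<lambda>c. \<lambda>i\<in>B. c (\<pi> i)) \<in> measurable (?M B') (?M B)"
    using \<pi> by (intro measurable_restrict measurable_component_singleton) (auto simp: bij_betw_def)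
  have s: "?D B \<in> sets (?M B)"
  proof -
    have "(\<lambda>c. \<Sum>b\<in>B. (c b)^2) \<in> borel_measurable (?M B)" by measurable
    then show ?thesis by measurable
  qed
  have "emeasure (?M B) (?D B) = emeasure (distr (?M B') (?M B) (\<lambda>c. \<lambda>i\<in>B. c (\<pi> i))) (?D B)"
    by (simp add: PiM_lborel_reindex[OF \<pi> fin(1)])
  also have "\<dots> = emeasure (?M B') (?D B')"
  proof (subst emeasure_distr[OF m s], rule arg_cong2[where f=emeasure, OF refl])
    have "(\<Sum>b\<in>B. (c (\<pi> b))\<^sup>2) = (\<Sum>b\<in>B'. (c b)\<^sup>2)" for c :: "_ \<Rightarrow> real"
      using sum.reindex_bij_betw[OF \<pi>, of "\<lambda>b. (c b)\<^sup>2"] by simp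
    then show "(\<lambda>c. \<lambda>i\<in>B. c (\<pi> i)) -` ?D B \<inter> space (?M B') = ?D B'"
      using m[THEN measurable_space] by (auto cong: sum.cong)
  qed
  finally show ?thesis using emeasure_frame_ball[OF B] emeasure_frame_ball[OF B'] by simp
qed

text \<open>The uniqueness argument for Haar measure: integrate \<open>1\<^sub>A(x) k(x - y)\<close> with \<open>k\<close> the indicator
  of the unit ball, in both orders; the symmetry of \<open>k\<close> replaces the inversion on the group.\<close>

lemma frame_lborel_unique:
  assumes B: "orthonormal B" and B': "orthonormal B'"
    and H: "(+) p ` span B = (+) p' ` span B'"
  shows "frame_lborel p B = frame_lborel p' B'"
proof (rule measure_eqI)
  define \<mu> where "\<mu> = frame_lborel p B"
  define \<nu> where "\<nu> = frame_lborel p' B'"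
  interpret \<mu>: sigma_finite_measure \<mu> unfolding \<mu>_def by (rule sigma_finite_frame_lborel[OF B])
  interpret \<nu>: sigma_finite_measure \<nu> unfolding \<nu>_def by (rule sigma_finite_frame_lborel[OF B'])
  interpret P: pair_sigma_finite \<mu> \<nu> ..
  have sets_\<mu>\<nu> [measurable_cong, simp]: "sets \<mu> = sets borel" "sets \<nu> = sets borel"
    by (simp_all add: \<mu>_def \<nu>_def)
  have fin: "finite B" "finite B'" using B B' orthonormal_finite by auto
  have pp: "p - p' \<in> span B'"
  proof -
    have "p \<in> (+) p ` span B" by (auto intro: rev_image_eqI[of 0] span_zero)
    then show ?thesis using H by auto
  qed
  have S: "span B = span B'"
  proof -
    have "x \<in> span B \<longleftrightarrow> x \<in> span B'" for x
    proof -
      have "x \<in> span B \<longleftrightarrow> p + x \<in> (+) p ` span B" by auto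
      also have "\<dots> \<longleftrightarrow> x + (p - p') \<in> span B'"
        unfolding H image_iff by (metis add.commute add_diff_eq diff_add_cancel)
      also have "\<dots> \<longleftrightarrow> x \<in> span B'" using pp span_add_eq2 by blast
      finally show ?thesis .
    qed
    then show ?thesis by blast
  qed
  have card: "card B = card B'"
    using B B' S by (metis dim_span dim_eq_card_independent orthonormal_independent)
  define k :: "'a \<Rightarrow> ennreal" where "k = indicator (ball 0 1)"
  have [measurable]: "k \<in> borel_measurable borel" unfolding k_def
    by (intro borel_measurable_indicator borel_open open_ball)
  have sym: "k (- x) = k x" for x by (simp add: k_def indicator_def)
  have ball: "k (x - q) = indicator (ball q 1) x" for x q
    by (simp add: k_def indicator_def dist_norm norm_minus_commute)
  have AE\<mu>: "AE x in \<mu>. x - p \<in> span B" unfolding \<mu>_def by (rule AE_frame_lborel[OF fin(1)])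
  have AE\<nu>: "AE y in \<nu>. y - p \<in> span B" unfolding \<nu>_def
    using AE_frame_lborel[OF fin(2), of p'] 
  proof eventually_elim
    case (elim y)
    then have "(y - p') - (p - p') \<in> span B'" using pp by (rule span_diff)
    then show ?case by (simp add: S)
  qed
  have tr\<mu>: "(\<integral>\<^sup>+x. g (x + v) \<partial>\<mu>) = (\<integral>\<^sup>+x. g x \<partial>\<mu>)"
    if "v \<in> span B" "g \<in> borel_measurable borel" for v g
    unfolding \<mu>_def using that by (intro nn_integral_frame_translate fin)
  have tr\<nu>: "(\<integral>\<^sup>+x. g (x + v) \<partial>\<nu>) = (\<integral>\<^sup>+x. g x \<partial>\<nu>)"
    if "v \<in> span B" "g \<in> borel_measurable borel" for v g
    unfolding \<nu>_def using that S by (intro nn_integral_frame_translate fin) auto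
  \<comment> \<open>A translation from \<open>p\<close> to \<open>p'\<close> and the equality of
    ball masses show that \<nu> gives this ball the same mass \<kappa> as \<mu> does. Being positive
    and finite, \<kappa> can be cancelled at the end.\<close>
  define \<kappa> where "\<kappa> = emeasure \<mu> (ball p 1)"
  have "emeasure \<nu> (ball p 1) = (\<integral>\<^sup>+y. k (y - p) \<partial>\<nu>)"
    by (simp add: ball)
  also have "\<dots> = (\<integral>\<^sup>+y. k (y + (p - p') - p) \<partial>\<nu>)"
    using tr\<nu>[of "p - p'" "\<lambda>y. k (y - p)"] pp S by simp
  also have "\<dots> = emeasure \<nu> (ball p' 1)" by (simp add: ball)
  also have "\<dots> = \<kappa>"
    unfolding \<nu>_def \<mu>_def \<kappa>_def by (rule emeasure_frame_ball_eq[OF B' B card[symmetric]])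
  finally have \<kappa>\<nu>: "emeasure \<nu> (ball p 1) = \<kappa>" .
  have \<kappa>: "\<kappa> \<noteq> 0" "\<kappa> \<noteq> \<infinity>"
    using emeasure_frame_ball_pos[OF B, of p] emeasure_frame_bounded_finite[OF B, of "ball p 1" p]
    by (auto simp: \<kappa>_def \<mu>_def)
  fix A assume "A \<in> sets (frame_lborel p B)"
  then have A [measurable]: "A \<in> sets borel" by simp
  let ?I = "\<lambda>x y. indicator A x * k (x - y)"
  have "(\<integral>\<^sup>+x. \<integral>\<^sup>+y. ?I x y \<partial>\<nu> \<partial>\<mu>) = (\<integral>\<^sup>+x. indicator A x * \<kappa> \<partial>\<mu>)"
  proof (rule nn_integral_cong_AE, use AE\<mu> in eventually_elim)
    case (elim x)
    have "(\<integral>\<^sup>+y. ?I x y \<partial>\<nu>) = indicator A x * (\<integral>\<^sup>+y. k (x - y) \<partial>\<nu>)"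
      by (subst nn_integral_cmult) auto
    also have "(\<integral>\<^sup>+y. k (x - y) \<partial>\<nu>) = (\<integral>\<^sup>+y. k (y - x) \<partial>\<nu>)"
      using sym by (metis minus_diff_eq)
    also have "\<dots> = (\<integral>\<^sup>+y. k (y + (x - p) - x) \<partial>\<nu>)"
      using tr\<nu>[of "x - p" "\<lambda>y. k (y - x)"] elim by simp
    also have "\<dots> = \<kappa>" by (simp add: ball \<kappa>\<nu>)
    finally show ?case .
  qed
  then have 1: "(\<integral>\<^sup>+x. \<integral>\<^sup>+y. ?I x y \<partial>\<nu> \<partial>\<mu>) = emeasure \<mu> A * \<kappa>"
    by (simp add: nn_integral_multc)
  have "(\<integral>\<^sup>+x. \<integral>\<^sup>+y. ?I x y \<partial>\<nu> \<partial>\<mu>) = (\<integral>\<^sup>+y. \<integral>\<^sup>+x. ?I x y \<partial>\<mu> \<partial>\<nu>)"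
    by (rule P.Fubini'[symmetric]) measurable
  \<comment> \<open>Substituting x + (y - p) for x turns k(x - y) into k(x - p). This requires y - p
    to lie in \<open>span B\<close>, which is why the integrands are compared almost everywhere.
    After another exchange of the integrals, a translation of y by x - p leaves the mass of
    \<open>A\<close> under \<nu>.\<close>
  also have "\<dots> = (\<integral>\<^sup>+y. \<integral>\<^sup>+x. indicator A (x + y - p) * k (x - p) \<partial>\<mu> \<partial>\<nu>)"
  proof (rule nn_integral_cong_AE, use AE\<nu> in eventually_elim)
    case (elim y)
    show ?case using tr\<mu>[OF elim, of "\<lambda>x. ?I x y"] by (simp add: algebra_simps)
  qed
  also have "\<dots> = (\<integral>\<^sup>+x. \<integral>\<^sup>+y. indicator A (x + y - p) * k (x - p) \<partial>\<nu> \<partial>\<mu>)"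
    by (rule P.Fubini') measurable
  also have "\<dots> = (\<integral>\<^sup>+x. emeasure \<nu> A * k (x - p) \<partial>\<mu>)"
  proof (rule nn_integral_cong_AE, use AE\<mu> in eventually_elim)
    case (elim x)
    have "(\<integral>\<^sup>+y. indicator A (x + y - p) \<partial>\<nu>) = (\<integral>\<^sup>+y. indicator A y \<partial>\<nu>)"
      using tr\<nu>[OF elim, of "indicator A"] by (simp add: algebra_simps)
    then show ?case by (subst nn_integral_multc) auto
  qed
  also have "\<dots> = emeasure \<nu> A * \<kappa>"
    unfolding ball \<kappa>_def by (rule nn_integral_cmult_indicator) simp
  finally have "emeasure \<mu> A * \<kappa> = emeasure \<nu> A * \<kappa>" using 1 by simp
  then show "emeasure (frame_lborel p B) A = emeasure (frame_lborel p' B') A"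
    using \<kappa> by (simp add: \<mu>_def \<nu>_def mult.commute[of _ \<kappa>] ennreal_mult_cancel_left)
qed simp

section \<open>Product frames and the measure on a flat\<close>

text \<open>A frame of a product consists of vectors (b, 0) and (0, b). The coordinates of each
  factor are therefore relabelled by the lifted vectors before the two product spaces are
  merged.\<close>

lemma emeasure_frame_lborel_reindex:
  assumes \<pi>: "bij_betw \<pi> B I" and B: "finite B" and A: "A \<in> sets borel"
  shows "emeasure (frame_lborel p B) A = emeasure (\<Pi>\<^sub>M i\<in>I. (lborel :: real measure))
    {c \<in> space (\<Pi>\<^sub>M i\<in>I. (lborel :: real measure)). p + (\<Sum>b\<in>B. c (\<pi> b) *\<^sub>R b) \<in> A}"
proof -
  let ?M = "\<lambda>B. \<Pi>\<^sub>M b\<in>B. (lborel :: real measure)"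
  let ?S = "{c \<in> space (?M B). p + (\<Sum>b\<in>B. c b *\<^sub>R b) \<in> A}"
  have m: "(\<lambda>c. \<lambda>i\<in>B. c (\<pi> i)) \<in> measurable (?M I) (?M B)"
    using \<pi> by (intro measurable_restrict measurable_component_singleton) (auto simp: bij_betw_def)
  have s: "?S \<in> sets (?M B)"
    using measurable_sets[OF frame_measurable A, of p B] by (simp add: vimage_def Int_def conj_commute)
  have "emeasure (frame_lborel p B) A = emeasure (distr (?M I) (?M B) (\<lambda>c. \<lambda>i\<in>B. c (\<pi> i))) ?S"
    by (simp add: emeasure_frame_lborel[OF A] PiM_lborel_reindex[OF \<pi> B])
  also have "\<dots> = emeasure (?M I) {c \<in> space (?M I). p + (\<Sum>b\<in>B. c (\<pi> b) *\<^sub>R b) \<in> A}"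
    using m[THEN measurable_space]
    by (subst emeasure_distr[OF m s], intro arg_cong2[where f=emeasure, OF refl])
       (auto cong: sum.cong)
  finally show ?thesis .
qed

lemma frame_sum_Times:
  assumes "finite B1" "finite B2" "0 \<notin> B1"
  shows "(\<Sum>b\<in>(\<lambda>b. (b, 0)) ` B1 \<union> Pair 0 ` B2. c b *\<^sub>R b) =
    ((\<Sum>b\<in>B1. c (b, 0) *\<^sub>R b), (\<Sum>b\<in>B2. c (0, b) *\<^sub>R b))"
proof -
  have "(\<Sum>b\<in>(\<lambda>b. (b, 0)) ` B1 \<union> Pair 0 ` B2. c b *\<^sub>R b)
      = (\<Sum>b\<in>(\<lambda>b. (b, 0)) ` B1. c b *\<^sub>R b) + (\<Sum>b\<in>Pair 0 ` B2. c b *\<^sub>R b)"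
    using assms by (intro sum.union_disjoint) auto
  also have "\<dots> = (\<Sum>b\<in>B1. c (b, 0) *\<^sub>R (b, 0)) + (\<Sum>b\<in>B2. c (0, b) *\<^sub>R (0, b))"
    by (subst (1 2) sum.reindex) (auto simp: inj_on_def)
  finally show ?thesis by (simp add: sum_prod)
qed

text \<open>For disjoint index sets, the product over the union is the pair measure of the two
  products. The coordinate map acts on the two blocks separately, so rectangles get the product of
  the masses.\<close>

lemma frame_lborel_Times:
  assumes B1: "orthonormal B1" and B2: "orthonormal B2"
  shows "frame_lborel (p, q) ((\<lambda>b. (b, 0)) ` B1 \<union> Pair 0 ` B2) = frame_lborel p B1 \<Otimes>\<^sub>M frame_lborel q B2"
proof (rule pair_measure_eqI[symmetric])
  let ?M = "\<lambda>B. \<Pi>\<^sub>M b\<in>B. (lborel :: real measure)"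
  show "sets (frame_lborel p B1 \<Otimes>\<^sub>M frame_lborel q B2) =
      sets (frame_lborel (p, q) ((\<lambda>b. (b, 0)) ` B1 \<union> Pair 0 ` B2))"
    by (simp only: sets_pair_measure_cong[OF sets_frame_lborel sets_frame_lborel] borel_prod
        sets_frame_lborel)
  fix A C assume "A \<in> sets (frame_lborel p B1)" "C \<in> sets (frame_lborel q B2)"
  then have A: "A \<in> sets borel" and C: "C \<in> sets borel" by simp_all
  have AC: "A \<times> C \<in> sets borel"
    using pair_measureI[OF A C] by (simp only: borel_prod)
  define I where "I = (\<lambda>b. (b, 0::'b)) ` B1"
  define J where "J = Pair (0::'a) ` B2"
  have fin: "finite B1" "finite B2" "finite I" "finite J"
    using B1 B2 by (auto simp: orthonormal_finite I_def J_def)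
  \<comment> \<open>Unit vectors are nonzero; otherwise (0, 0) could be an index of both
    blocks.\<close>
  have z: "0 \<notin> B1" using B1 by (auto simp: orthonormal_def)
  have disj: "I \<inter> J = {}" using z by (auto simp: I_def J_def)
  have bI: "bij_betw (\<lambda>b. (b, 0::'b)) B1 I" and bJ: "bij_betw (Pair (0::'a)) B2 J"
    by (auto simp: I_def J_def bij_betw_def inj_on_def)
  interpret J: sigma_finite_measure "?M J" by (rule lborel_product.sigma_finite) (rule fin)
  let ?S = "{c \<in> space (?M (I \<union> J)). (p, q) + (\<Sum>b\<in>I \<union> J. c b *\<^sub>R b) \<in> A \<times> C}"
  let ?X = "{c \<in> space (?M I). p + (\<Sum>b\<in>B1. c (b, 0) *\<^sub>R b) \<in> A}"
  let ?Y = "{c \<in> space (?M J). q + (\<Sum>b\<in>B2. c (0, b) *\<^sub>R b) \<in> C}"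
  have s: "?S \<in> sets (?M (I \<union> J))"
    using measurable_sets[OF frame_measurable AC, of "(p, q)" "I \<union> J"]
    by (simp add: vimage_def Int_def conj_commute)
  have X: "?X \<in> sets (?M I)" and Y: "?Y \<in> sets (?M J)"
  proof -
    have "(\<lambda>c. p + (\<Sum>b\<in>B1. c (b, 0) *\<^sub>R b)) \<in> borel_measurable (?M I)"
      by (intro borel_measurable_add borel_measurable_const borel_measurable_sum
          borel_measurable_scaleR) (auto simp: measurable_component_singleton I_def)
    from measurable_sets[OF this A] show "?X \<in> sets (?M I)"
      by (simp add: vimage_def Int_def conj_commute)
    have "(\<lambda>c. q + (\<Sum>b\<in>B2. c (0, b) *\<^sub>R b)) \<in> borel_measurable (?M J)"
      by (intro borel_measurable_add borel_measurable_const borel_measurable_sum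
          borel_measurable_scaleR) (auto simp: measurable_component_singleton J_def)
    from measurable_sets[OF this C] show "?Y \<in> sets (?M J)"
      by (simp add: vimage_def Int_def conj_commute)
  qed
  have "emeasure (frame_lborel (p, q) (I \<union> J)) (A \<times> C) = emeasure (?M (I \<union> J)) ?S"
    by (rule emeasure_frame_lborel[OF AC])
  also have "\<dots> = emeasure (distr (?M I \<Otimes>\<^sub>M ?M J) (?M (I \<union> J)) (merge I J)) ?S"
    by (simp only: lborel_product.distr_merge[OF disj fin(3,4)])
  also have "\<dots> = emeasure (?M I \<Otimes>\<^sub>M ?M J) (merge I J -` ?S \<inter> space (?M I \<Otimes>\<^sub>M ?M J))"
    by (rule emeasure_distr[OF measurable_merge s])
  also have "merge I J -` ?S \<inter> space (?M I \<Otimes>\<^sub>M ?M J) = ?X \<times> ?Y"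
  proof -
    have "merge I J (c, c') \<in> ?S \<longleftrightarrow> c \<in> ?X \<and> c' \<in> ?Y"
      if "c \<in> space (?M I)" "c' \<in> space (?M J)" for c c'
    proof -
      have "merge I J (c, c') \<in> space (?M (I \<union> J))"
        using measurable_space[OF measurable_merge, of "(c, c')" I "\<lambda>_. lborel" J] that
        by (simp add: space_pair_measure)
      moreover have "(\<Sum>b\<in>I \<union> J. merge I J (c, c') b *\<^sub>R b) =
          ((\<Sum>b\<in>B1. c (b, 0) *\<^sub>R b), (\<Sum>b\<in>B2. c' (0, b) *\<^sub>R b))"
      proof -
        have "(\<Sum>b\<in>B1. merge I J (c, c') (b, 0) *\<^sub>R b) = (\<Sum>b\<in>B1. c (b, 0) *\<^sub>R b)"
          by (intro sum.cong refl) (auto simp: I_def merge_def)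
        moreover have "(\<Sum>b\<in>B2. merge I J (c, c') (0, b) *\<^sub>R b) = (\<Sum>b\<in>B2. c' (0, b) *\<^sub>R b)"
          using disj by (intro sum.cong refl) (auto simp: J_def merge_def)
        ultimately show ?thesis
          unfolding I_def J_def frame_sum_Times[OF fin(1,2) z] by simp
      qed
      ultimately show ?thesis using that by simp
    qed
    note iff = this
    show ?thesis
    proof (rule set_eqI)
      fix z :: "('a \<times> 'b \<Rightarrow> real) \<times> ('a \<times> 'b \<Rightarrow> real)"
      obtain c c' where z: "z = (c, c')" by (cases z)
      show "z \<in> merge I J -` ?S \<inter> space (?M I \<Otimes>\<^sub>M ?M J) \<longleftrightarrow> z \<in> ?X \<times> ?Y"
        unfolding z vimage_eq Int_iff space_pair_measure mem_Sigma_iff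
      proof (cases "c \<in> space (?M I) \<and> c' \<in> space (?M J)")
        case True
        then show "merge I J (c, c') \<in> ?S \<and> c \<in> space (?M I) \<and> c' \<in> space (?M J) \<longleftrightarrow>
            c \<in> ?X \<and> c' \<in> ?Y"
          by (simp only: iff simp_thms)
      qed (simp only: mem_Collect_eq, argo)
    qed
  qed
  also have "emeasure (?M I \<Otimes>\<^sub>M ?M J) (?X \<times> ?Y) = emeasure (?M I) ?X * emeasure (?M J) ?Y"
    by (rule J.emeasure_pair_measure_Times[OF X Y])
  also have "\<dots> = emeasure (frame_lborel p B1) A * emeasure (frame_lborel q B2) C"
    unfolding emeasure_frame_lborel_reindex[OF bI fin(1) A] emeasure_frame_lborel_reindex[OF bJ fin(2) C] ..
  finally show "emeasure (frame_lborel p B1) A * emeasure (frame_lborel q B2) C =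
      emeasure (frame_lborel (p, q) ((\<lambda>b. (b, 0)) ` B1 \<union> Pair 0 ` B2)) (A \<times> C)"
    by (simp add: I_def J_def)
qed (use assms sigma_finite_frame_lborel in auto)

lemma orthonormal_Basis: "orthonormal Basis"
  by (auto simp: orthonormal_def pairwise_def orthogonal_def inner_Basis)

lemma frame_lborel_Basis: "frame_lborel 0 Basis = lborel"
  unfolding frame_lborel_def by (subst (2) lborel_eq) simp

lemma orthonormal_Times:
  assumes "orthonormal B1" "orthonormal B2"
  shows "orthonormal ((\<lambda>b. (b, 0)) ` B1 \<union> Pair 0 ` B2)"
  using assms unfolding orthonormal_def pairwise_def orthogonal_def
  by (auto simp: norm_Pair; blast)

lemma span_Times_frame:
  assumes "finite B1" "finite B2" "0 \<notin> B1"
  shows "span ((\<lambda>b. (b, 0)) ` B1 \<union> Pair 0 ` B2) = span B1 \<times> span B2"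
proof -
  have e: "(\<lambda>b. (b, 0)) ` B1 = B1 \<times> {0}" "Pair 0 ` B2 = {0} \<times> B2" by auto
  show ?thesis
    unfolding e span_Un real_vector.span_Times_sing1 real_vector.span_Times_sing2 by force
qed

definition is_frame :: "'a::euclidean_space set \<Rightarrow> 'a \<Rightarrow> 'a set \<Rightarrow> bool" where
  "is_frame H p B \<longleftrightarrow> orthonormal B \<and> H = (+) p ` span B"

text \<open>\<open>flat_lborel\<close> takes an unspecified frame. The given frame shows that one
  exists, hence the chosen one is a frame of \<open>H\<close> too, and uniqueness makes the two
  measures equal.\<close>

lemma flat_lborel_eq:
  assumes "is_frame H p B"
  shows "flat_lborel H = frame_lborel p B"
proof -
  let ?Q = "\<lambda>(p, B). pairwise orthogonal B \<and> (\<forall>b\<in>B. norm b = 1) \<and> H = (+) p ` span B"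
  obtain p' B' where s: "Eps ?Q = (p', B')" by (cases "Eps ?Q")
  have "?Q (p, B)" using assms by (simp add: is_frame_def orthonormal_def)
  then have "?Q (Eps ?Q)" by (rule someI)
  then have "is_frame H p' B'" unfolding s by (simp add: is_frame_def orthonormal_def)
  then have "frame_lborel p' B' = frame_lborel p B"
    using assms by (intro frame_lborel_unique) (auto simp: is_frame_def)
  then show ?thesis
    by (simp add: flat_lborel_def s frame_lborel_def)
qed

lemma hyperplane_frame:
  assumes "l \<noteq> 0"
  obtains p B where "is_frame (hyperplane l d) p B"
proof -
  obtain B where B: "B \<subseteq> {x. l \<bullet> x = 0}" "pairwise orthogonal B" "\<And>x. x \<in> B \<Longrightarrow> norm x = 1"
      "span B = {x. l \<bullet> x = 0}"
    using orthonormal_basis_subspace[OF subspace_hyperplane[of l]] by metis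
  \<comment> \<open>The foot of the perpendicular from the origin to the hyperplane.\<close>
  define p where "p = (- of_int d / (l \<bullet> l)) *\<^sub>R l"
  have p: "l \<bullet> p = - of_int d" using assms by (simp add: p_def)
  have "x \<in> (+) p ` {x. l \<bullet> x = 0}" if "l \<bullet> x + of_int d = 0" for x
    using that p by (intro image_eqI[of _ _ "x - p"]) (auto simp: inner_diff_right)
  then have "hyperplane l d = (+) p ` span B"
    using p by (auto simp: hyperplane_def B(4) inner_add_right)
  moreover have "orthonormal B" using B(2,3) by (simp add: orthonormal_def)
  ultimately show thesis using that by (simp add: is_frame_def)
qed

lemma is_frame_Times:
  assumes "is_frame H1 p B1" "is_frame H2 q B2"
  shows "is_frame (H1 \<times> H2) (p, q) ((\<lambda>b. (b, 0)) ` B1 \<union> Pair 0 ` B2)"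
proof -
  have "finite B1" "finite B2" "0 \<notin> B1"
    using assms orthonormal_finite by (auto simp: is_frame_def orthonormal_def)
  then show ?thesis
    using assms orthonormal_Times unfolding is_frame_def
    by (auto simp: span_Times_frame image_iff)
qed

lemma is_frame_UNIV: "is_frame UNIV 0 Basis"
  by (simp add: is_frame_def orthonormal_Basis)

lemma flat_lborel_Times_UNIV:
  assumes "is_frame H p B"
  shows "flat_lborel (H \<times> (UNIV :: 'b::euclidean_space set)) = flat_lborel H \<Otimes>\<^sub>M lborel"
    and "flat_lborel ((UNIV :: 'b set) \<times> H) = lborel \<Otimes>\<^sub>M flat_lborel H"
proof -
  have B: "orthonormal B" using assms by (simp add: is_frame_def)
  show "flat_lborel (H \<times> (UNIV :: 'b set)) = flat_lborel H \<Otimes>\<^sub>M lborel"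
    unfolding flat_lborel_eq[OF is_frame_Times[OF assms is_frame_UNIV]] flat_lborel_eq[OF assms]
      frame_lborel_Times[OF B orthonormal_Basis] frame_lborel_Basis ..
  show "flat_lborel ((UNIV :: 'b set) \<times> H) = lborel \<Otimes>\<^sub>M flat_lborel H"
    unfolding flat_lborel_eq[OF is_frame_Times[OF is_frame_UNIV assms]] flat_lborel_eq[OF assms]
      frame_lborel_Times[OF orthonormal_Basis B] frame_lborel_Basis ..
qed

lemma
  assumes "is_frame H p B"
  shows sets_flat_lborel: "sets (flat_lborel H) = sets borel"
    and sigma_finite_flat_lborel: "sigma_finite_measure (flat_lborel H)"
    and emeasure_flat_bounded_finite: "bounded A \<Longrightarrow> emeasure (flat_lborel H) A < \<infinity>"
proof -
  have B: "orthonormal B" using assms by (simp add: is_frame_def)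
  show "sets (flat_lborel H) = sets borel" "sigma_finite_measure (flat_lborel H)"
    "bounded A \<Longrightarrow> emeasure (flat_lborel H) A < \<infinity>"
    unfolding flat_lborel_eq[OF assms]
    using sigma_finite_frame_lborel[OF B] emeasure_frame_bounded_finite[OF B] by auto
qed

subsection \<open>Facets of a product\<close>

text \<open>Moving a point of each set to the origin makes both translated sets contain 0. The span
  of their product then contains both axes, so it is the product of the spans, and dimensions
  add.\<close>

lemma aff_dim_Times:
  fixes S :: "'a::euclidean_space set" and T :: "'b::euclidean_space set"
  assumes "S \<noteq> {}" "T \<noteq> {}"
  shows "aff_dim (S \<times> T) = aff_dim S + aff_dim T"
proof -
  obtain a b where ab: "a \<in> S" "b \<in> T" using assms by auto
  define A where "A = (+) (-a) ` S"
  define B where "B = (+) (-b) ` T"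
  have 0: "0 \<in> A" "0 \<in> B" using ab by (auto simp: A_def B_def intro: rev_image_eqI)
  have "(+) (- (a, b)) ` (S \<times> T) = A \<times> B"
    unfolding A_def B_def by (auto simp: image_iff)
  then have "aff_dim (S \<times> T) = int (dim (A \<times> B))"
    using ab aff_dim_eq_dim[of "(a, b)" "S \<times> T"] by (simp add: hull_inc)
  also have "span (A \<times> B) = span A \<times> span B"
  proof
    have "A \<times> B \<subseteq> span A \<times> span B" by (auto intro: span_base)
    moreover have "subspace (span A \<times> span B)" by (simp add: subspace_Times)
    ultimately show "span (A \<times> B) \<subseteq> span A \<times> span B" by (rule span_minimal)
    have "span A \<times> {0} = span (A \<times> {0::'b})" "{0} \<times> span B = span ({0::'a} \<times> B)"
      by (simp_all only: real_vector.span_Times_sing1 real_vector.span_Times_sing2)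
    moreover have "span (A \<times> {0}) \<subseteq> span (A \<times> B)" "span ({0} \<times> B) \<subseteq> span (A \<times> B)"
      using 0 by (auto intro!: span_mono)
    ultimately have "(x, 0) + (0, y) \<in> span (A \<times> B)" if "x \<in> span A" "y \<in> span B" for x y
      using that by (intro span_add) blast+
    then show "span A \<times> span B \<subseteq> span (A \<times> B)" by auto
  qed
  then have "dim (A \<times> B) = dim (span A \<times> span B)" by (metis dim_span)
  also have "\<dots> = dim A + dim B" by (simp add: dim_Times)
  also have "int \<dots> = aff_dim S + aff_dim T"
    using ab aff_dim_eq_dim[of a S] aff_dim_eq_dim[of b T] by (simp add: A_def B_def hull_inc)
  finally show ?thesis .
qed

lemma
  assumes "integral_delzant P"
  shows delzant_compact: "compact P" and delzant_convex: "convex P"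
    and delzant_interior: "interior P \<noteq> {}" and delzant_nonempty: "P \<noteq> {}"
    and delzant_polytope: "polytope P"
  using assms interior_subset[of P]
  by (auto simp: integral_delzant_def polytope_imp_compact polytope_imp_convex)

lemma facet_dataD:
  assumes "(l, d) \<in> facet_data P"
  shows "l \<noteq> 0" "primitive l" "\<And>x. x \<in> P \<Longrightarrow> l \<bullet> x + of_int d \<ge> 0" "(P \<inter> hyperplane l d) facet_of P"
  using assms by (auto simp: facet_data_def primitive_def)

lemma closed_hyperplane': "closed (hyperplane l d)"
proof -
  have "hyperplane l d = {x. l \<bullet> x = - of_int d}" by (auto simp: hyperplane_def)
  then show ?thesis by (simp add: closed_hyperplane)
qed

text \<open>From an interior point a short step in the direction of -l stays in \<open>P\<close>. If
  the point lay on the hyperplane, the step would make the defining inequality fail.\<close>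

lemma facet_subset_frontier:
  assumes "(l, d) \<in> facet_data P" "closed P"
  shows "P \<inter> hyperplane l d \<subseteq> frontier P"
proof -
  have "x \<notin> interior P" if x: "x \<in> hyperplane l d" for x
  proof
    assume "x \<in> interior P"
    then obtain e where e: "e > 0" "cball x e \<subseteq> P" by (auto simp: mem_interior_cball)
    define y where "y = x - (e / norm l) *\<^sub>R l"
    have l: "l \<noteq> 0" using facet_dataD(1)[OF assms(1)] .
    then have "y \<in> P" using e by (auto simp: y_def dist_norm intro!: subsetD[OF e(2)])
    then have "0 \<le> l \<bullet> y + of_int d" using facet_dataD(3)[OF assms(1)] by simp
    also have "\<dots> = - (e / norm l) * (l \<bullet> l)"
      using x by (simp add: y_def hyperplane_def inner_diff_right)
    also have "\<dots> < 0" using e l by simp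
    finally show False by simp
  qed
  then show ?thesis using assms(2) by (auto simp: frontier_def)
qed

text \<open>Every facet contains a vertex of \<open>P\<close>, and a polytope has finitely many
  vertices. At a vertex the conormals form a lattice basis, hence a finite set, and the constant
  term is determined by the conormal and the vertex.\<close>

lemma finite_facet_data:
  assumes P: "integral_delzant P"
  shows "finite (facet_data P)"
proof -
  define X where "X = {v. v extreme_point_of P}"
  define N where "N v = {l. \<exists>d. (l, d) \<in> facet_data P \<and> v \<in> hyperplane l d}" for v
  have X: "finite X"
    using finite_polyhedron_extreme_points polytope_imp_polyhedron delzant_polytope[OF P] X_def by blast
  have N: "finite (N v)" if "v \<in> X" for v
    using P that unfolding integral_delzant_def X_def N_def lattice_basis_def
    by (auto intro: independent_imp_finite)
  \<comment> \<open>The value -(l . v) equals the integer \<open>d\<close>; the floor merely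
    recovers it with integer type.\<close>
  have "facet_data P \<subseteq> (\<Union>v\<in>X. (\<lambda>l. (l, \<lfloor>- (l \<bullet> v)\<rfloor>)) ` N v)"
  proof
    fix z assume z: "z \<in> facet_data P"
    obtain l d where ld: "z = (l, d)" by (cases z)
    let ?F = "P \<inter> hyperplane l d"
    have F: "?F face_of P" "?F \<noteq> {}"
      using facet_dataD(4)[of l d P] z ld by (auto simp: facet_of_def)
    have "compact ?F" "convex ?F"
      using F(1) face_of_imp_convex face_of_imp_compact delzant_compact[OF P] delzant_convex[OF P]
      by blast+
    then obtain v where v: "v extreme_point_of ?F" using extreme_point_exists_convex F(2) by blast
    then have "v \<in> X" "v \<in> hyperplane l d"
      using extreme_point_of_face[OF F(1)] by (auto simp: X_def)
    moreover have "d = \<lfloor>- (l \<bullet> v)\<rfloor>"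
    proof -
      have "- (l \<bullet> v) = of_int d" using \<open>v \<in> hyperplane l d\<close> by (simp add: hyperplane_def)
      then show ?thesis by simp
    qed
    ultimately show "z \<in> (\<Union>v\<in>X. (\<lambda>l. (l, \<lfloor>- (l \<bullet> v)\<rfloor>)) ` N v)"
      using z ld by (auto simp: N_def intro!: bexI[of _ v] image_eqI[of _ _ l])
  qed
  then show ?thesis using X N by (meson finite_UN_I finite_imageI finite_subset)
qed

lemma int_lattice_Pair: "(x, y) \<in> int_lattice \<longleftrightarrow> x \<in> int_lattice \<and> y \<in> int_lattice"
  by (auto simp: int_lattice_def Basis_prod_def ball_Un)

lemma int_lattice_0: "0 \<in> int_lattice"
  by (simp add: int_lattice_def)

lemma primitive_Pair_0:
  "primitive (l, 0) \<longleftrightarrow> primitive l" "primitive (0, l) \<longleftrightarrow> primitive l"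
proof -
  have "(\<forall>k::nat. \<forall>m\<in>int_lattice. (l, 0) = real k *\<^sub>R m \<longrightarrow> k = 1) \<longleftrightarrow>
      (\<forall>k::nat. \<forall>m\<in>int_lattice. l = real k *\<^sub>R m \<longrightarrow> k = 1)" (is "?L \<longleftrightarrow> ?R")
    and "(\<forall>k::nat. \<forall>m\<in>int_lattice. (0, l) = real k *\<^sub>R m \<longrightarrow> k = 1) \<longleftrightarrow>
      (\<forall>k::nat. \<forall>m\<in>int_lattice. l = real k *\<^sub>R m \<longrightarrow> k = 1)" (is "?L' \<longleftrightarrow> _")
  proof -
    have "?R" if ?L
    proof (intro allI ballI impI)
      fix k m assume "m \<in> int_lattice" "l = real k *\<^sub>R m"
      then have "(m, 0) \<in> int_lattice" "(l, 0) = real k *\<^sub>R (m, 0)"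
        by (simp_all add: int_lattice_Pair int_lattice_0)
      then show "k = 1" using that by blast
    qed
    moreover have "?R" if ?L'
    proof (intro allI ballI impI)
      fix k m assume "m \<in> int_lattice" "l = real k *\<^sub>R m"
      then have "(0, m) \<in> int_lattice" "(0, l) = real k *\<^sub>R (0, m)"
        by (simp_all add: int_lattice_Pair int_lattice_0)
      then show "k = 1" using that by blast
    qed
    moreover have "?L \<and> ?L'" if ?R
    proof (intro conjI allI ballI impI)
      fix k m assume "m \<in> int_lattice" "(l, 0) = real k *\<^sub>R m"
      then have "fst m \<in> int_lattice" "l = real k *\<^sub>R fst m"
        by (cases m; simp add: int_lattice_Pair)+
      then show "k = 1" using that by blast
    next
      fix k m assume "m \<in> int_lattice" "(0, l) = real k *\<^sub>R m"
      then have "snd m \<in> int_lattice" "l = real k *\<^sub>R snd m"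
        by (cases m; simp add: int_lattice_Pair)+
      then show "k = 1" using that by blast
    qed
    ultimately show "?L \<longleftrightarrow> ?R" "?L' \<longleftrightarrow> ?R" by blast+
  qed
  then show "primitive (l, 0) \<longleftrightarrow> primitive l" "primitive (0, l) \<longleftrightarrow> primitive l"
    unfolding primitive_def
    by (auto simp: int_lattice_Pair int_lattice_0 zero_prod_def)
qed

lemma hyperplane_Pair_0:
  "hyperplane (l, 0) d = hyperplane l d \<times> UNIV" "hyperplane (0, l) d = UNIV \<times> hyperplane l d"
  by (auto simp: hyperplane_def)

lemma face_of_aff_dim_eq:
  assumes "convex P" "F face_of P" "aff_dim F = aff_dim P"
  shows "F = P"
  using assms face_of_aff_dim_lt by fastforce

lemma zero_if_constant_on_interior:
  assumes "interior P \<noteq> {}" and c: "\<And>x. x \<in> P \<Longrightarrow> l \<bullet> x = (c::real)"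
  shows "l = 0"
proof (rule ccontr)
  assume l: "l \<noteq> 0"
  obtain x where "x \<in> interior P" using assms(1) by auto
  then obtain e where e: "e > 0" "cball x e \<subseteq> P" by (auto simp: mem_interior_cball)
  have "x + (e / norm l) *\<^sub>R l \<in> P" using e l by (auto simp: dist_norm intro!: subsetD[OF e(2)])
  moreover have "x \<in> P" using e by auto
  ultimately have "l \<bullet> (x + (e / norm l) *\<^sub>R l) = l \<bullet> x" using c by metis
  then show False using e l by (simp add: inner_add_right)
qed

text \<open>A face of a product is a product of faces, and codimension one forces one of these to be
  the whole factor. On that factor the conormal component is constant; since the factor has
  interior, the component is zero, and what remains is facet data of the other factor.\<close>

lemma facet_data_Times:
  fixes P1 :: "'a::euclidean_space set" and P2 :: "'b::euclidean_space set"
  assumes P1: "integral_delzant P1" and P2: "integral_delzant P2"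
  shows "facet_data (P1 \<times> P2) =
    (\<lambda>(l, d). ((l, 0), d)) ` facet_data P1 \<union> (\<lambda>(l, d). ((0, l), d)) ` facet_data P2"
    (is "_ = ?R1 \<union> ?R2")
proof
  note ne = delzant_nonempty[OF P1] delzant_nonempty[OF P2]
  note int = delzant_interior[OF P1] delzant_interior[OF P2]
  note conv = delzant_convex[OF P1] delzant_convex[OF P2]
  have face_self: "P1 face_of P1" "P2 face_of P2"
    using conv face_of_refl by blast+
  have dimP: "aff_dim (P1 \<times> P2) = aff_dim P1 + aff_dim P2" by (rule aff_dim_Times[OF ne])
  show "?R1 \<union> ?R2 \<subseteq> facet_data (P1 \<times> P2)"
  proof safe
    fix l d assume ld: "(l, d) \<in> facet_data P1"
    have "(P1 \<times> P2) \<inter> hyperplane (l, 0) d = (P1 \<inter> hyperplane l d) \<times> P2"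
      by (auto simp: hyperplane_Pair_0)
    moreover have "((P1 \<inter> hyperplane l d) \<times> P2) facet_of (P1 \<times> P2)"
      using facet_dataD(4)[OF ld] ne face_self face_of_Times dimP
      by (auto simp: facet_of_def aff_dim_Times)
    ultimately show "((l, 0), d) \<in> facet_data (P1 \<times> P2)"
      using ld by (auto simp: facet_data_def primitive_Pair_0)
  next
    fix l d assume ld: "(l, d) \<in> facet_data P2"
    have "(P1 \<times> P2) \<inter> hyperplane (0, l) d = P1 \<times> (P2 \<inter> hyperplane l d)"
      by (auto simp: hyperplane_Pair_0)
    moreover have "(P1 \<times> (P2 \<inter> hyperplane l d)) facet_of (P1 \<times> P2)"
      using facet_dataD(4)[OF ld] ne face_self face_of_Times dimP
      by (auto simp: facet_of_def aff_dim_Times)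
    ultimately show "((0, l), d) \<in> facet_data (P1 \<times> P2)"
      using ld by (auto simp: facet_data_def primitive_Pair_0)
  qed
  show "facet_data (P1 \<times> P2) \<subseteq> ?R1 \<union> ?R2"
  proof
    fix z assume z: "z \<in> facet_data (P1 \<times> P2)"
    obtain l1 l2 d where zd: "z = ((l1, l2), d)" by (metis surj_pair)
    note fd = facet_dataD[OF z[unfolded zd]]
    let ?F = "(P1 \<times> P2) \<inter> hyperplane (l1, l2) d"
    obtain F1 F2 where F: "F1 face_of P1" "F2 face_of P2" "?F = F1 \<times> F2"
      using fd(4) unfolding facet_of_def face_of_Times_decomp by blast
    have F0: "F1 \<noteq> {}" "F2 \<noteq> {}" and dF: "aff_dim F1 + aff_dim F2 = aff_dim P1 + aff_dim P2 - 1"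
      using fd(4) F(3) aff_dim_Times[of F1 F2] dimP by (auto simp: facet_of_def)
    have eq: "l1 \<bullet> x + l2 \<bullet> y + of_int d = 0" if "x \<in> F1" "y \<in> F2" for x y
    proof -
      have "(x, y) \<in> ?F" using that F(3) by auto
      then show ?thesis by (simp add: hyperplane_def)
    qed
    have le: "aff_dim F1 \<le> aff_dim P1" "aff_dim F2 \<le> aff_dim P2"
      using F(1,2) face_of_imp_subset aff_dim_subset by blast+
    have "aff_dim F1 = aff_dim P1 \<or> aff_dim F2 = aff_dim P2" using dF le by linarith
    then show "z \<in> ?R1 \<union> ?R2"
    proof
      assume "aff_dim F1 = aff_dim P1"
      then have F1: "F1 = P1" using face_of_aff_dim_eq conv F(1) by blast
      obtain y where y: "y \<in> F2" using F0 by auto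
      have "l1 \<bullet> x = - (l2 \<bullet> y + of_int d)" if "x \<in> P1" for x
        using eq[of x y] that y F1 by simp
      then have l1: "l1 = 0" using zero_if_constant_on_interior[OF int(1)] by blast
      have "?F = P1 \<times> (P2 \<inter> hyperplane l2 d)" unfolding l1 by (auto simp: hyperplane_Pair_0)
      then have "F2 = P2 \<inter> hyperplane l2 d" using F(3) F1 ne by auto
      then have "(P2 \<inter> hyperplane l2 d) facet_of P2"
        using F(2) F0 dF F1 by (simp add: facet_of_def)
      moreover have "primitive l2" using fd(2) l1 by (simp add: primitive_Pair_0)
      moreover have "0 \<le> l2 \<bullet> y + of_int d" if "y \<in> P2" for y
        using fd(3)[of "(_, y)"] that ne l1 by auto
      ultimately have "(l2, d) \<in> facet_data P2" by (simp add: facet_data_def)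
      then show ?thesis unfolding zd l1 by (auto intro: rev_image_eqI)
    next
      assume "aff_dim F2 = aff_dim P2"
      then have F2: "F2 = P2" using face_of_aff_dim_eq conv F(2) by blast
      obtain x where x: "x \<in> F1" using F0 by auto
      have "l2 \<bullet> y = - (l1 \<bullet> x + of_int d)" if "y \<in> P2" for y
        using eq[of x y] that x F2 by simp
      then have l2: "l2 = 0" using zero_if_constant_on_interior[OF int(2)] by blast
      have "?F = (P1 \<inter> hyperplane l1 d) \<times> P2" unfolding l2 by (auto simp: hyperplane_Pair_0)
      then have "F1 = P1 \<inter> hyperplane l1 d" using F(3) F2 ne by auto
      then have "(P1 \<inter> hyperplane l1 d) facet_of P1"
        using F(1) F0 dF F2 by (simp add: facet_of_def)
      moreover have "primitive l1" using fd(2) l2 by (simp add: primitive_Pair_0)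
      moreover have "0 \<le> l1 \<bullet> x + of_int d" if "x \<in> P1" for x
        using fd(3)[of "(x, _)"] that ne l2 by auto
      ultimately have "(l1, d) \<in> facet_data P1" by (simp add: facet_data_def)
      then show ?thesis unfolding zd l2 by (auto intro: rev_image_eqI)
    qed
  qed
qed

subsection \<open>Integration over the boundary\<close>

lemma set_integrable_compact:
  fixes F :: "'a::euclidean_space \<Rightarrow> real"
  assumes M: "sets M = sets borel" and K: "compact K" and F: "continuous_on K F"
    and fin: "emeasure M K < \<infinity>"
  shows "set_integrable M K F"
proof -
  have Kb: "K \<in> sets borel" using K by (simp add: borel_closed compact_imp_closed)
  have m: "(\<lambda>x. indicator K x *\<^sub>R F x) \<in> borel_measurable M"
    using borel_measurable_continuous_on_indicator[OF Kb F] M measurable_cong_sets by blast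
  obtain B where B: "\<And>x. x \<in> K \<Longrightarrow> norm (F x) \<le> B"
    using compact_imp_bounded[OF compact_continuous_image[OF F K]] by (auto simp: bounded_iff)
  show ?thesis unfolding set_integrable_def
    by (rule integrableI_bounded_set[of K _ _ B]) (use Kb M m fin B in auto)
qed

section \<open>The boundary integral as a sum over facets\<close>

text \<open>One summand of \<open>bd_measure\<close> as a genuine measure, so that countable
  additivity of the sum is inherited from the summands.\<close>

definition facet_measure :: "'a::euclidean_space set \<Rightarrow> 'a \<times> int \<Rightarrow> 'a measure" where
  "facet_measure P j = density (flat_lborel (hyperplane (fst j) (snd j)))
     (\<lambda>x. ennreal (1 / norm (fst j) * indicator (P \<inter> hyperplane (fst j) (snd j)) x))"

text \<open>The form in which boundary integrals are handled: a finite sum of integrals over single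
  facets, each of which splits on a product. For continuous functions \<open>LINT_bd_measure\<close>
  identifies it with the integral against \<open>bd_measure\<close>.\<close>

definition bd_int :: "'a::euclidean_space set \<Rightarrow> ('a \<Rightarrow> real) \<Rightarrow> real" where
  "bd_int P F = (\<Sum>(l, d)\<in>facet_data P.
     1 / norm l * (LINT x:P \<inter> hyperplane l d|flat_lborel (hyperplane l d). F x))"

lemma
  assumes "l \<noteq> 0"
  shows sets_flat_hyperplane: "sets (flat_lborel (hyperplane l d)) = sets borel"
    and sigma_finite_flat_hyperplane: "sigma_finite_measure (flat_lborel (hyperplane l d))"
    and emeasure_flat_hyperplane_finite: "bounded A \<Longrightarrow> emeasure (flat_lborel (hyperplane l d)) A < \<infinity>"
  using hyperplane_frame[OF assms, of d] sets_flat_lborel sigma_finite_flat_lborel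
    emeasure_flat_bounded_finite by metis+

lemma compact_facet: "integral_delzant P \<Longrightarrow> compact (P \<inter> hyperplane l d)"
  by (simp add: closed_hyperplane' compact_Int_closed delzant_compact)

lemma sets_facet_measure:
  assumes "j \<in> facet_data P"
  shows "sets (facet_measure P j) = sets borel"
  using assms facet_dataD(1)[of "fst j" "snd j" P]
  by (simp add: facet_measure_def sets_flat_hyperplane)

lemma emeasure_facet_measure:
  assumes P: "integral_delzant P" and j: "(l, d) \<in> facet_data P" and A: "A \<in> sets borel"
  shows "emeasure (facet_measure P (l, d)) A =
    ennreal (1 / norm l) * emeasure (flat_lborel (hyperplane l d)) (A \<inter> (P \<inter> hyperplane l d))"
proof -
  let ?F = "P \<inter> hyperplane l d" and ?m = "flat_lborel (hyperplane l d)"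
  note s = sets_flat_hyperplane[OF facet_dataD(1)[OF j], of d]
  have F: "?F \<in> sets borel" using compact_facet[OF P] by (simp add: borel_closed compact_imp_closed)
  have m: "(\<lambda>x. ennreal (1 / norm l * indicator ?F x)) \<in> borel_measurable ?m"
    unfolding measurable_cong_sets[OF s refl] using F by measurable
  have "emeasure (facet_measure P (l, d)) A =
      (\<integral>\<^sup>+x. ennreal (1 / norm l * indicator ?F x) * indicator A x \<partial>?m)"
    unfolding facet_measure_def fst_conv snd_conv using A s m by (intro emeasure_density) auto
  also have "\<dots> = (\<integral>\<^sup>+x. ennreal (1 / norm l) * indicator (A \<inter> ?F) x \<partial>?m)"
    by (intro nn_integral_cong) (auto simp: indicator_def)
  also have "\<dots> = ennreal (1 / norm l) * emeasure ?m (A \<inter> ?F)"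
    using A F s by (intro nn_integral_cmult_indicator) auto
  finally show ?thesis .
qed

lemma sets_bd_measure: "sets (bd_measure P) = sets borel"
  unfolding bd_measure_def using sets.sigma_sets_eq[of borel]
  by (subst sets_measure_of) auto

text \<open>\<open>measure_of\<close> yields the zero measure unless the set function is a measure,
  so countable additivity has to be established before any value of \<open>bd_measure\<close> is
  known. It follows by exchanging the sum over facets with the countable sum.\<close>

lemma emeasure_bd_measure:
  assumes P: "integral_delzant P" and A: "A \<in> sets borel"
  shows "emeasure (bd_measure P) A = (\<Sum>j\<in>facet_data P. emeasure (facet_measure P j) A)"
proof -
  let ?\<mu> = "\<lambda>A. \<Sum>(l, d)\<in>facet_data P.
        ennreal (1 / norm l) * emeasure (flat_lborel (hyperplane l d)) (A \<inter> (P \<inter> hyperplane l d))"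
  have eq: "?\<mu> A = (\<Sum>j\<in>facet_data P. emeasure (facet_measure P j) A)" if "A \<in> sets borel" for A
    using that by (intro sum.cong refl) (auto simp: emeasure_facet_measure[OF P])
  have "emeasure (bd_measure P) A = ?\<mu> A"
  proof (rule emeasure_measure_of[OF bd_measure_def])
    show "positive (sets (bd_measure P)) ?\<mu>" by (auto simp: positive_def)
    show "countably_additive (sets (bd_measure P)) ?\<mu>"
      unfolding countably_additive_def sets_bd_measure
    proof (intro allI impI)
      fix A :: "nat \<Rightarrow> 'a set"
      assume A: "range A \<subseteq> sets borel" "disjoint_family A" "\<Union>(range A) \<in> sets borel"
      have "(\<Sum>i. ?\<mu> (A i)) = (\<Sum>i. \<Sum>j\<in>facet_data P. emeasure (facet_measure P j) (A i))"
        using A(1) by (intro suminf_cong eq) auto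
      also have "\<dots> = (\<Sum>j\<in>facet_data P. \<Sum>i. emeasure (facet_measure P j) (A i))"
        by (rule suminf_sum) simp
      also have "\<dots> = (\<Sum>j\<in>facet_data P. emeasure (facet_measure P j) (\<Union>(range A)))"
        using A by (intro sum.cong refl suminf_emeasure) (auto simp: sets_facet_measure)
      also have "\<dots> = ?\<mu> (\<Union>(range A))" using A by (intro eq[symmetric]) auto
      finally show "(\<Sum>i. ?\<mu> (A i)) = ?\<mu> (\<Union>(range A))" .
    qed
  qed (use A in \<open>auto simp: sets_bd_measure\<close>)
  then show ?thesis using eq[OF A] by simp
qed

lemma nn_integral_bd_measure:
  assumes P: "integral_delzant P" and g: "g \<in> borel_measurable borel"
  shows "(\<integral>\<^sup>+x. g x \<partial>bd_measure P) = (\<Sum>j\<in>facet_data P. \<integral>\<^sup>+x. g x \<partial>facet_measure P j)"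
proof -
  have mb: "f \<in> borel_measurable borel \<Longrightarrow> f \<in> borel_measurable (bd_measure P)" for f :: "'a \<Rightarrow> ennreal"
    using measurable_cong_sets[OF sets_bd_measure refl] by blast
  have mf: "f \<in> borel_measurable borel \<Longrightarrow> j \<in> facet_data P \<Longrightarrow> f \<in> borel_measurable (facet_measure P j)"
    for f :: "'a \<Rightarrow> ennreal" and j
    using measurable_cong_sets[OF sets_facet_measure refl] by blast
  show ?thesis
    using g
  proof (induction rule: borel_measurable_induct)
    case (cong f g)
    then show ?case by simp
  next
    case (set A)
    then show ?case
      by (simp add: emeasure_bd_measure[OF P] sets_bd_measure sets_facet_measure)
  next
    case (mult u c)
    then show ?case
      by (simp add: nn_integral_cmult mb mf sum_distrib_left)
  next
    case (add u v)
    then show ?case by (simp add: nn_integral_add mb mf sum.distrib)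
  next
    case (seq U)
    have inc: "incseq (\<lambda>i. \<integral>\<^sup>+x. U i x \<partial>M)" for M
      using seq by (intro incseq_nn_integral)
    have "(\<integral>\<^sup>+x. (SUP i. U i) x \<partial>bd_measure P) = (SUP i. \<integral>\<^sup>+x. U i x \<partial>bd_measure P)"
      unfolding SUP_apply using seq by (intro nn_integral_monotone_convergence_SUP mb) auto
    also have "\<dots> = (SUP i. \<Sum>j\<in>facet_data P. \<integral>\<^sup>+x. U i x \<partial>facet_measure P j)"
      using seq.IH by simp
    also have "\<dots> = (\<Sum>j\<in>facet_data P. SUP i. \<integral>\<^sup>+x. U i x \<partial>facet_measure P j)"
      by (rule ennreal_SUP_sum) (rule inc)
    also have "\<dots> = (\<Sum>j\<in>facet_data P. \<integral>\<^sup>+x. (SUP i. U i) x \<partial>facet_measure P j)"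
      unfolding SUP_apply using seq
      by (intro sum.cong refl nn_integral_monotone_convergence_SUP[symmetric] mf) auto
    finally show ?case .
  qed
qed

lemma emeasure_bd_measure_finite:
  assumes P: "integral_delzant P" and A: "A \<in> sets borel"
  shows "emeasure (bd_measure P) A < \<infinity>"
proof -
  have "emeasure (facet_measure P j) A < \<infinity>" if "j \<in> facet_data P" for j
  proof -
    obtain l d where j: "j = (l, d)" by (cases j)
    have "emeasure (flat_lborel (hyperplane l d)) (A \<inter> (P \<inter> hyperplane l d)) < \<infinity>"
      using that j facet_dataD(1)
      by (intro emeasure_flat_hyperplane_finite)
         (auto intro: bounded_subset[OF compact_imp_bounded[OF delzant_compact[OF P]]])
    then show ?thesis
      using that unfolding j by (simp add: emeasure_facet_measure[OF P _ A] ennreal_mult_less_top)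
  qed
  then show ?thesis
    by (simp add: emeasure_bd_measure[OF P A] ennreal_sum_less_top finite_facet_data[OF P])
qed

lemma compact_frontier_delzant: "integral_delzant P \<Longrightarrow> compact (frontier P)"
  by (simp add: compact_frontier delzant_compact)

lemma set_integrable_bd:
  fixes F :: "'a::euclidean_space \<Rightarrow> real"
  assumes P: "integral_delzant P" and F: "continuous_on UNIV F"
  shows "set_integrable (bd_measure P) (frontier P) F"
proof (rule set_integrable_compact[OF sets_bd_measure compact_frontier_delzant[OF P]])
  show "emeasure (bd_measure P) (frontier P) < \<infinity>"
    by (intro emeasure_bd_measure_finite[OF P] borel_closed frontier_closed)
qed (use F continuous_on_subset in blast)

lemma set_integrable_facet:
  fixes F :: "'a::euclidean_space \<Rightarrow> real"
  assumes P: "integral_delzant P" and F: "continuous_on UNIV F" and l: "l \<noteq> 0"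
  shows "set_integrable (flat_lborel (hyperplane l d)) (P \<inter> hyperplane l d) F"
proof (rule set_integrable_compact[OF sets_flat_hyperplane[OF l] compact_facet[OF P]])
  show "emeasure (flat_lborel (hyperplane l d)) (P \<inter> hyperplane l d) < \<infinity>"
    by (intro emeasure_flat_hyperplane_finite[OF l] compact_imp_bounded compact_facet[OF P])
qed (use F continuous_on_subset in blast)

text \<open>Nonnegative integrals add up over the facet measures. General continuous functions are
  reduced to this case by their positive and negative parts.\<close>

lemma LINT_bd_measure_nonneg:
  assumes P: "integral_delzant P" and F: "continuous_on UNIV F" and nn: "\<And>x. F x \<ge> 0"
  shows "(LINT x:frontier P|bd_measure P. F x) = bd_int P F"
proof -
  let ?u = "\<lambda>x. indicator (frontier P) x *\<^sub>R F x"
  have fr: "frontier P \<in> sets borel"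
    using compact_frontier_delzant[OF P] by (simp add: borel_closed compact_imp_closed)
  have u: "?u \<in> borel_measurable borel"
    by (rule borel_measurable_continuous_on_indicator[OF fr continuous_on_subset[OF F]]) simp
  have u0: "\<And>x. 0 \<le> ?u x" using nn by simp
  have facet: "(\<integral>\<^sup>+x. ennreal (?u x) \<partial>facet_measure P (l, d)) < \<infinity> \<and>
      enn2real (\<integral>\<^sup>+x. ennreal (?u x) \<partial>facet_measure P (l, d)) =
      1 / norm l * (LINT x:P \<inter> hyperplane l d|flat_lborel (hyperplane l d). F x)"
    if j: "(l, d) \<in> facet_data P" for l d
  proof -
    let ?F = "P \<inter> hyperplane l d" and ?m = "flat_lborel (hyperplane l d)"
    have l: "l \<noteq> 0" using facet_dataD(1)[OF j] .
    note s = sets_flat_hyperplane[OF l, of d]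
    have Fb: "?F \<in> sets borel" using compact_facet[OF P] by (simp add: borel_closed compact_imp_closed)
    have m: "(\<lambda>x. 1 / norm l * indicator ?F x) \<in> borel_measurable ?m"
      unfolding measurable_cong_sets[OF s refl] using Fb by measurable
    have um: "?u \<in> borel_measurable ?m"
      unfolding measurable_cong_sets[OF s refl] by (rule u)
    have sub: "?F \<subseteq> frontier P"
      using facet_subset_frontier[OF j] delzant_compact[OF P] compact_imp_closed by blast
    \<comment> \<open>On a facet the cut-off at the frontier disappears, because the facet lies in
      the frontier.\<close>
    have eq: "(1 / norm l * indicator ?F x) *\<^sub>R ?u x = 1 / norm l * (indicator ?F x *\<^sub>R F x)" for x
      using sub by (auto simp: indicator_def)
    have int: "integrable ?m (\<lambda>x. 1 / norm l * (indicator ?F x *\<^sub>R F x))"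
      using set_integrable_facet[OF P F l, of d] unfolding set_integrable_def by (rule integrable_mult_right)
    have "integrable (facet_measure P (l, d)) ?u"
      unfolding facet_measure_def fst_conv snd_conv
      by (subst integrable_density[OF um m]) (use int in \<open>auto simp only: eq intro!: AE_I2\<close>, simp)
    moreover have "integral\<^sup>L (facet_measure P (l, d)) ?u = integral\<^sup>L ?m (\<lambda>x. 1 / norm l * (indicator ?F x *\<^sub>R F x))"
      unfolding facet_measure_def fst_conv snd_conv
      by (subst integral_density[OF um m]) (auto simp only: eq intro!: AE_I2, simp)
    moreover have "0 \<le> integral\<^sup>L (facet_measure P (l, d)) ?u"
      using u0 by (intro integral_nonneg_AE) simp
    ultimately have "(\<integral>\<^sup>+x. ennreal (?u x) \<partial>facet_measure P (l, d)) =
        ennreal (1 / norm l * (LINT x:?F|?m. F x))" "0 \<le> 1 / norm l * (LINT x:?F|?m. F x)"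
      using u0 nn_integral_eq_integral[of "facet_measure P (l, d)" ?u]
      unfolding set_lebesgue_integral_def by (simp_all only: integral_mult_right_zero AE_I2 simp_thms)
    then show ?thesis by simp
  qed
  have "(LINT x:frontier P|bd_measure P. F x) = enn2real (\<integral>\<^sup>+x. ennreal (?u x) \<partial>bd_measure P)"
    unfolding set_lebesgue_integral_def
    using u u0 measurable_cong_sets[OF sets_bd_measure refl] by (intro integral_eq_nn_integral) blast+
  also have "\<dots> = enn2real (\<Sum>j\<in>facet_data P. \<integral>\<^sup>+x. ennreal (?u x) \<partial>facet_measure P j)"
    using u by (subst nn_integral_bd_measure[OF P]) auto
  also have "\<dots> = (\<Sum>j\<in>facet_data P. enn2real (\<integral>\<^sup>+x. ennreal (?u x) \<partial>facet_measure P j))"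
    using facet by (subst enn2real_sum) (auto simp: o_def)
  also have "\<dots> = bd_int P F"
    unfolding bd_int_def using facet by (intro sum.cong refl) auto
  finally show ?thesis .
qed

lemma bd_int_diff:
  assumes P: "integral_delzant P" and F: "continuous_on UNIV F" and G: "continuous_on UNIV G"
  shows "bd_int P (\<lambda>x. F x - G x) = bd_int P F - bd_int P G"
  unfolding bd_int_def
  using set_integrable_facet[OF P F] set_integrable_facet[OF P G]
  by (subst sum_subtractf[symmetric], intro sum.cong refl)
     (auto simp: set_integral_diff right_diff_distrib facet_dataD(1) diff_divide_distrib)

lemma LINT_bd_measure:
  assumes P: "integral_delzant P" and F: "continuous_on UNIV F"
  shows "(LINT x:frontier P|bd_measure P. F x) = bd_int P F"
proof -
  let ?p = "\<lambda>x. max (F x) 0" and ?n = "\<lambda>x. max (- F x) 0"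
  have c: "continuous_on UNIV ?p" "continuous_on UNIV ?n" using F by (auto intro!: continuous_intros)
  have eq: "F = (\<lambda>x. ?p x - ?n x)" by (auto simp: max_def)
  have "(LINT x:frontier P|bd_measure P. ?p x - ?n x) =
      (LINT x:frontier P|bd_measure P. ?p x) - (LINT x:frontier P|bd_measure P. ?n x)"
    using set_integrable_bd[OF P] c by (intro set_integral_diff)
  also have "\<dots> = bd_int P ?p - bd_int P ?n"
    using LINT_bd_measure_nonneg[OF P] c by simp
  also have "\<dots> = bd_int P (\<lambda>x. ?p x - ?n x)" by (rule bd_int_diff[OF P c, symmetric])
  finally show ?thesis using eq by simp
qed

text \<open>A continuous function on a compact product of finite mass is integrable, so both orders
  of integration agree. The inner integrals are claimed to be integrable, which is what averaging
  over the other variable requires.\<close>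

lemma
  fixes F :: "'a::euclidean_space \<times> 'b::euclidean_space \<Rightarrow> real"
  assumes sf: "sigma_finite_measure M1" "sigma_finite_measure M2"
    and s: "sets M1 = sets borel" "sets M2 = sets borel"
    and K: "compact K1" "compact K2" and fin: "emeasure M1 K1 < \<infinity>" "emeasure M2 K2 < \<infinity>"
    and F: "continuous_on UNIV F"
  shows set_integral_Times_fst: "(LINT z:K1 \<times> K2|M1 \<Otimes>\<^sub>M M2. F z) = (LINT x:K1|M1. LINT y:K2|M2. F (x, y))"
    and set_integral_Times_snd: "(LINT z:K1 \<times> K2|M1 \<Otimes>\<^sub>M M2. F z) = (LINT y:K2|M2. LINT x:K1|M1. F (x, y))"
    and set_integrable_Times_fst: "set_integrable M1 K1 (\<lambda>x. LINT y:K2|M2. F (x, y))"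
    and set_integrable_Times_snd: "set_integrable M2 K2 (\<lambda>y. LINT x:K1|M1. F (x, y))"
proof -
  interpret M1: sigma_finite_measure M1 by fact
  interpret M2: sigma_finite_measure M2 by fact
  interpret pair_sigma_finite M1 M2 ..
  let ?G = "\<lambda>z. indicator (K1 \<times> K2) z *\<^sub>R F z"
  have s12: "sets (M1 \<Otimes>\<^sub>M M2) = sets borel"
    by (simp only: sets_pair_measure_cong[OF s] borel_prod)
  have Kb: "K1 \<in> sets M1" "K2 \<in> sets M2" using K s by (auto simp: borel_closed compact_imp_closed)
  have "set_integrable (M1 \<Otimes>\<^sub>M M2) (K1 \<times> K2) F"
    using K fin Kb by (intro set_integrable_compact s12 compact_Times continuous_on_subset[OF F])
      (auto simp: M2.emeasure_pair_measure_Times ennreal_mult_less_top)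
  then have int: "integrable (M1 \<Otimes>\<^sub>M M2) (\<lambda>(x, y). ?G (x, y))"
    by (simp add: set_integrable_def case_prod_unfold)
  have e1: "(\<integral>y. ?G (x, y) \<partial>M2) = indicator K1 x *\<^sub>R (LINT y:K2|M2. F (x, y))" for x
    unfolding set_lebesgue_integral_def by (simp add: indicator_times mult.assoc)
  have e2: "(\<integral>x. ?G (x, y) \<partial>M1) = indicator K2 y *\<^sub>R (LINT x:K1|M1. F (x, y))" for y
    unfolding set_lebesgue_integral_def
    by (simp add: indicator_times mult.assoc mult.left_commute[of _ "indicator K2 y"])
  show "(LINT z:K1 \<times> K2|M1 \<Otimes>\<^sub>M M2. F z) = (LINT x:K1|M1. LINT y:K2|M2. F (x, y))"
    unfolding set_lebesgue_integral_def[of _ "K1 \<times> K2"] set_lebesgue_integral_def[of _ K1]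
    using integral_fst[OF int] unfolding e1 by (simp add: case_prod_unfold)
  show "(LINT z:K1 \<times> K2|M1 \<Otimes>\<^sub>M M2. F z) = (LINT y:K2|M2. LINT x:K1|M1. F (x, y))"
    unfolding set_lebesgue_integral_def[of _ "K1 \<times> K2"] set_lebesgue_integral_def[of _ K2]
    using integral_snd[OF int] unfolding e2 by (simp add: case_prod_unfold)
  show "set_integrable M1 K1 (\<lambda>x. LINT y:K2|M2. F (x, y))"
    unfolding set_integrable_def using integrable_fst[OF int] unfolding e1 .
  show "set_integrable M2 K2 (\<lambda>y. LINT x:K1|M1. F (x, y))"
    unfolding set_integrable_def using integrable_snd[OF int] unfolding e2 .
qed

section \<open>Linear functionals on continuous functions\<close>

definition vol_int :: "'a::euclidean_space set \<Rightarrow> ('a \<Rightarrow> real) \<Rightarrow> real" where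
  "vol_int P F = (LINT x:P|lborel. F x)"

text \<open>Linearity is asked for continuous arguments: a non-integrable function has integral 0 by
  convention, so additivity fails for arbitrary functions. The one notion serves boundary integrals,
  volume integrals with a continuous weight, and the excess.\<close>

definition linear_on_cont :: "(('a::euclidean_space \<Rightarrow> real) \<Rightarrow> real) \<Rightarrow> bool" where
  "linear_on_cont \<Lambda> \<longleftrightarrow>
     (\<forall>F G. continuous_on UNIV F \<longrightarrow> continuous_on UNIV G \<longrightarrow> \<Lambda> (\<lambda>x. F x + G x) = \<Lambda> F + \<Lambda> G) \<and>
     (\<forall>c F. continuous_on UNIV F \<longrightarrow> \<Lambda> (\<lambda>x. c * F x) = c * \<Lambda> F)"

lemma linear_on_contD:
  assumes "linear_on_cont \<Lambda>"
  shows "continuous_on UNIV F \<Longrightarrow> continuous_on UNIV G \<Longrightarrow> \<Lambda> (\<lambda>x. F x + G x) = \<Lambda> F + \<Lambda> G"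
    and "continuous_on UNIV F \<Longrightarrow> \<Lambda> (\<lambda>x. c * F x) = c * \<Lambda> F"
    and "continuous_on UNIV F \<Longrightarrow> continuous_on UNIV G \<Longrightarrow> \<Lambda> (\<lambda>x. F x - G x) = \<Lambda> F - \<Lambda> G"
proof -
  show add: "continuous_on UNIV F \<Longrightarrow> continuous_on UNIV G \<Longrightarrow> \<Lambda> (\<lambda>x. F x + G x) = \<Lambda> F + \<Lambda> G"
    for F G using assms by (simp add: linear_on_cont_def)
  show mult: "continuous_on UNIV F \<Longrightarrow> \<Lambda> (\<lambda>x. c * F x) = c * \<Lambda> F"
    for c F using assms by (simp add: linear_on_cont_def)
  show "continuous_on UNIV F \<Longrightarrow> continuous_on UNIV G \<Longrightarrow> \<Lambda> (\<lambda>x. F x - G x) = \<Lambda> F - \<Lambda> G"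
    using add[of F "\<lambda>x. (-1) * G x"] mult[of G "-1"] by (simp add: continuous_on_minus)
qed

lemma linear_on_cont_sum:
  assumes \<Lambda>: "linear_on_cont \<Lambda>" and "finite I" and F: "\<And>i. i \<in> I \<Longrightarrow> continuous_on UNIV (F i)"
  shows "\<Lambda> (\<lambda>x. \<Sum>i\<in>I. F i x) = (\<Sum>i\<in>I. \<Lambda> (F i))"
  using assms(2,3)
proof (induction I)
  case empty
  show ?case using linear_on_contD(2)[OF \<Lambda>, of "\<lambda>_. 0" 0] by simp
next
  case (insert i I)
  then show ?case by (simp add: linear_on_contD(1)[OF \<Lambda>] continuous_on_sum)
qed

lemma continuous_affine: "continuous_on UNIV (\<lambda>x. w \<bullet> (x, 1::real))"
  by (intro continuous_intros)

text \<open>Pairing with (x, 1) parametrizes the affine functions by the Euclidean space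
  \<open>'a \<times> real\<close>. A linear functional on them is thus given by finitely many
  values, which opens the way to linear algebra.\<close>

lemma linear_on_cont_affine:
  assumes \<Lambda>: "linear_on_cont \<Lambda>"
  shows "\<Lambda> (\<lambda>x. w \<bullet> (x, 1::real)) = (\<Sum>b\<in>Basis. (w \<bullet> b) * \<Lambda> (\<lambda>x. b \<bullet> (x, 1)))"
proof -
  have "\<Lambda> (\<lambda>x. w \<bullet> (x, 1::real)) = \<Lambda> (\<lambda>x. \<Sum>b\<in>Basis. (w \<bullet> b) * (b \<bullet> (x, 1)))"
    by (simp add: euclidean_inner[of w] inner_commute)
  also have "\<dots> = (\<Sum>b\<in>Basis. \<Lambda> (\<lambda>x. (w \<bullet> b) * (b \<bullet> (x, 1))))"
    by (intro linear_on_cont_sum[OF \<Lambda>] continuous_intros) simp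
  also have "\<dots> = (\<Sum>b\<in>Basis. (w \<bullet> b) * \<Lambda> (\<lambda>x. b \<bullet> (x, 1)))"
    by (intro sum.cong refl linear_on_contD(2)[OF \<Lambda>] continuous_affine)
  finally show ?thesis .
qed

lemma affine_fun_iff: "affine_fun f \<longleftrightarrow> (\<exists>w. f = (\<lambda>x. w \<bullet> (x, 1::real)))"
  unfolding affine_fun_def
proof
  assume "\<exists>a c. f = (\<lambda>x. a \<bullet> x + c)"
  then obtain a c where "f = (\<lambda>x. (a, c) \<bullet> (x, 1::real))" by auto
  then show "\<exists>w. f = (\<lambda>x. w \<bullet> (x, 1::real))" by blast
next
  assume "\<exists>w. f = (\<lambda>x. w \<bullet> (x, 1::real))"
  then obtain w where "f = (\<lambda>x. w \<bullet> (x, 1::real))" by blast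
  then show "\<exists>a c. f = (\<lambda>x. a \<bullet> x + c)" by (cases w) auto
qed

lemma affine_fun_continuous: "affine_fun f \<Longrightarrow> continuous_on UNIV f"
  unfolding affine_fun_def by (auto intro!: continuous_intros)

lemma set_integrable_vol:
  fixes F :: "'a::euclidean_space \<Rightarrow> real"
  assumes P: "compact P" and F: "continuous_on UNIV F"
  shows "set_integrable lborel P F"
proof (rule set_integrable_compact[OF sets_lborel P])
  show "emeasure lborel P < \<infinity>"
    using P compact_imp_bounded emeasure_bounded_finite by blast
qed (use F continuous_on_subset in blast)

lemma linear_vol_int:
  assumes P: "compact P" and h: "continuous_on UNIV h"
  shows "linear_on_cont (\<lambda>F. vol_int P (\<lambda>x. h x * F x))"
  unfolding linear_on_cont_def vol_int_def
proof (intro conjI allI impI)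
  fix F G :: "'a \<Rightarrow> real" assume "continuous_on UNIV F" "continuous_on UNIV G"
  then show "(LINT x:P|lborel. h x * (F x + G x)) = (LINT x:P|lborel. h x * F x) + (LINT x:P|lborel. h x * G x)"
    unfolding distrib_left using h by (intro set_integral_add set_integrable_vol P continuous_intros)
next
  fix c and F :: "'a \<Rightarrow> real"
  show "(LINT x:P|lborel. h x * (c * F x)) = c * (LINT x:P|lborel. h x * F x)"
    unfolding mult.left_commute[of _ c] by simp
qed

lemma linear_vol_int_1:
  assumes P: "compact P"
  shows "linear_on_cont (vol_int P)"
  using linear_vol_int[OF P, of "\<lambda>_. 1"] by simp

lemma vol_int_mono:
  assumes "compact P" "continuous_on UNIV F" "continuous_on UNIV G" "\<And>x. x \<in> P \<Longrightarrow> F x \<le> G x"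
  shows "vol_int P F \<le> vol_int P G"
  unfolding vol_int_def using assms by (intro set_integral_mono set_integrable_vol) auto

lemma vol_int_cong: "(\<And>x. x \<in> P \<Longrightarrow> F x = G x) \<Longrightarrow> vol_int P F = vol_int P G"
  unfolding vol_int_def set_lebesgue_integral_def
  by (intro Bochner_Integration.integral_cong refl) (auto simp: indicator_def)

lemma linear_bd_int:
  assumes P: "integral_delzant P"
  shows "linear_on_cont (bd_int P)"
  unfolding linear_on_cont_def
proof (intro conjI allI impI)
  fix F G :: "'a \<Rightarrow> real" assume F: "continuous_on UNIV F" and G: "continuous_on UNIV G"
  show "bd_int P (\<lambda>x. F x + G x) = bd_int P F + bd_int P G"
    using bd_int_diff[OF P, of "\<lambda>x. F x + G x" G] F G by (simp add: continuous_on_add)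
next
  fix c and F :: "'a \<Rightarrow> real" assume F: "continuous_on UNIV F"
  show "bd_int P (\<lambda>x. c * F x) = c * bd_int P F"
    unfolding bd_int_def sum_distrib_left by (intro sum.cong refl) auto
qed

lemma bd_int_mono:
  assumes P: "integral_delzant P" and F: "continuous_on UNIV F" and G: "continuous_on UNIV G"
    and le: "\<And>x. x \<in> P \<Longrightarrow> F x \<le> G x"
  shows "bd_int P F \<le> bd_int P G"
  unfolding bd_int_def
proof (rule sum_mono, clarify)
  fix l d assume "(l, d) \<in> facet_data P"
  then have "l \<noteq> 0" using facet_dataD(1) by blast
  then show "1 / norm l * (LINT x:P \<inter> hyperplane l d|flat_lborel (hyperplane l d). F x) \<le>
      1 / norm l * (LINT x:P \<inter> hyperplane l d|flat_lborel (hyperplane l d). G x)"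
    using le by (intro mult_left_mono set_integral_mono set_integrable_facet[OF P] F G) auto
qed

lemma continuous_slice:
  assumes "continuous_on UNIV F"
  shows "continuous_on UNIV (\<lambda>x. F (x, y))" "continuous_on UNIV (\<lambda>y. F (x, y))"
  by (rule continuous_on_compose2[OF assms]; auto intro!: continuous_intros)+

lemma
  fixes F :: "'a::euclidean_space \<times> 'b::euclidean_space \<Rightarrow> real"
  assumes P: "compact P1" "compact P2" and F: "continuous_on UNIV F"
  shows vol_int_Times_fst: "vol_int (P1 \<times> P2) F = vol_int P1 (\<lambda>x. vol_int P2 (\<lambda>y. F (x, y)))"
    and vol_int_Times_snd: "vol_int (P1 \<times> P2) F = vol_int P2 (\<lambda>y. vol_int P1 (\<lambda>x. F (x, y)))"
    and set_integrable_vol_fst: "set_integrable lborel P1 (\<lambda>x. vol_int P2 (\<lambda>y. F (x, y)))"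
    and set_integrable_vol_snd: "set_integrable lborel P2 (\<lambda>y. vol_int P1 (\<lambda>x. F (x, y)))"
proof -
  have fin: "emeasure lborel P1 < \<infinity>" "emeasure lborel P2 < \<infinity>"
    using P compact_imp_bounded emeasure_bounded_finite by blast+
  note * = sigma_finite_lborel sigma_finite_lborel sets_lborel sets_lborel P fin F
  show "vol_int (P1 \<times> P2) F = vol_int P1 (\<lambda>x. vol_int P2 (\<lambda>y. F (x, y)))"
    using set_integral_Times_fst[OF *] by (simp add: vol_int_def lborel_prod)
  show "vol_int (P1 \<times> P2) F = vol_int P2 (\<lambda>y. vol_int P1 (\<lambda>x. F (x, y)))"
    using set_integral_Times_snd[OF *] by (simp add: vol_int_def lborel_prod)
  show "set_integrable lborel P1 (\<lambda>x. vol_int P2 (\<lambda>y. F (x, y)))"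
    using set_integrable_Times_fst[OF *] by (simp add: vol_int_def)
  show "set_integrable lborel P2 (\<lambda>y. vol_int P1 (\<lambda>x. F (x, y)))"
    using set_integrable_Times_snd[OF *] by (simp add: vol_int_def)
qed

section \<open>Boundary integrals on a product\<close>

lemma
  assumes int: "\<And>i. i \<in> I \<Longrightarrow> set_integrable lborel P (F i)" and I: "finite I"
  shows vol_int_sum: "vol_int P (\<lambda>x. \<Sum>i\<in>I. F i x) = (\<Sum>i\<in>I. vol_int P (F i))"
    and set_integrable_sum': "set_integrable lborel P (\<lambda>x. \<Sum>i\<in>I. F i x)"
  using int unfolding vol_int_def set_lebesgue_integral_def set_integrable_def scaleR_sum_right
  by (auto intro!: Bochner_Integration.integral_sum Bochner_Integration.integrable_sum)

text \<open>The hyperplane with conormal (l, 0) is the hyperplane of \<open>l\<close> times the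
  whole second space, and its flat measure is the product with Lebesgue measure. Fubini then applies
  on each facet.\<close>

lemma
  fixes F :: "'a::euclidean_space \<times> 'b::euclidean_space \<Rightarrow> real"
  assumes P1: "integral_delzant P1" and P2: "compact P2" and F: "continuous_on UNIV F"
  shows set_integrable_bd_int_fst: "set_integrable lborel P2 (\<lambda>y. bd_int P1 (\<lambda>x. F (x, y)))"
    and bd_int_Times_fst: "vol_int P2 (\<lambda>y. bd_int P1 (\<lambda>x. F (x, y))) =
      (\<Sum>(l, d)\<in>facet_data P1. 1 / norm l *
        (LINT z:(P1 \<inter> hyperplane l d) \<times> P2|flat_lborel (hyperplane (l, 0::'b) d). F z))"
proof -
  let ?m = "\<lambda>l d. flat_lborel (hyperplane l d)"
  have f: "set_integrable lborel P2 (\<lambda>y. 1 / norm l * (LINT x:P1 \<inter> hyperplane l d|?m l d. F (x, y))) \<and>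
      vol_int P2 (\<lambda>y. 1 / norm l * (LINT x:P1 \<inter> hyperplane l d|?m l d. F (x, y))) =
      1 / norm l * (LINT z:(P1 \<inter> hyperplane l d) \<times> P2|?m (l, 0::'b) d. F z)"
    if "(l, d) \<in> facet_data P1" for l d
  proof -
    have l: "l \<noteq> 0" using that facet_dataD(1) by blast
    obtain p B where B: "is_frame (hyperplane l d) p B" using hyperplane_frame[OF l] .
    have fin: "emeasure (?m l d) (P1 \<inter> hyperplane l d) < \<infinity>" "emeasure lborel P2 < \<infinity>"
      using emeasure_flat_hyperplane_finite[OF l] compact_imp_bounded[OF compact_facet[OF P1]]
        emeasure_bounded_finite[OF compact_imp_bounded[OF P2]] by auto
    note * = sigma_finite_flat_hyperplane[OF l] sigma_finite_lborel sets_flat_hyperplane[OF l]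
      sets_lborel compact_facet[OF P1] P2 fin F
    show ?thesis
      unfolding hyperplane_Pair_0 flat_lborel_Times_UNIV(1)[OF B] set_integral_Times_snd[OF *] vol_int_def
      using set_integrable_Times_snd[OF *] by simp
  qed
  show "set_integrable lborel P2 (\<lambda>y. bd_int P1 (\<lambda>x. F (x, y)))"
    unfolding bd_int_def case_prod_unfold using f
    by (intro set_integrable_sum' finite_facet_data[OF P1]) auto
  show "vol_int P2 (\<lambda>y. bd_int P1 (\<lambda>x. F (x, y))) =
      (\<Sum>(l, d)\<in>facet_data P1. 1 / norm l *
        (LINT z:(P1 \<inter> hyperplane l d) \<times> P2|flat_lborel (hyperplane (l, 0::'b) d). F z))"
    unfolding bd_int_def case_prod_unfold using f
    by (subst vol_int_sum[OF _ finite_facet_data[OF P1]]) (auto intro!: sum.cong)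
qed

lemma
  fixes F :: "'a::euclidean_space \<times> 'b::euclidean_space \<Rightarrow> real"
  assumes P1: "compact P1" and P2: "integral_delzant P2" and F: "continuous_on UNIV F"
  shows set_integrable_bd_int_snd: "set_integrable lborel P1 (\<lambda>x. bd_int P2 (\<lambda>y. F (x, y)))"
    and bd_int_Times_snd: "vol_int P1 (\<lambda>x. bd_int P2 (\<lambda>y. F (x, y))) =
      (\<Sum>(l, d)\<in>facet_data P2. 1 / norm l *
        (LINT z:P1 \<times> (P2 \<inter> hyperplane l d)|flat_lborel (hyperplane (0::'a, l) d). F z))"
proof -
  let ?m = "\<lambda>l d. flat_lborel (hyperplane l d)"
  have f: "set_integrable lborel P1 (\<lambda>x. 1 / norm l * (LINT y:P2 \<inter> hyperplane l d|?m l d. F (x, y))) \<and>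
      vol_int P1 (\<lambda>x. 1 / norm l * (LINT y:P2 \<inter> hyperplane l d|?m l d. F (x, y))) =
      1 / norm l * (LINT z:P1 \<times> (P2 \<inter> hyperplane l d)|?m (0::'a, l) d. F z)"
    if "(l, d) \<in> facet_data P2" for l d
  proof -
    have l: "l \<noteq> 0" using that facet_dataD(1) by blast
    obtain p B where B: "is_frame (hyperplane l d) p B" using hyperplane_frame[OF l] .
    have fin: "emeasure lborel P1 < \<infinity>" "emeasure (?m l d) (P2 \<inter> hyperplane l d) < \<infinity>"
      using emeasure_flat_hyperplane_finite[OF l] compact_imp_bounded[OF compact_facet[OF P2]]
        emeasure_bounded_finite[OF compact_imp_bounded[OF P1]] by auto
    note * = sigma_finite_lborel sigma_finite_flat_hyperplane[OF l] sets_lborel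
      sets_flat_hyperplane[OF l] P1 compact_facet[OF P2] fin F
    show ?thesis
      unfolding hyperplane_Pair_0 flat_lborel_Times_UNIV(2)[OF B] set_integral_Times_fst[OF *] vol_int_def
      using set_integrable_Times_fst[OF *] by simp
  qed
  show "set_integrable lborel P1 (\<lambda>x. bd_int P2 (\<lambda>y. F (x, y)))"
    unfolding bd_int_def case_prod_unfold using f
    by (intro set_integrable_sum' finite_facet_data[OF P2]) auto
  show "vol_int P1 (\<lambda>x. bd_int P2 (\<lambda>y. F (x, y))) =
      (\<Sum>(l, d)\<in>facet_data P2. 1 / norm l *
        (LINT z:P1 \<times> (P2 \<inter> hyperplane l d)|flat_lborel (hyperplane (0::'a, l) d). F z))"
    unfolding bd_int_def case_prod_unfold using f
    by (subst vol_int_sum[OF _ finite_facet_data[OF P2]]) (auto intro!: sum.cong)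
qed

text \<open>This is the splitting of \<sigma>. The weights match because extending a conormal by a
  zero component keeps its norm.\<close>

lemma bd_int_Times:
  fixes F :: "'a::euclidean_space \<times> 'b::euclidean_space \<Rightarrow> real"
  assumes P1: "integral_delzant P1" and P2: "integral_delzant P2" and F: "continuous_on UNIV F"
  shows "bd_int (P1 \<times> P2) F = vol_int P2 (\<lambda>y. bd_int P1 (\<lambda>x. F (x, y)))
    + vol_int P1 (\<lambda>x. bd_int P2 (\<lambda>y. F (x, y)))"
proof -
  let ?A = "(\<lambda>(l, d). ((l, 0::'b), d)) ` facet_data P1"
  let ?B = "(\<lambda>(l, d). ((0::'a, l), d)) ` facet_data P2"
  let ?t = "\<lambda>(l, d). 1 / norm l * (LINT z:(P1 \<times> P2) \<inter> hyperplane l d|flat_lborel (hyperplane l d). F z)"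
  have fin: "finite ?A" "finite ?B" using finite_facet_data P1 P2 by blast+
  \<comment> \<open>Conormals are nonzero, so no pair is lifted from both factors.\<close>
  have disj: "?A \<inter> ?B = {}" using facet_dataD(1) by fastforce
  have "bd_int (P1 \<times> P2) F = sum ?t ?A + sum ?t ?B"
    unfolding bd_int_def facet_data_Times[OF P1 P2] by (rule sum.union_disjoint[OF fin disj])
  also have "sum ?t ?A = vol_int P2 (\<lambda>y. bd_int P1 (\<lambda>x. F (x, y)))"
  proof -
    have e: "(P1 \<times> P2) \<inter> hyperplane (l, 0) d = (P1 \<inter> hyperplane l d) \<times> P2" for l d
      by (auto simp: hyperplane_Pair_0)
    have "sum ?t ?A = sum (?t \<circ> (\<lambda>(l, d). ((l, 0), d))) (facet_data P1)"
      by (rule sum.reindex) (auto simp: inj_on_def)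
    then show ?thesis
      unfolding bd_int_Times_fst[OF P1 delzant_compact[OF P2] F]
      by (simp add: o_def case_prod_unfold e norm_Pair)
  qed
  also have "sum ?t ?B = vol_int P1 (\<lambda>x. bd_int P2 (\<lambda>y. F (x, y)))"
  proof -
    have e: "(P1 \<times> P2) \<inter> hyperplane (0, l) d = P1 \<times> (P2 \<inter> hyperplane l d)" for l d
      by (auto simp: hyperplane_Pair_0)
    have "sum ?t ?B = sum (?t \<circ> (\<lambda>(l, d). ((0, l), d))) (facet_data P2)"
      by (rule sum.reindex) (auto simp: inj_on_def)
    then show ?thesis
      unfolding bd_int_Times_snd[OF delzant_compact[OF P1] P2 F]
      by (simp add: o_def case_prod_unfold e norm_Pair)
  qed
  finally show ?thesis .
qed

subsection \<open>The density of the extremal function\<close>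

text \<open>The role of \<open>h\<close> is that of \<open>sbar P + extremal_fun P\<close>.\<close>

definition is_density :: "'a::euclidean_space set \<Rightarrow> ('a \<Rightarrow> real) \<Rightarrow> bool" where
  "is_density P h \<longleftrightarrow> affine_fun h \<and>
     (\<forall>l. affine_fun l \<longrightarrow> bd_int P l = vol_int P (\<lambda>x. h x * l x))"

text \<open>If g were nonzero at an interior point, it would be nonzero on a nonempty open subset of
  \<open>P\<close>, which is not negligible. This is the definiteness behind both uniqueness and
  existence of the density.\<close>

lemma vol_int_square_zero:
  assumes P: "compact P" and g: "continuous_on UNIV g" and 0: "vol_int P (\<lambda>x. g x * g x) = 0"
    and x: "x \<in> interior P"
  shows "g x = 0"
proof (rule ccontr)
  assume nz: "g x \<noteq> 0"
  let ?U = "interior P \<inter> {x. g x \<noteq> 0}"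
  have "open ?U" using g by (intro open_Int open_interior open_Collect_neq) auto
  have int: "integrable lborel (\<lambda>x. indicator P x *\<^sub>R (g x * g x))"
    using set_integrable_vol[OF P, of "\<lambda>x. g x * g x"] g
    by (auto simp: set_integrable_def intro!: continuous_intros)
  have "AE x in lborel. indicator P x *\<^sub>R (g x * g x) = 0"
    using 0 by (subst integral_nonneg_eq_0_iff_AE[OF int, symmetric])
      (auto simp: vol_int_def set_lebesgue_integral_def)
  then have "AE x in lborel. x \<notin> ?U"
    by eventually_elim (use interior_subset in \<open>auto simp: indicator_def\<close>)
  then have "?U \<in> null_sets lborel"
    using \<open>open ?U\<close> by (subst (asm) AE_iff_null_sets[symmetric]) auto
  then have "negligible ?U"
    by (simp add: negligible_iff_null_sets null_sets_completionI)
  then show False using open_not_negligible[OF \<open>open ?U\<close>] nz x by blast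
qed

lemma affine_zero_on_interior:
  assumes "x0 \<in> interior P" and 0: "\<And>x. x \<in> interior P \<Longrightarrow> w \<bullet> (x, 1::real) = 0"
  shows "w = 0"
proof -
  obtain a c where w: "w = (a, c)" by (cases w)
  have "a \<bullet> x = - c" if "x \<in> interior P" for x using 0[OF that] by (simp add: w)
  moreover have "interior (interior P) \<noteq> {}" using assms by auto
  ultimately have a: "a = 0" using zero_if_constant_on_interior[of "interior P"] by blast
  then show ?thesis using 0[OF assms(1)] by (simp add: w zero_prod_def)
qed

lemma is_density_unique:
  assumes P: "integral_delzant P" and h: "is_density P h" "is_density P h'"
  shows "h = h'"
proof -
  obtain w w' where w: "h = (\<lambda>x. w \<bullet> (x, 1::real))" "h' = (\<lambda>x. w' \<bullet> (x, 1::real))"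
    using h unfolding is_density_def affine_fun_iff by blast
  \<comment> \<open>The difference of the two densities is affine and hence an admissible test
    function; testing with it produces the integral of its square.\<close>
  let ?g = "\<lambda>x. (w - w') \<bullet> (x, 1::real)"
  have g: "affine_fun ?g" unfolding affine_fun_iff by blast
  have c: "continuous_on UNIV (\<lambda>x. h x * ?g x)" "continuous_on UNIV (\<lambda>x. h' x * ?g x)"
    unfolding w by (intro continuous_intros)+
  have "vol_int P (\<lambda>x. h x * ?g x) = vol_int P (\<lambda>x. h' x * ?g x)"
    using h g unfolding is_density_def by metis
  then have "vol_int P (\<lambda>x. h x * ?g x - h' x * ?g x) = 0"
    using linear_on_contD(3)[OF linear_vol_int_1[OF delzant_compact[OF P]] c] by simp
  then have "vol_int P (\<lambda>x. ?g x * ?g x) = 0"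
    by (simp add: w inner_diff_left left_diff_distrib)
  then have "?g x = 0" if "x \<in> interior P" for x
    using vol_int_square_zero[OF delzant_compact[OF P] continuous_affine _ that] by blast
  then have "w - w' = 0" using affine_zero_on_interior delzant_interior[OF P] by blast
  then show ?thesis by (simp add: w)
qed

text \<open>Existence: the Gram operator of the affine functions with respect to the volume form on \<open>P\<close>
  is injective, hence onto.\<close>

lemma is_density_exists:
  fixes P :: "'a::euclidean_space set"
  assumes P: "integral_delzant P"
  obtains h where "is_density P h"
proof -
  note K = delzant_compact[OF P]
  define T :: "'a \<times> real \<Rightarrow> 'a \<times> real" where
    "T u = (\<Sum>b\<in>Basis. vol_int P (\<lambda>x. (u \<bullet> (x, 1)) * (b \<bullet> (x, 1))) *\<^sub>R b)" for u
  have inner_sum_Basis: "(\<Sum>b\<in>Basis. f b *\<^sub>R b) \<bullet> w = (\<Sum>b\<in>Basis. (w \<bullet> b) * f b)"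
    for f and w :: "'a \<times> real"
    by (simp add: inner_sum_left inner_commute[of w] mult.commute)
  have T: "T u \<bullet> w = vol_int P (\<lambda>x. (u \<bullet> (x, 1)) * (w \<bullet> (x, 1)))" for u w
    unfolding T_def inner_sum_Basis
    by (rule linear_on_cont_affine[OF linear_vol_int[OF K continuous_affine], symmetric])
  have lin: "linear T"
  proof (rule linearI)
    fix u v :: "'a \<times> real" and r :: real
    have "T (u + v) \<bullet> w = (T u + T v) \<bullet> w" for w
      using linear_on_contD(1)[OF linear_vol_int[OF K continuous_affine[of w]]
          continuous_affine[of u] continuous_affine[of v]]
      by (simp only: T inner_add_left mult.commute[of _ "w \<bullet> _"])
    then show "T (u + v) = T u + T v" by (metis vector_eq_rdot)
    have "T (r *\<^sub>R u) \<bullet> w = (r *\<^sub>R T u) \<bullet> w" for w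
      using linear_on_contD(2)[OF linear_vol_int[OF K continuous_affine[of w]]
          continuous_affine[of u], of r]
      by (simp only: T inner_scaleR_left mult.commute[of _ "w \<bullet> _"])
    then show "T (r *\<^sub>R u) = r *\<^sub>R T u" by (metis vector_eq_rdot)
  qed
  have "u = 0" if "T u = 0" for u
  proof -
    have "vol_int P (\<lambda>x. (u \<bullet> (x, 1)) * (u \<bullet> (x, 1))) = 0"
      using T[of u u] that by simp
    then have "u \<bullet> (x, 1) = 0" if "x \<in> interior P" for x
      using vol_int_square_zero[OF K continuous_affine _ that] by blast
    then show ?thesis using affine_zero_on_interior delzant_interior[OF P] by blast
  qed
  then have "inj T" using lin by (simp add: linear_injective_0)
  then have "surj T" using lin linear_injective_imp_surjective by blast
  \<comment> \<open>The vector representing the boundary functional: its inner product with w is the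
    boundary integral of the affine function with coordinates w. A preimage under \<open>T\<close>
    gives the density.\<close>
  define t where "t = (\<Sum>b\<in>Basis. bd_int P (\<lambda>x. b \<bullet> (x, 1::real)) *\<^sub>R b)"
  obtain u where "t = T u" using surjD[OF \<open>surj T\<close>] by blast
  then have u: "T u = (\<Sum>b\<in>Basis. bd_int P (\<lambda>x. b \<bullet> (x, 1::real)) *\<^sub>R b)"
    by (simp only: t_def)
  have "is_density P (\<lambda>x. u \<bullet> (x, 1::real))"
    unfolding is_density_def
  proof (intro conjI allI impI)
    show "affine_fun (\<lambda>x. u \<bullet> (x, 1::real))" unfolding affine_fun_iff by blast
    fix l :: "'a \<Rightarrow> real" assume "affine_fun l"
    then obtain w where l: "l = (\<lambda>x. w \<bullet> (x, 1::real))" unfolding affine_fun_iff by blast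
    have "bd_int P l = (\<Sum>b\<in>Basis. (w \<bullet> b) * bd_int P (\<lambda>x. b \<bullet> (x, 1)))"
      unfolding l by (rule linear_on_cont_affine[OF linear_bd_int[OF P]])
    also have "\<dots> = T u \<bullet> w" unfolding u inner_sum_Basis ..
    also have "\<dots> = vol_int P (\<lambda>x. u \<bullet> (x, 1) * l x)" unfolding T l ..
    finally show "bd_int P l = vol_int P (\<lambda>x. u \<bullet> (x, 1) * l x)" .
  qed
  then show thesis using that by blast
qed

lemma affine_fun_shift:
  "affine_fun h \<Longrightarrow> affine_fun (\<lambda>x. h x - c)" "affine_fun h \<Longrightarrow> affine_fun (\<lambda>x. c + h x)"
proof -
  assume "affine_fun h"
  then obtain a d where h: "h = (\<lambda>x. a \<bullet> x + d)" unfolding affine_fun_def by blast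
  have "(\<lambda>x. h x - c) = (\<lambda>x. a \<bullet> x + (d - c))" "(\<lambda>x. c + h x) = (\<lambda>x. a \<bullet> x + (c + d))"
    by (auto simp: h)
  then show "affine_fun (\<lambda>x. h x - c)" "affine_fun (\<lambda>x. c + h x)"
    unfolding affine_fun_def by blast+
qed

text \<open>The condition on V involves V only through its sum with the constant
  \<open>sbar P\<close>, so that sum is an affine density, and there is exactly one. This is also
  what gives the definite description its meaning.\<close>

lemma extremal_fun_eq:
  assumes P: "integral_delzant P" and h: "is_density P h"
  shows "sbar P + extremal_fun P x = h x"
proof -
  have D: "(affine_fun V \<and> (\<forall>l. affine_fun l \<longrightarrow>
        (LINT x:frontier P|bd_measure P. l x) = (LINT x:P|lborel. (sbar P + V x) * l x))) \<longleftrightarrow>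
      affine_fun V \<and> is_density P (\<lambda>x. sbar P + V x)" for V
    using affine_fun_shift(2) LINT_bd_measure[OF P affine_fun_continuous]
    by (auto simp: is_density_def vol_int_def)
  have "extremal_fun P = (\<lambda>x. h x - sbar P)"
    unfolding extremal_fun_def D
  proof (rule the_equality)
    show "affine_fun (\<lambda>x. h x - sbar P) \<and> is_density P (\<lambda>x. sbar P + (h x - sbar P))"
      using h by (auto simp: is_density_def intro: affine_fun_shift(1))
    fix V assume V: "affine_fun V \<and> is_density P (\<lambda>x. sbar P + V x)"
    then have "(\<lambda>x. sbar P + V x) = h" using is_density_unique[OF P _ h] by blast
    then show "V = (\<lambda>x. h x - sbar P)" by auto
  qed
  then show ?thesis by simp
qed

text \<open>A test function is prescribed on \<open>P\<close> alone. Both integrals see no more than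
  that, since the closed set \<open>P\<close> contains its frontier, and so a continuous function on
  the whole space may replace it.\<close>

lemma L_V_eq:
  assumes P: "integral_delzant P" and h: "is_density P h" and F: "continuous_on UNIV F"
    and f: "\<And>x. x \<in> P \<Longrightarrow> f x = F x"
  shows "L_V P f = bd_int P F - vol_int P (\<lambda>x. h x * F x)"
proof -
  have "frontier P \<subseteq> P"
    using delzant_compact[OF P] compact_imp_closed frontier_subset_closed by blast
  then have "(LINT x:frontier P|bd_measure P. f x) = (LINT x:frontier P|bd_measure P. F x)"
    unfolding set_lebesgue_integral_def using f
    by (intro Bochner_Integration.integral_cong refl) (auto simp: indicator_def)
  moreover have "(LINT x:P|lborel. h x * f x) = (LINT x:P|lborel. h x * F x)"
    using f vol_int_cong[of P "\<lambda>x. h x * f x" "\<lambda>x. h x * F x"] by (simp add: vol_int_def)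
  ultimately show ?thesis
    unfolding L_V_def extremal_fun_eq[OF P h] LINT_bd_measure[OF P F] by (simp add: vol_int_def)
qed

text \<open>Slices of an affine function are affine, so the identity of each factor applies inside
  the integral over the other. With uniqueness of the density this settles the extremal function of
  the product.\<close>

lemma is_density_Times:
  fixes P1 :: "'a::euclidean_space set" and P2 :: "'b::euclidean_space set"
  assumes P1: "integral_delzant P1" and P2: "integral_delzant P2"
    and h1: "is_density P1 h1" and h2: "is_density P2 h2"
  shows "is_density (P1 \<times> P2) (\<lambda>z. h1 (fst z) + h2 (snd z))"
  unfolding is_density_def
proof (intro conjI allI impI)
  note K1 = delzant_compact[OF P1] and K2 = delzant_compact[OF P2]
  obtain a1 c1 a2 c2 where h: "h1 = (\<lambda>x. a1 \<bullet> x + c1)" "h2 = (\<lambda>x. a2 \<bullet> x + c2)"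
    using h1 h2 unfolding is_density_def affine_fun_def by blast
  have "(\<lambda>z. h1 (fst z) + h2 (snd z)) = (\<lambda>z. (a1, a2) \<bullet> z + (c1 + c2))"
    unfolding h by (auto simp: inner_prod_def)
  then show "affine_fun (\<lambda>z. h1 (fst z) + h2 (snd z))" unfolding affine_fun_def by blast
  fix l :: "'a \<times> 'b \<Rightarrow> real" assume l: "affine_fun l"
  then obtain a c where lac: "l = (\<lambda>z. a \<bullet> z + c)" unfolding affine_fun_def by blast
  have lc: "continuous_on UNIV l" using l by (rule affine_fun_continuous)
  have "affine_fun (\<lambda>x. l (x, y))" "affine_fun (\<lambda>y. l (x, y))" for x y
  proof -
    have "(\<lambda>x. l (x, y)) = (\<lambda>x. fst a \<bullet> x + (snd a \<bullet> y + c))" "(\<lambda>y. l (x, y)) = (\<lambda>y. snd a \<bullet> y + (fst a \<bullet> x + c))"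
      by (auto simp: lac inner_prod_def)
    then show "affine_fun (\<lambda>x. l (x, y))" "affine_fun (\<lambda>y. l (x, y))"
      unfolding affine_fun_def by blast+
  qed
  note sl = this
  have c: "continuous_on UNIV (\<lambda>z. h1 (fst z) * l z)" "continuous_on UNIV (\<lambda>z. h2 (snd z) * l z)"
    unfolding h using lc by (auto intro!: continuous_intros)
  have "bd_int (P1 \<times> P2) l = vol_int P2 (\<lambda>y. bd_int P1 (\<lambda>x. l (x, y)))
    + vol_int P1 (\<lambda>x. bd_int P2 (\<lambda>y. l (x, y)))"
    by (rule bd_int_Times[OF P1 P2 lc])
  also have "\<dots> = vol_int P2 (\<lambda>y. vol_int P1 (\<lambda>x. h1 x * l (x, y)))
    + vol_int P1 (\<lambda>x. vol_int P2 (\<lambda>y. h2 y * l (x, y)))"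
    using h1 h2 sl by (simp add: is_density_def)
  also have "\<dots> = vol_int (P1 \<times> P2) (\<lambda>z. h1 (fst z) * l z) + vol_int (P1 \<times> P2) (\<lambda>z. h2 (snd z) * l z)"
    using vol_int_Times_snd[OF K1 K2 c(1)] vol_int_Times_fst[OF K1 K2 c(2)] by simp
  also have "\<dots> = vol_int (P1 \<times> P2) (\<lambda>z. (h1 (fst z) + h2 (snd z)) * l z)"
    unfolding distrib_right
    by (rule linear_on_contD(1)[OF linear_vol_int_1 c, symmetric]) (intro compact_Times K1 K2)
  finally show "bd_int (P1 \<times> P2) l = vol_int (P1 \<times> P2) (\<lambda>z. (h1 (fst z) + h2 (snd z)) * l z)" .
qed

subsection \<open>Piecewise affine functions and the J-norm\<close>

text \<open>An indexed family rather than a set of affine functions: slicing or changing the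
  constants may make members coincide, but it keeps the index set.\<close>

definition pl :: "'i set \<Rightarrow> ('i \<Rightarrow> 'a::euclidean_space) \<Rightarrow> ('i \<Rightarrow> real) \<Rightarrow> 'a \<Rightarrow> real" where
  "pl I a c x = Max ((\<lambda>i. a i \<bullet> x + c i) ` I)"

lemma pl_le_iff: "finite I \<Longrightarrow> I \<noteq> {} \<Longrightarrow> pl I a c x \<le> r \<longleftrightarrow> (\<forall>i\<in>I. a i \<bullet> x + c i \<le> r)"
  by (simp add: pl_def)

lemma pl_ge: "finite I \<Longrightarrow> i \<in> I \<Longrightarrow> a i \<bullet> x + c i \<le> pl I a c x"
  by (simp add: pl_def)

lemma pl_attained:
  assumes "finite I" "I \<noteq> {}"
  obtains i where "i \<in> I" "pl I a c x = a i \<bullet> x + c i"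
proof -
  have "pl I a c x \<in> (\<lambda>i. a i \<bullet> x + c i) ` I"
    unfolding pl_def using assms by (intro Max_in) auto
  then show thesis using that by blast
qed

lemma pl_convex:
  assumes I: "finite I" "I \<noteq> {}"
  shows "convex_on UNIV (pl I a c)"
proof (rule convex_onI)
  fix t :: real and x y :: 'b assume t: "0 < t" "t < 1"
  show "pl I a c ((1 - t) *\<^sub>R x + t *\<^sub>R y) \<le> (1 - t) * pl I a c x + t * pl I a c y"
    unfolding pl_le_iff[OF I]
  proof
    fix i assume i: "i \<in> I"
    have "a i \<bullet> ((1 - t) *\<^sub>R x + t *\<^sub>R y) + c i = (1 - t) * (a i \<bullet> x + c i) + t * (a i \<bullet> y + c i)"
      by (simp add: inner_add_right algebra_simps)
    also have "\<dots> \<le> (1 - t) * pl I a c x + t * pl I a c y"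
      using t pl_ge[OF I(1) i] by (intro add_mono mult_left_mono) auto
    finally show "a i \<bullet> ((1 - t) *\<^sub>R x + t *\<^sub>R y) + c i \<le> (1 - t) * pl I a c x + t * pl I a c y" .
  qed
qed simp

lemma pl_continuous: "finite I \<Longrightarrow> I \<noteq> {} \<Longrightarrow> continuous_on UNIV (pl I a c)"
  using pl_convex convex_on_continuous open_UNIV by blast

lemma pl_perturb:
  assumes I: "finite I" "I \<noteq> {}" and e: "\<And>i. i \<in> I \<Longrightarrow> \<bar>q i - c i\<bar> \<le> e"
  shows "\<bar>pl I a q x - pl I a c x\<bar> \<le> e"
proof -
  have "pl I a q x \<le> pl I a c x + e" unfolding pl_le_iff[OF I]
    using pl_ge[OF I(1), of _ a x c] e by (smt (verit))
  moreover have "pl I a c x \<le> pl I a q x + e" unfolding pl_le_iff[OF I]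
    using pl_ge[OF I(1), of _ a x q] e by (smt (verit))
  ultimately show ?thesis by linarith
qed

lemma C_PL_rat_pl:
  fixes f :: "'a::euclidean_space \<Rightarrow> real"
  assumes "f \<in> C_PL_rat P"
  obtains S :: "('a \<Rightarrow> real) set" and a c where "finite S" "S \<noteq> {}"
    "\<And>i b. i \<in> S \<Longrightarrow> b \<in> Basis \<Longrightarrow> a i \<bullet> b \<in> \<rat>" "\<And>x. x \<in> P \<Longrightarrow> f x = pl S a c x"
proof -
  obtain S where S: "finite S" "S \<noteq> {}" "\<forall>l\<in>S. rat_affine_fun l"
    "\<forall>x\<in>P. f x = Max ((\<lambda>l. l x) ` S)" using assms unfolding C_PL_rat_def by blast
  obtain a c where c: "\<forall>l\<in>S. (\<forall>b\<in>Basis. a l \<bullet> b \<in> \<rat>) \<and> c l \<in> \<rat> \<and> l = (\<lambda>x. a l \<bullet> x + c l)"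
    using S(3) unfolding rat_affine_fun_def by metis
  have "f x = pl S a c x" if "x \<in> P" for x
  proof -
    have "(\<lambda>l. l x) ` S = (\<lambda>i. a i \<bullet> x + c i) ` S"
      using c by (intro image_cong refl) metis
    then show ?thesis using S(4) that by (simp add: pl_def)
  qed
  then show thesis using that[of S a c] S c by blast
qed

lemma pl_C_PL_rat:
  assumes I: "finite I" "I \<noteq> {}" and a: "\<And>i b. i \<in> I \<Longrightarrow> b \<in> Basis \<Longrightarrow> a i \<bullet> b \<in> \<rat>"
    and q: "\<And>i. i \<in> I \<Longrightarrow> q i \<in> \<rat>"
  shows "pl I a q \<in> C_PL_rat P"
proof -
  let ?S = "(\<lambda>i x. a i \<bullet> x + q i) ` I"
  have "finite ?S" "?S \<noteq> {}" using I by auto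
  moreover have "\<forall>l\<in>?S. rat_affine_fun l" using a q unfolding rat_affine_fun_def by blast
  moreover have "pl I a q x = Max ((\<lambda>l. l x) ` ?S)" for x by (simp add: pl_def image_image)
  ultimately show ?thesis unfolding C_PL_rat_def by blast
qed

section \<open>Barycenter, excess and the J-norm\<close>

definition vol :: "'a::euclidean_space set \<Rightarrow> real" where
  "vol P = measure lborel P"

definition bary :: "'a::euclidean_space set \<Rightarrow> 'a" where
  "bary P = (\<Sum>b\<in>Basis. (vol_int P (\<lambda>x. x \<bullet> b) / vol P) *\<^sub>R b)"

lemma vol_int_const: "compact P \<Longrightarrow> vol_int P (\<lambda>_. c) = c * vol P"
  unfolding vol_int_def vol_def set_lebesgue_integral_def by simp

lemma vol_pos:
  assumes "integral_delzant P"
  shows "vol P > 0"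
proof (rule ccontr)
  assume "\<not> vol P > 0"
  then have "vol P = 0" using measure_nonneg[of lborel P] by (simp add: vol_def)
  then have "vol_int P (\<lambda>_. 1 * 1) = 0" using vol_int_const[OF delzant_compact[OF assms], of 1] by simp
  then show False
    using vol_int_square_zero[OF delzant_compact[OF assms], of "\<lambda>_. 1"] delzant_interior[OF assms]
    by auto
qed

lemma vol_int_affine:
  assumes P: "integral_delzant P"
  shows "vol_int P (\<lambda>x. a \<bullet> x + c) = vol P * (a \<bullet> bary P + c)"
proof -
  note lin = linear_vol_int_1[OF delzant_compact[OF P]]
  have "vol_int P (\<lambda>x. a \<bullet> x + c) = vol_int P (\<lambda>x. a \<bullet> x) + vol_int P (\<lambda>_. c)"
    by (intro linear_on_contD(1)[OF lin] continuous_intros)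
  also have "vol_int P (\<lambda>x. a \<bullet> x) = vol_int P (\<lambda>x. \<Sum>b\<in>Basis. (a \<bullet> b) * (x \<bullet> b))"
    by (subst euclidean_inner[of a]) (simp only:)
  also have "\<dots> = (\<Sum>b\<in>Basis. vol_int P (\<lambda>x. (a \<bullet> b) * (x \<bullet> b)))"
    by (intro linear_on_cont_sum[OF lin] continuous_intros) simp
  also have "\<dots> = (\<Sum>b\<in>Basis. (a \<bullet> b) * vol_int P (\<lambda>x. x \<bullet> b))"
    by (intro sum.cong refl linear_on_contD(2)[OF lin] continuous_intros)
  also have "\<dots> = vol P * (a \<bullet> bary P)"
    using vol_pos[OF P] by (simp add: bary_def inner_sum_right sum_distrib_left mult_ac)
  finally show ?thesis
    by (simp add: vol_int_const[OF delzant_compact[OF P]] algebra_simps)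
qed

text \<open>Each facet inequality is integrated over \<open>P\<close> and divided by the volume.
  This suffices because \<open>P\<close> is cut out by its facet data.\<close>

lemma bary_in:
  assumes P: "integral_delzant P"
  shows "bary P \<in> P"
proof -
  have "l \<bullet> bary P + of_int d \<ge> 0" if ld: "(l, d) \<in> facet_data P" for l d
  proof -
    have "vol_int P (\<lambda>_. 0) \<le> vol_int P (\<lambda>x. l \<bullet> x + of_int d)"
      using facet_dataD(3)[OF ld] by (intro vol_int_mono delzant_compact P continuous_intros)
    then have "0 \<le> vol P * (l \<bullet> bary P + of_int d)"
      using vol_int_affine[OF P] vol_int_const[OF delzant_compact[OF P]] by simp
    then show ?thesis using vol_pos[OF P] by (simp add: zero_le_mult_iff)
  qed
  moreover have "P = {x. \<forall>(l, d)\<in>facet_data P. l \<bullet> x + of_int d \<ge> 0}"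
    using P unfolding integral_delzant_def by blast
  ultimately show ?thesis by blast
qed

text \<open>The gap in Jensen's inequality at the barycenter. It vanishes on affine functions and is
  nonnegative on convex ones; being linear, unlike the infimum in \<open>J_norm\<close>, it behaves
  well under integration over slices.\<close>

definition excess :: "'a::euclidean_space set \<Rightarrow> ('a \<Rightarrow> real) \<Rightarrow> real" where
  "excess P g = vol_int P g / vol P - g (bary P)"

text \<open>The mean of \<xi> is its value at the barycenter, so adding \<xi> does not change the
  excess. The infimum over \<open>P\<close> is at most the value at the barycenter, which is a point
  of \<open>P\<close>.\<close>

lemma excess_le_J:
  assumes P: "integral_delzant P" and g: "continuous_on UNIV g" and \<xi>: "affine_fun \<xi>"
  shows "excess P g \<le> 1 / measure lborel P * (LINT x:P|lborel. g x + \<xi> x) - (INF x\<in>P. g x + \<xi> x)"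
proof -
  obtain a c where \<xi>ac: "\<xi> = (\<lambda>x. a \<bullet> x + c)" using \<xi> unfolding affine_fun_def by blast
  note lin = linear_vol_int_1[OF delzant_compact[OF P]]
  have c: "continuous_on UNIV (\<lambda>x. g x + \<xi> x)"
    using g affine_fun_continuous[OF \<xi>] by (intro continuous_intros)
  have "vol_int P (\<lambda>x. g x + \<xi> x) = vol_int P g + vol P * \<xi> (bary P)"
    using linear_on_contD(1)[OF lin g affine_fun_continuous[OF \<xi>]] vol_int_affine[OF P]
    by (simp add: \<xi>ac)
  then have "1 / vol P * vol_int P (\<lambda>x. g x + \<xi> x) = vol_int P g / vol P + \<xi> (bary P)"
    using vol_pos[OF P] by (simp add: field_simps)
  moreover have "(INF x\<in>P. g x + \<xi> x) \<le> g (bary P) + \<xi> (bary P)"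
  proof (rule cINF_lower[OF _ bary_in[OF P]])
    have "compact ((\<lambda>x. g x + \<xi> x) ` P)"
      using delzant_compact[OF P] continuous_on_subset[OF c] by (intro compact_continuous_image) auto
    then show "bdd_below ((\<lambda>x. g x + \<xi> x) ` P)"
      by (intro bounded_imp_bdd_below compact_imp_bounded)
  qed
  ultimately show ?thesis by (simp add: excess_def vol_def vol_int_def)
qed

lemma J_norm_cong:
  assumes "\<And>x. x \<in> P \<Longrightarrow> f x = g x"
  shows "J_norm P f = J_norm P g"
proof -
  have "(LINT x:P|lborel. f x + \<xi> x) = (LINT x:P|lborel. g x + \<xi> x)" for \<xi>
    using vol_int_cong[of P "\<lambda>x. f x + \<xi> x" "\<lambda>x. g x + \<xi> x"] assms by (simp add: vol_int_def)
  then show ?thesis unfolding J_norm_def using assms by simp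
qed

text \<open>This direction makes the stability of the factors usable for the excess of slices; the
  reverse one, for piecewise affine functions, returns to the J-norm on the product.\<close>

lemma J_norm_ge:
  assumes P: "integral_delzant P" and g: "continuous_on UNIV g"
  shows "excess P g \<le> J_norm P g"
  unfolding J_norm_def
proof (rule cINF_greatest)
  show "{\<xi> :: 'a \<Rightarrow> real. affine_fun \<xi>} \<noteq> {}" unfolding affine_fun_def by blast
qed (use excess_le_J[OF P g] in simp)

text \<open>Testing the infimum against minus an affine function that is active at the barycenter.\<close>

lemma J_norm_le:
  assumes P: "integral_delzant P" and I: "finite I" "I \<noteq> {}"
  shows "J_norm P (pl I a c) \<le> excess P (pl I a c)"
proof -
  let ?g = "pl I a c"
  obtain i where i: "i \<in> I" "?g (bary P) = a i \<bullet> bary P + c i" using pl_attained[OF I] .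
  define \<xi> where "\<xi> x = (- a i) \<bullet> x + (- c i)" for x
  have \<xi>: "affine_fun \<xi>" unfolding affine_fun_def \<xi>_def by blast
  note g = pl_continuous[OF I, of a c]
  note lin = linear_vol_int_1[OF delzant_compact[OF P]]
  have "J_norm P ?g \<le> 1 / measure lborel P * (LINT x:P|lborel. ?g x + \<xi> x) - (INF x\<in>P. ?g x + \<xi> x)"
    unfolding J_norm_def
  proof (rule cINF_lower)
    show "bdd_below ((\<lambda>\<xi>. 1 / measure lborel P * (LINT x:P|lborel. ?g x + \<xi> x) - (INF x\<in>P. ?g x + \<xi> x)) `
        {\<xi>. affine_fun \<xi>})"
      using excess_le_J[OF P g] by (intro bdd_belowI2[of _ "excess P ?g"]) simp
  qed (use \<xi> in simp)
  also have "(LINT x:P|lborel. ?g x + \<xi> x) = vol_int P ?g + vol P * \<xi> (bary P)"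
    using linear_on_contD(1)[OF lin g affine_fun_continuous[OF \<xi>]] vol_int_affine[OF P, of "- a i" "- c i"]
    by (simp add: \<xi>_def vol_int_def)
  also have "1 / measure lborel P * \<dots> = excess P ?g"
    using vol_pos[OF P] i by (simp add: excess_def \<xi>_def vol_def field_simps)
  also have "excess P ?g - (INF x\<in>P. ?g x + \<xi> x) \<le> excess P ?g"
  proof -
    have "0 \<le> ?g x + \<xi> x" for x
      using pl_ge[OF I(1) i(1), of a x c] by (simp add: \<xi>_def)
    then have "0 \<le> (INF x\<in>P. ?g x + \<xi> x)"
      by (intro cINF_greatest delzant_nonempty[OF P])
    then show ?thesis by simp
  qed
  finally show ?thesis .
qed

section \<open>From rational to real constants\<close>

text \<open>Each of the three terms is bounded in the supremum norm on \<open>P\<close>. Hence a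
  failure of the stability inequality at one function persists at nearby ones, among them functions
  with rational constants.\<close>

lemma linear_bounded_functional:
  assumes P: "integral_delzant P" and h: "continuous_on UNIV h"
  obtains C where "C > 0" "\<And>u e. continuous_on UNIV u \<Longrightarrow> (\<And>x. x \<in> P \<Longrightarrow> \<bar>u x\<bar> \<le> e) \<Longrightarrow> 
    \<bar>bd_int P u - vol_int P (\<lambda>x. h x * u x) - \<delta> * excess P u\<bar> \<le> C * e"
proof
  note K = delzant_compact[OF P]
  \<comment> \<open>Total mass of the boundary, integral of the absolute value of h, and twice that
    of \<delta>, because the excess is a mean minus a value.\<close>
  define C0 where "C0 = bd_int P (\<lambda>_. 1) + vol_int P (\<lambda>x. \<bar>h x\<bar>) + \<bar>\<delta>\<bar> * 2"
  define C where "C = \<bar>C0\<bar> + 1"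
  show "C > 0" by (simp add: C_def)
  fix u :: "'a \<Rightarrow> real" and e assume u: "continuous_on UNIV u" and e: "\<And>x. x \<in> P \<Longrightarrow> \<bar>u x\<bar> \<le> e"
  have le: "u x \<le> e" "- e \<le> u x" if "x \<in> P" for x using e[OF that] by auto
  have e0: "0 \<le> e" using e[OF bary_in[OF P]] by linarith
  have "bd_int P (\<lambda>_. - e) \<le> bd_int P u" "bd_int P u \<le> bd_int P (\<lambda>_. e)"
    using le by (auto intro!: bd_int_mono[OF P] u continuous_intros)
  then have 1: "\<bar>bd_int P u\<bar> \<le> e * bd_int P (\<lambda>_. 1)"
    using linear_on_contD(2)[OF linear_bd_int[OF P], of "\<lambda>_. 1" e]
      linear_on_contD(2)[OF linear_bd_int[OF P], of "\<lambda>_. 1" "- e"] by simp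
  have h2: "h x * u x \<le> e * \<bar>h x\<bar>" "- e * \<bar>h x\<bar> \<le> h x * u x" if "x \<in> P" for x
  proof -
    have "\<bar>h x * u x\<bar> \<le> e * \<bar>h x\<bar>"       using e[OF that] by (simp add: abs_mult mult.commute[of "\<bar>h x\<bar>"] mult_right_mono)
    then show "h x * u x \<le> e * \<bar>h x\<bar>" "- e * \<bar>h x\<bar> \<le> h x * u x" by auto
  qed
  have "vol_int P (\<lambda>x. - e * \<bar>h x\<bar>) \<le> vol_int P (\<lambda>x. h x * u x)"
    "vol_int P (\<lambda>x. h x * u x) \<le> vol_int P (\<lambda>x. e * \<bar>h x\<bar>)"
    using h2 by (auto intro!: vol_int_mono K u h continuous_intros)
  then have 2: "\<bar>vol_int P (\<lambda>x. h x * u x)\<bar> \<le> e * vol_int P (\<lambda>x. \<bar>h x\<bar>)"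
    using linear_on_contD(2)[OF linear_vol_int_1[OF K], of "\<lambda>x. \<bar>h x\<bar>" e]
      linear_on_contD(2)[OF linear_vol_int_1[OF K], of "\<lambda>x. \<bar>h x\<bar>" "- e"] h
    by (simp add: continuous_on_rabs)
  have "vol_int P (\<lambda>_. - e) \<le> vol_int P u" "vol_int P u \<le> vol_int P (\<lambda>_. e)"
    using le by (auto intro!: vol_int_mono K u continuous_intros)
  then have "\<bar>vol_int P u\<bar> \<le> e * vol P" by (simp add: vol_int_const[OF K])
  then have "\<bar>vol_int P u / vol P\<bar> \<le> e" using vol_pos[OF P] by (simp add: field_simps)
  then have "\<bar>excess P u\<bar> \<le> 2 * e" using e[OF bary_in[OF P]] unfolding excess_def by linarith
  then have 3: "\<bar>\<delta> * excess P u\<bar> \<le> \<bar>\<delta>\<bar> * (2 * e)" by (simp add: abs_mult mult_left_mono)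
  have "\<bar>bd_int P u - vol_int P (\<lambda>x. h x * u x) - \<delta> * excess P u\<bar>
      \<le> e * bd_int P (\<lambda>_. 1) + e * vol_int P (\<lambda>x. \<bar>h x\<bar>) + \<bar>\<delta>\<bar> * (2 * e)"
    using 1 2 3 by linarith
  also have "\<dots> = C0 * e" by (simp add: C0_def algebra_simps)
  also have "\<dots> \<le> C * e" using e0 by (intro mult_right_mono) (auto simp: C_def)
  finally show "\<bar>bd_int P u - vol_int P (\<lambda>x. h x * u x) - \<delta> * excess P u\<bar> \<le> C * e" .
qed

lemma excess_linear:
  assumes P: "integral_delzant P"
  shows "linear_on_cont (excess P)"
  using linear_vol_int_1[OF delzant_compact[OF P]]
  by (auto simp: linear_on_cont_def excess_def algebra_simps add_divide_distrib)

text \<open>Density of the rationals: the constants, unlike the slopes, may be arbitrary reals. This is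
  needed since the constants of a slice of a rational function need not be rational.\<close>

lemma stable_real_constants:
  assumes P: "integral_delzant P" and h: "is_density P h" and \<delta>: "\<delta> > 0"
    and stab: "\<And>f. f \<in> C_PL_rat P \<Longrightarrow> L_V P f \<ge> \<delta> * J_norm P f"
    and I: "finite I" "I \<noteq> {}" and a: "\<And>i b. i \<in> I \<Longrightarrow> b \<in> Basis \<Longrightarrow> a i \<bullet> b \<in> \<rat>"
  shows "bd_int P (pl I a c) - vol_int P (\<lambda>x. h x * pl I a c x) \<ge> \<delta> * excess P (pl I a c)"
proof (rule ccontr)
  have hc: "continuous_on UNIV h" using h affine_fun_continuous by (auto simp: is_density_def)
  define \<Phi> where "\<Phi> u = bd_int P u - vol_int P (\<lambda>x. h x * u x) - \<delta> * excess P u" for u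
  obtain C where C: "C > 0" "\<And>u e. continuous_on UNIV u \<Longrightarrow> (\<And>x. x \<in> P \<Longrightarrow> \<bar>u x\<bar> \<le> e) \<Longrightarrow> \<bar>\<Phi> u\<bar> \<le> C * e"
    unfolding \<Phi>_def using linear_bounded_functional[OF P hc] by metis
  assume "\<not> ?thesis"
  then have neg: "\<Phi> (pl I a c) < 0" by (simp add: \<Phi>_def)
  \<comment> \<open>With this tolerance the perturbation changes \<Phi> by at most half of its
    absolute value, so \<Phi> would stay negative at rational constants, against stability.\<close>
  define e where "e = - \<Phi> (pl I a c) / (2 * C)"
  have e: "e > 0" using neg C(1) by (simp add: e_def divide_neg_pos)
  have "\<exists>q\<in>\<rat>. \<bar>q - c i\<bar> \<le> e" for i
  proof -
    obtain q where "q \<in> \<rat>" "c i < q" "q < c i + e" using Rats_dense_in_real[of "c i" "c i + e"] e by auto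
    then show ?thesis by (intro bexI[of _ q]) auto
  qed
  then obtain q where q: "\<And>i. q i \<in> \<rat>" "\<And>i. \<bar>q i - c i\<bar> \<le> e" by metis
  note cont = pl_continuous[OF I, of a]
  have "0 \<le> \<Phi> (pl I a q)"
  proof -
    have "\<delta> * excess P (pl I a q) \<le> \<delta> * J_norm P (pl I a q)"
      using J_norm_ge[OF P cont] \<delta> by simp
    also have "\<dots> \<le> L_V P (pl I a q)" by (intro stab pl_C_PL_rat I a q(1))
    also have "\<dots> = bd_int P (pl I a q) - vol_int P (\<lambda>x. h x * pl I a q x)"
      by (rule L_V_eq[OF P h cont]) simp
    finally show ?thesis by (simp add: \<Phi>_def)
  qed
  moreover have "\<Phi> (\<lambda>x. pl I a q x - pl I a c x) = \<Phi> (pl I a q) - \<Phi> (pl I a c)"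
    unfolding \<Phi>_def
    unfolding linear_on_contD(3)[OF linear_bd_int[OF P] cont cont]
      linear_on_contD(3)[OF linear_vol_int[OF delzant_compact[OF P] hc] cont cont]
      linear_on_contD(3)[OF excess_linear[OF P] cont cont]
    by (simp add: right_diff_distrib)
  moreover have "\<bar>\<Phi> (\<lambda>x. pl I a q x - pl I a c x)\<bar> \<le> C * e"
    using pl_perturb[OF I] q(2) by (intro C(2) continuous_on_diff cont) blast
  moreover have "C * e = - \<Phi> (pl I a c) / 2" using C(1) by (simp add: e_def)
  ultimately show False using neg by linarith
qed

subsection \<open>Products\<close>

text \<open>Independence comes from counting: there are as many lifted vectors as the dimension of
  their span. Integer coefficients are found in each component separately.\<close>

lemma lattice_basis_Times:
  fixes N1 :: "'a::euclidean_space set" and N2 :: "'b::euclidean_space set"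
  assumes N1: "lattice_basis N1" and N2: "lattice_basis N2"
  shows "lattice_basis ((\<lambda>l. (l, 0)) ` N1 \<union> Pair 0 ` N2)"
  unfolding lattice_basis_def
proof (intro conjI ballI)
  have ind: "independent N1" "independent N2"
    and lat: "N1 \<subseteq> int_lattice" "N2 \<subseteq> int_lattice"
    using N1 N2 by (auto simp: lattice_basis_def)
  have fin: "finite N1" "finite N2" using ind independent_imp_finite by blast+
  have z: "0 \<notin> N1" using ind(1) dependent_zero by blast
  let ?N = "(\<lambda>l. (l, 0::'b)) ` N1 \<union> Pair (0::'a) ` N2"
  show "?N \<subseteq> int_lattice" using lat by (auto simp: int_lattice_Pair int_lattice_0)
  have "card ?N = card N1 + card N2"
    using fin z by (subst card_Un_disjoint) (auto simp: card_image inj_on_def)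
  also have "\<dots> = dim (span N1 \<times> span N2)"
    using ind by (simp add: dim_Times dim_eq_card_independent)
  finally have "card ?N = dim (span ?N)" by (simp only: span_Times_frame[OF fin z])
  then show "independent ?N"
    using card_eq_dim[of ?N "span ?N"] fin by (simp add: span_superset)
  fix z :: "'a \<times> 'b" assume "z \<in> int_lattice"
  then have "fst z \<in> int_lattice" "snd z \<in> int_lattice" by (cases z; simp add: int_lattice_Pair)+
  then obtain c1 c2 :: "_ \<Rightarrow> int" where c: "fst z = (\<Sum>l\<in>N1. of_int (c1 l) *\<^sub>R l)"
      "snd z = (\<Sum>l\<in>N2. of_int (c2 l) *\<^sub>R l)"
    using N1 N2 unfolding lattice_basis_def by metis
  \<comment> \<open>The test \<open>snd l = 0\<close> tells the two blocks apart, since the vectors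
    of \<open>N2\<close> are nonzero.\<close>
  define c where "c l = (if snd l = 0 then c1 (fst l) else c2 (snd l))" for l :: "'a \<times> 'b"
  have nz: "l \<noteq> 0" if "l \<in> N2" for l using that ind(2) dependent_zero by blast
  have "(\<Sum>l\<in>?N. of_int (c l) *\<^sub>R l) = z"
    unfolding frame_sum_Times[OF fin z] using c nz by (auto simp: c_def prod_eq_iff intro!: sum.cong)
  then show "\<exists>c :: _ \<Rightarrow> int. z = (\<Sum>l\<in>?N. of_int (c l) *\<^sub>R l)" by metis
qed

lemma extreme_point_Times:
  fixes P1 :: "'a::euclidean_space set" and P2 :: "'b::euclidean_space set"
  assumes "(v1, v2) extreme_point_of (P1 \<times> P2)"
  shows "v1 extreme_point_of P1" "v2 extreme_point_of P2"
proof -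
  have "{v1} \<times> {v2} face_of P1 \<times> P2" using assms by (simp add: face_of_singleton)
  then have "{v1} face_of P1 \<and> {v2} face_of P2" unfolding face_of_Times_eq by simp
  then show "v1 extreme_point_of P1" "v2 extreme_point_of P2" by (simp_all add: face_of_singleton)
qed

text \<open>Density and J-norm of the product are computed by the same lemmas as for the factors, so
  the product has to be Delzant itself. A vertex of it is a pair of vertices, and the conormals
  there are the lifted conormals of both.\<close>

lemma integral_delzant_Times:
  fixes P1 :: "'a::euclidean_space set" and P2 :: "'b::euclidean_space set"
  assumes P1: "integral_delzant P1" and P2: "integral_delzant P2"
  shows "integral_delzant (P1 \<times> P2)"
  unfolding integral_delzant_def
proof (intro conjI allI impI)
  obtain S T where "finite S" "P1 = convex hull S" "finite T" "P2 = convex hull T"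
    using delzant_polytope[OF P1] delzant_polytope[OF P2] unfolding polytope_def by blast
  then show "polytope (P1 \<times> P2)"
    unfolding polytope_def by (metis convex_hull_Times finite_SigmaI)
  show "interior (P1 \<times> P2) \<noteq> {}"
    using delzant_interior[OF P1] delzant_interior[OF P2] by (simp add: interior_Times)
  have eq: "P1 = {x. \<forall>(l, d)\<in>facet_data P1. l \<bullet> x + of_int d \<ge> 0}"
    "P2 = {x. \<forall>(l, d)\<in>facet_data P2. l \<bullet> x + of_int d \<ge> 0}"
    using P1 P2 unfolding integral_delzant_def by blast+
  have "z \<in> P1 \<times> P2 \<longleftrightarrow> (\<forall>(l, d)\<in>facet_data (P1 \<times> P2). l \<bullet> z + of_int d \<ge> 0)" for z
  proof -
    have "fst z \<in> P1 \<longleftrightarrow> (\<forall>(l, d)\<in>facet_data P1. l \<bullet> fst z + of_int d \<ge> 0)"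
      "snd z \<in> P2 \<longleftrightarrow> (\<forall>(l, d)\<in>facet_data P2. l \<bullet> snd z + of_int d \<ge> 0)"
      using eq by blast+
    then show ?thesis
      by (cases z) (simp add: facet_data_Times[OF P1 P2] ball_Un case_prod_unfold)
  qed
  then show "P1 \<times> P2 = {z. \<forall>(l, d)\<in>facet_data (P1 \<times> P2). l \<bullet> z + of_int d \<ge> 0}" by blast
  fix v assume v: "v extreme_point_of (P1 \<times> P2)"
  obtain v1 v2 where v12: "v = (v1, v2)" by (cases v)
  let ?N1 = "{l. \<exists>d. (l, d) \<in> facet_data P1 \<and> v1 \<in> hyperplane l d}"
  let ?N2 = "{l. \<exists>d. (l, d) \<in> facet_data P2 \<and> v2 \<in> hyperplane l d}"
  have "lattice_basis ?N1" "lattice_basis ?N2"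
    using P1 P2 extreme_point_Times[OF v[unfolded v12]] unfolding integral_delzant_def by blast+
  then have "lattice_basis ((\<lambda>l. (l, 0)) ` ?N1 \<union> Pair 0 ` ?N2)" by (rule lattice_basis_Times)
  moreover have "((l1, l2), d) \<in> facet_data (P1 \<times> P2) \<longleftrightarrow>
      l2 = 0 \<and> (l1, d) \<in> facet_data P1 \<or> l1 = 0 \<and> (l2, d) \<in> facet_data P2" for l1 l2 d
    unfolding facet_data_Times[OF P1 P2] by force
  then have "{l. \<exists>d. (l, d) \<in> facet_data (P1 \<times> P2) \<and> v \<in> hyperplane l d} =
      (\<lambda>l. (l, 0)) ` ?N1 \<union> Pair 0 ` ?N2"
    unfolding v12 by (auto simp: hyperplane_Pair_0 image_iff; blast)
  ultimately show "lattice_basis {l. \<exists>d. (l, d) \<in> facet_data (P1 \<times> P2) \<and> v \<in> hyperplane l d}"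
    by simp
qed

lemma vol_Times:
  assumes "compact P1" "compact P2"
  shows "vol (P1 \<times> P2) = vol P1 * vol P2"
  using vol_int_Times_fst[OF assms, of "\<lambda>_. 1"] assms
  by (simp add: vol_int_const compact_Times mult.commute)

lemma bary_Times:
  fixes P1 :: "'a::euclidean_space set" and P2 :: "'b::euclidean_space set"
  assumes P1: "integral_delzant P1" and P2: "integral_delzant P2"
  shows "bary (P1 \<times> P2) = (bary P1, bary P2)"
proof -
  note K = delzant_compact[OF P1] delzant_compact[OF P2]
  \<comment> \<open>The barycenter is recognized by its inner product with every vector: a linear
    function integrates to the volume times its value there.\<close>
  have "a \<bullet> bary (P1 \<times> P2) = a \<bullet> (bary P1, bary P2)" for a :: "'a \<times> 'b"
  proof -
    obtain a1 a2 where a: "a = (a1, a2)" by (cases a)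
    have "vol (P1 \<times> P2) * (a \<bullet> bary (P1 \<times> P2)) = vol_int (P1 \<times> P2) (\<lambda>z. a \<bullet> z)"
      using vol_int_affine[OF integral_delzant_Times[OF P1 P2], of a 0] by simp
    also have "\<dots> = vol_int P1 (\<lambda>x. vol_int P2 (\<lambda>y. a2 \<bullet> y + a1 \<bullet> x))"
      by (subst vol_int_Times_fst[OF K]) (auto intro!: continuous_intros simp: a add.commute)
    also have "\<dots> = vol_int P1 (\<lambda>x. (vol P2 *\<^sub>R a1) \<bullet> x + vol P2 * (a2 \<bullet> bary P2))"
      unfolding vol_int_affine[OF P2] by (simp add: algebra_simps)
    also have "\<dots> = vol P1 * ((vol P2 *\<^sub>R a1) \<bullet> bary P1 + vol P2 * (a2 \<bullet> bary P2))"
      by (rule vol_int_affine[OF P1])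
    also have "\<dots> = vol (P1 \<times> P2) * (a \<bullet> (bary P1, bary P2))"
      by (simp add: vol_Times[OF K] a algebra_simps)
    finally show ?thesis using vol_pos[OF integral_delzant_Times[OF P1 P2]] by simp
  qed
  then show ?thesis by (metis vector_eq_ldot)
qed

section \<open>Comparing the excess with that of the slices\<close>

lemma pl_slice:
  "pl I a c (x, y) = pl I (\<lambda>i. fst (a i)) (\<lambda>i. c i + snd (a i) \<bullet> y) x"
  "pl I a c (x, y) = pl I (\<lambda>i. snd (a i)) (\<lambda>i. c i + fst (a i) \<bullet> x) y"
  by (simp_all add: pl_def inner_prod_def algebra_simps)

text \<open>Integration over x preserves convexity in y, and a finite convex function on the whole
  space is continuous. No domination argument is involved.\<close>

lemma continuous_vol_int_param:
  fixes F :: "'a::euclidean_space \<Rightarrow> 'b::euclidean_space \<Rightarrow> real"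
  assumes P: "compact P" and cont: "\<And>y. continuous_on UNIV (\<lambda>x. F x y)"
    and conv: "\<And>x. convex_on UNIV (\<lambda>y. F x y)"
  shows "continuous_on UNIV (\<lambda>y. vol_int P (\<lambda>x. F x y))"
proof (rule convex_on_continuous[OF open_UNIV], rule convex_onI)
  note lin = linear_vol_int_1[OF P]
  fix t :: real and y y' :: 'b assume t: "0 < t" "t < 1"
  have c: "continuous_on UNIV (\<lambda>x. (1 - t) * F x y)" "continuous_on UNIV (\<lambda>x. t * F x y')"
    using cont by (auto intro!: continuous_intros)
  have "vol_int P (\<lambda>x. F x ((1 - t) *\<^sub>R y + t *\<^sub>R y')) \<le> vol_int P (\<lambda>x. (1 - t) * F x y + t * F x y')"
    using t by (intro vol_int_mono P cont continuous_on_add c convex_onD[OF conv]) auto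
  also have "\<dots> = (1 - t) * vol_int P (\<lambda>x. F x y) + t * vol_int P (\<lambda>x. F x y')"
    using linear_on_contD(1)[OF lin c] linear_on_contD(2)[OF lin cont] by simp
  finally show "vol_int P (\<lambda>x. F x ((1 - t) *\<^sub>R y + t *\<^sub>R y')) \<le>
      (1 - t) * vol_int P (\<lambda>x. F x y) + t * vol_int P (\<lambda>x. F x y')" .
qed simp

text \<open>Jensen's inequality: an affine piece active at the barycenter is a minorant whose mean
  is the common value there.\<close>

lemma excess_pl_nonneg:
  assumes P: "integral_delzant P" and I: "finite I" "I \<noteq> {}"
  shows "excess P (pl I a c) \<ge> 0"
proof -
  obtain i where i: "i \<in> I" "pl I a c (bary P) = a i \<bullet> bary P + c i" using pl_attained[OF I] .
  have "vol P * pl I a c (bary P) = vol_int P (\<lambda>x. a i \<bullet> x + c i)"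
    using i vol_int_affine[OF P] by simp
  also have "\<dots> \<le> vol_int P (pl I a c)"
    using pl_ge[OF I(1) i(1)]
    by (intro vol_int_mono delzant_compact P pl_continuous I continuous_intros)
  finally show ?thesis using vol_pos[OF P] by (simp add: excess_def field_simps)
qed

text \<open>The map taking y to (b + y)/2 scales volume by 2^-n and sends the convex set
  \<open>P\<close> into itself. The integral on the left is therefore 2^n times that of the
  nonnegative function \<open>E\<close> over a part of \<open>P\<close>.\<close>

lemma vol_int_contract_le:
  fixes P :: "'a::euclidean_space set"
  assumes P: "compact P" "convex P" and b: "b \<in> P"
    and E: "continuous_on UNIV E" and nn: "\<And>y. 0 \<le> E y"
  shows "vol_int P (\<lambda>y. E ((1/2) *\<^sub>R b + (1/2) *\<^sub>R y)) \<le> 2 ^ DIM('a) * vol_int P E"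
proof -
  let ?h = "\<lambda>y. (1/2) *\<^sub>R b + (1/2) *\<^sub>R (y::'a)"
  let ?g = "\<lambda>y. indicator P y *\<^sub>R E y"
  have Pb: "P \<in> sets borel" using P(1) by (simp add: borel_closed compact_imp_closed)
  have gm: "?g \<in> borel_measurable borel"
    by (rule borel_measurable_continuous_on_indicator[OF Pb continuous_on_subset[OF E]]) simp
  have hm: "?h \<in> borel_measurable lborel" by simp
  have gi: "integrable lborel ?g"
    using set_integrable_vol[OF P(1) E] by (simp add: set_integrable_def)
  let ?k = "(1/2::real) ^ DIM('a)"
  have lb: "(lborel :: 'a measure) = density (distr lborel borel ?h) (\<lambda>_. ennreal ?k)"
    using lborel_affine[of "1/2" "(1/2) *\<^sub>R b"] by simp
  have "integrable (density (distr lborel borel ?h) (\<lambda>_. ennreal ?k)) ?g"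
    using gi lb by simp
  then have "integrable (distr lborel borel ?h) (\<lambda>y. ?k *\<^sub>R ?g y)"
    using gm by (subst (asm) integrable_density) auto
  then have "integrable (distr lborel borel ?h) ?g" by simp
  then have int: "integrable lborel (\<lambda>y. ?g (?h y))"
    using gm by (subst (asm) integrable_distr_eq) auto
  have "vol_int P E = integral\<^sup>L (density (distr lborel borel ?h) (\<lambda>_. ennreal ?k)) ?g"
    unfolding vol_int_def set_lebesgue_integral_def using lb by simp
  also have "\<dots> = integral\<^sup>L (distr lborel borel ?h) (\<lambda>y. ?k *\<^sub>R ?g y)"
    using gm by (subst integral_density) auto
  also have "\<dots> = ?k * integral\<^sup>L (distr lborel borel ?h) ?g" by simp
  also have "integral\<^sup>L (distr lborel borel ?h) ?g = (\<integral>y. ?g (?h y) \<partial>lborel)"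
    using gm by (subst integral_distr) auto
  finally have eq: "vol_int P E = ?k * (\<integral>y. ?g (?h y) \<partial>lborel)" .
  have "vol_int P (\<lambda>y. E (?h y)) \<le> (\<integral>y. ?g (?h y) \<partial>lborel)"
    unfolding vol_int_def set_lebesgue_integral_def
  proof (rule integral_mono[OF _ int])
    have "continuous_on UNIV (\<lambda>y. E (?h y))"
      by (rule continuous_on_compose2[OF E]) (auto intro!: continuous_intros)
    then show "integrable lborel (\<lambda>y. indicator P y *\<^sub>R E (?h y))"
      using set_integrable_vol[OF P(1)] by (simp add: set_integrable_def)
    fix y :: 'a
    have "?h y \<in> P" if "y \<in> P" using convexD[OF P(2) b that, of "1/2" "1/2"] by simp
    then show "indicator P y *\<^sub>R E (?h y) \<le> ?g (?h y)" using nn by (simp add: indicator_def)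
  qed
  also have "\<dots> = 2 ^ DIM('a) * vol_int P E" unfolding eq by (simp add: power_divide)
  finally show ?thesis .
qed

text \<open>Writing \<open>F(x, b\<^sub>2)\<close> at the barycenter \<open>b\<^sub>2\<close> as a single slice would lose control, so it is
  replaced (Jensen) by the average of \<open>F(x, (y + b\<^sub>2)/2)\<close> over \<open>y\<close>; the contraction costs a factor
  \<open>2\<^sup>n\<close> in the averaged excess and leaves half of the left-hand side on the right.\<close>

lemma excess_Times_le:
  fixes P1 :: "'a::euclidean_space set" and P2 :: "'b::euclidean_space set"
    and a :: "'i \<Rightarrow> 'a \<times> 'b" and c :: "'i \<Rightarrow> real"
  assumes P1: "integral_delzant P1" and P2: "integral_delzant P2" and I: "finite I" "I \<noteq> {}"
  defines "F \<equiv> pl I a c"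
  shows "excess (P1 \<times> P2) F \<le> 2 * (2 ^ DIM('b) / vol P2 * vol_int P2 (\<lambda>y. excess P1 (\<lambda>x. F (x, y)))
    + 1 / vol P1 * vol_int P1 (\<lambda>x. excess P2 (\<lambda>y. F (x, y))))"
proof -
  note K = delzant_compact[OF P1] delzant_compact[OF P2]
  note lin1 = linear_vol_int_1[OF K(1)] and lin2 = linear_vol_int_1[OF K(2)]
  define v1 v2 b1 b2 where "v1 = vol P1" and "v2 = vol P2" and "b1 = bary P1" and "b2 = bary P2"
  have v: "v1 > 0" "v2 > 0" using vol_pos P1 P2 by (simp_all add: v1_def v2_def)
  define G where "G y = vol_int P1 (\<lambda>x. F (x, y))" for y
  define H where "H x = vol_int P2 (\<lambda>y. F (x, y))" for x
  define E where "E y = excess P1 (\<lambda>x. F (x, y))" for y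
  define m where "m = vol_int (P1 \<times> P2) F"
  have Fc: "continuous_on UNIV F" unfolding F_def by (rule pl_continuous[OF I])
  have Fs: "continuous_on UNIV (\<lambda>x. F (x, y))" "continuous_on UNIV (\<lambda>y. F (x, y))" for x y
    using continuous_slice[OF Fc] by auto
  have Fx: "convex_on UNIV (\<lambda>x. F (x, y))" and Fy: "convex_on UNIV (\<lambda>y. F (x, y))" for x y
  proof -
    have "(\<lambda>x. F (x, y)) = pl I (\<lambda>i. fst (a i)) (\<lambda>i. c i + snd (a i) \<bullet> y)"
      "(\<lambda>y. F (x, y)) = pl I (\<lambda>i. snd (a i)) (\<lambda>i. c i + fst (a i) \<bullet> x)"
      unfolding F_def by (rule ext, rule pl_slice)+
    then show "convex_on UNIV (\<lambda>x. F (x, y))" "convex_on UNIV (\<lambda>y. F (x, y))"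
      by (simp_all only: pl_convex[OF I])
  qed
  have Gc: "continuous_on UNIV G"
    unfolding G_def using continuous_vol_int_param[OF K(1) Fs(1) Fy] .
  have Hc: "continuous_on UNIV H"
    unfolding H_def using continuous_vol_int_param[OF K(2) Fs(2) Fx] .
  have E: "E y = (1 / v1) * G y - F (b1, y)" for y
    by (simp add: E_def excess_def G_def v1_def b1_def)
  have Ec: "continuous_on UNIV E"
    unfolding E[abs_def] using Gc Fs by (intro continuous_intros)
  have E0: "0 \<le> E y" for y
    unfolding E_def F_def pl_slice(1) by (rule excess_pl_nonneg[OF P1 I])
  have mG: "m = vol_int P2 G" and mH: "m = vol_int P1 H"
    unfolding m_def G_def H_def using vol_int_Times_snd[OF K Fc] vol_int_Times_fst[OF K Fc] by auto
  define A where "A = vol_int P2 E"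
  have A: "A = m / v1 - vol_int P2 (\<lambda>y. F (b1, y))"
  proof -
    have "A = vol_int P2 (\<lambda>y. (1 / v1) * G y) - vol_int P2 (\<lambda>y. F (b1, y))"
      unfolding A_def E[abs_def] using Gc by (intro linear_on_contD(3)[OF lin2] Fs continuous_intros)
    then show ?thesis unfolding linear_on_contD(2)[OF lin2 Gc] mG[symmetric] by simp
  qed
  have A0: "0 \<le> A"
    using vol_int_mono[OF K(2) continuous_on_const Ec, of 0] E0 vol_int_const[OF K(2), of 0]
    by (simp add: A_def)
  define B where "B = vol_int P1 (\<lambda>x. excess P2 (\<lambda>y. F (x, y)))"
  have B: "B = m / v2 - G b2"
  proof -
    have "B = vol_int P1 (\<lambda>x. (1 / v2) * H x - F (x, b2))"
      by (simp add: B_def excess_def H_def v2_def b2_def)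
    also have "\<dots> = vol_int P1 (\<lambda>x. (1 / v2) * H x) - vol_int P1 (\<lambda>x. F (x, b2))"
      using Hc by (intro linear_on_contD(3)[OF lin1] Fs continuous_intros)
    finally show ?thesis
      unfolding linear_on_contD(2)[OF lin1 Hc] mH[symmetric] by (simp add: G_def)
  qed
  let ?h = "\<lambda>y. (1/2) *\<^sub>R b2 + (1/2) *\<^sub>R y"
  let ?F' = "\<lambda>z. F (fst z, ?h (snd z))"
  have F'c: "continuous_on UNIV ?F'"
    by (rule continuous_on_compose2[OF Fc]) (auto intro!: continuous_intros)
  have hc: "continuous_on UNIV (\<lambda>y. f (?h y))" if "continuous_on UNIV f" for f :: "'b \<Rightarrow> real"
    by (rule continuous_on_compose2[OF that]) (auto intro!: continuous_intros)
  have jensen: "v2 * F (x, b2) \<le> vol_int P2 (\<lambda>y. F (x, ?h y))" for x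
  proof -
    \<comment> \<open>An affine piece active at (x, b2). Along \<open>?h\<close> its mean over
      \<open>P2\<close> is its value at b2, because the mean of \<open>?h\<close> is b2.\<close>
    obtain i where i: "i \<in> I" "F (x, b2) = a i \<bullet> (x, b2) + c i"
      using pl_attained[OF I] unfolding F_def by metis
    let ?a = "(1/2) *\<^sub>R snd (a i)" and ?c = "fst (a i) \<bullet> x + (1/2) * (snd (a i) \<bullet> b2) + c i"
    have eq: "a i \<bullet> (x, ?h y) + c i = ?a \<bullet> y + ?c" for y
      by (simp add: inner_prod_def inner_add_right)
    have "v2 * F (x, b2) = vol_int P2 (\<lambda>y. ?a \<bullet> y + ?c)"
      unfolding vol_int_affine[OF P2] i(2) v2_def[symmetric] b2_def[symmetric]
      by (simp add: inner_prod_def)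
    also have "\<dots> \<le> vol_int P2 (\<lambda>y. F (x, ?h y))"
      using pl_ge[OF I(1) i(1), of a _ c] hc[OF Fs(2)] unfolding F_def[symmetric]
      by (intro vol_int_mono K continuous_intros) (simp_all only: eq[symmetric])
    finally show ?thesis .
  qed
  have "v2 * G b2 = vol_int P1 (\<lambda>x. v2 * F (x, b2))"
    unfolding G_def using linear_on_contD(2)[OF lin1 Fs(1)] by simp
  also have "\<dots> \<le> vol_int P1 (\<lambda>x. vol_int P2 (\<lambda>y. ?F' (x, y)))"
    unfolding vol_int_def[of P1]
  proof (rule set_integral_mono)
    show "set_integrable lborel P1 (\<lambda>x. v2 * F (x, b2))"
      by (intro set_integrable_vol K continuous_intros Fs)
    show "set_integrable lborel P1 (\<lambda>x. vol_int P2 (\<lambda>y. ?F' (x, y)))"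
      by (rule set_integrable_vol_fst[OF K F'c])
    show "v2 * F (x, b2) \<le> vol_int P2 (\<lambda>y. ?F' (x, y))" for x using jensen by simp
  qed
  also have "\<dots> = vol_int P2 (\<lambda>y. G (?h y))"
    using vol_int_Times_fst[OF K F'c] vol_int_Times_snd[OF K F'c] by (simp add: G_def)
  \<comment> \<open>By the definition of \<open>E\<close>, the value of \<open>G\<close> at the
    contracted point is \<open>v1 * E\<close> plus \<open>v1 * F (b1, .)\<close> there. Convexity on
    the segment from b2 to y bounds the latter by the mean of the endpoint values.\<close>
  also have "\<dots> \<le> vol_int P2 (\<lambda>y. v1 * E (?h y) + ((v1 / 2) * F (b1, y) + v1 / 2 * F (b1, b2)))"
  proof (rule vol_int_mono[OF K(2) hc[OF Gc]])
    show "continuous_on UNIV (\<lambda>y. v1 * E (?h y) + ((v1 / 2) * F (b1, y) + v1 / 2 * F (b1, b2)))"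
      by (intro continuous_intros hc[OF Ec] Fs)
    fix y
    have "F (b1, ?h y) \<le> 1/2 * F (b1, b2) + 1/2 * F (b1, y)"
      using convex_onD[OF Fy, of "1/2" b2 y b1] by simp
    moreover have "G (?h y) = v1 * E (?h y) + v1 * F (b1, ?h y)"
      using v unfolding E by (simp add: field_simps)
    ultimately show "G (?h y) \<le> v1 * E (?h y) + ((v1 / 2) * F (b1, y) + v1 / 2 * F (b1, b2))"
      using mult_left_mono[of "F (b1, ?h y)" "1/2 * F (b1, b2) + 1/2 * F (b1, y)" v1] v
      by (simp add: algebra_simps)
  qed
  also have "\<dots> = v1 * vol_int P2 (\<lambda>y. E (?h y)) + ((v1 / 2) * vol_int P2 (\<lambda>y. F (b1, y))
      + v1 / 2 * F (b1, b2) * v2)"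
  proof -
    have c: "continuous_on UNIV (\<lambda>y. v1 * E (?h y))" "continuous_on UNIV (\<lambda>y. (v1 / 2) * F (b1, y))"
      by (intro continuous_intros hc[OF Ec] Fs)+
    show ?thesis
      unfolding linear_on_contD(1)[OF lin2 c(1) continuous_on_add[OF c(2) continuous_on_const]]
        linear_on_contD(1)[OF lin2 c(2) continuous_on_const]
        linear_on_contD(2)[OF lin2 hc[OF Ec]] linear_on_contD(2)[OF lin2 Fs(2)]
        vol_int_const[OF K(2)] v2_def ..
  qed
  also have "\<dots> \<le> v1 * (2 ^ DIM('b) * A) + ((v1 / 2) * (m / v1 - A) + v1 / 2 * F (b1, b2) * v2)"
  proof -
    have 1: "vol_int P2 (\<lambda>y. E (?h y)) \<le> 2 ^ DIM('b) * A"
      unfolding A_def b2_def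
      by (rule vol_int_contract_le[OF K(2) delzant_convex[OF P2] bary_in[OF P2] Ec E0])
    have 2: "vol_int P2 (\<lambda>y. F (b1, y)) = m / v1 - A" using A by simp
    show ?thesis
      unfolding 2 using mult_left_mono[OF 1, of v1] v by simp
  qed
  also have "(v1 / 2) * (m / v1 - A) = m / 2 - v1 / 2 * A" using v by (simp add: field_simps)
  finally have *: "m - v2 * B \<le> v1 * (2 ^ DIM('b) * A) + (m / 2 - v1 / 2 * A + v1 / 2 * F (b1, b2) * v2)"
    using v by (simp add: B right_diff_distrib)
  \<comment> \<open>The term with -A/2 is dropped. Moving m/2 to the left then leaves half of the
    wanted difference there, and doubling it is the origin of the outer factor 2.\<close>
  have "0 \<le> v1 / 2 * A" using v A0 by simp
  then have "m - v1 * v2 * F (b1, b2) \<le> 2 * (v1 * (2 ^ DIM('b) * A) + v2 * B)"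
    using * by (simp add: algebra_simps)
  moreover have "excess (P1 \<times> P2) F = (m - v1 * v2 * F (b1, b2)) / (v1 * v2)"
    using v by (simp add: excess_def m_def bary_Times[OF P1 P2] vol_Times[OF K] v1_def v2_def b1_def b2_def
        diff_divide_distrib)
  ultimately have "excess (P1 \<times> P2) F \<le> 2 * (v1 * (2 ^ DIM('b) * A) + v2 * B) / (v1 * v2)"
    using v by (simp add: divide_right_mono)
  also have "\<dots> = 2 * (2 ^ DIM('b) / v2 * A + 1 / v1 * B)"
    using v by (simp add: field_simps)
  finally show ?thesis unfolding A_def B_def E_def[abs_def] v1_def v2_def .
qed

text \<open>Integrates the stability inequality of slices over the parameter. Integrability is all
  that Fubini has supplied for boundary integrals of slices, so \<open>u\<close> and
  \<open>w\<close> are not assumed continuous.\<close>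

lemma stable_average:
  assumes u: "set_integrable lborel P u" and w: "set_integrable lborel P w"
    and k: "continuous_on UNIV k" and P: "compact P"
    and le: "\<And>y. y \<in> P \<Longrightarrow> \<delta> * k y \<le> u y - w y"
  shows "\<delta> * vol_int P k \<le> vol_int P u - vol_int P w"
proof -
  have "\<delta> * vol_int P k = vol_int P (\<lambda>y. \<delta> * k y)"
    using linear_on_contD(2)[OF linear_vol_int_1[OF P] k] by simp
  also have "\<dots> \<le> vol_int P (\<lambda>y. u y - w y)"
    unfolding vol_int_def using k le
    by (intro set_integral_mono set_integrable_vol set_integral_diff(1)[OF u w] P continuous_intros) auto
  also have "\<dots> = vol_int P u - vol_int P w"
    unfolding vol_int_def by (rule set_integral_diff(2)[OF u w])
  finally show ?thesis .
qed

theorem corollary1p0p4: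
  fixes P1 :: "'a::euclidean_space set" and P2 :: "'b::euclidean_space set"
  assumes "integral_delzant P1" and "integral_delzant P2"
    and "uniformly_relatively_K_polystable P1"
    and "uniformly_relatively_K_polystable P2"
  shows "uniformly_relatively_K_polystable (P1 \<times> P2)"
proof -
  note D = assms(1,2) and K = delzant_compact[OF assms(1)] delzant_compact[OF assms(2)]
  obtain \<delta>1 where \<delta>1: "\<delta>1 > 0" "\<And>f. f \<in> C_PL_rat P1 \<Longrightarrow> L_V P1 f \<ge> \<delta>1 * J_norm P1 f"
    using assms(3) unfolding uniformly_relatively_K_polystable_def by blast
  obtain \<delta>2 where \<delta>2: "\<delta>2 > 0" "\<And>f. f \<in> C_PL_rat P2 \<Longrightarrow> L_V P2 f \<ge> \<delta>2 * J_norm P2 f"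
    using assms(4) unfolding uniformly_relatively_K_polystable_def by blast
  obtain h1 where h1: "is_density P1 h1" using is_density_exists[OF D(1)] .
  obtain h2 where h2: "is_density P2 h2" using is_density_exists[OF D(2)] .
  have hc: "continuous_on UNIV h1" "continuous_on UNIV h2"
    using h1 h2 affine_fun_continuous by (auto simp: is_density_def)
  let ?h = "\<lambda>z. h1 (fst z) + h2 (snd z)"
  have h: "is_density (P1 \<times> P2) ?h" by (rule is_density_Times[OF D h1 h2])
  have D12: "integral_delzant (P1 \<times> P2)" by (rule integral_delzant_Times[OF D])
  have v: "vol P1 > 0" "vol P2 > 0" using vol_pos D by blast+
  \<comment> \<open>The coefficients of the two integrated slice excesses in
    \<open>excess_Times_le\<close>. They are asymmetric because the contraction takes place in the
    second factor.\<close>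
  define c1 c2 where "c1 = 2 * 2 ^ DIM('b) / vol P2" and "c2 = 2 / vol P1"
  have c: "c1 > 0" "c2 > 0" using v by (simp_all add: c1_def c2_def)
  define \<delta> where "\<delta> = min (\<delta>1 / c1) (\<delta>2 / c2)"
  have \<delta>: "\<delta> > 0" "\<delta> * c1 \<le> \<delta>1" "\<delta> * c2 \<le> \<delta>2"
    using \<delta>1(1) \<delta>2(1) c by (auto simp: \<delta>_def min_def field_simps)
  have "\<delta> * J_norm (P1 \<times> P2) f \<le> L_V (P1 \<times> P2) f" if f: "f \<in> C_PL_rat (P1 \<times> P2)" for f
  proof -
    obtain S :: "('a \<times> 'b \<Rightarrow> real) set" and a c where I: "finite S" "S \<noteq> {}"
      and a: "\<And>i b. i \<in> S \<Longrightarrow> b \<in> Basis \<Longrightarrow> a i \<bullet> b \<in> \<rat>"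
      and fF: "\<And>z. z \<in> P1 \<times> P2 \<Longrightarrow> f z = pl S a c z"
      using C_PL_rat_pl[OF f] by metis
    define F where "F = pl S a c"
    have Fc: "continuous_on UNIV F" unfolding F_def by (rule pl_continuous[OF I])
    have a1: "fst (a i) \<bullet> b \<in> \<rat>" if "i \<in> S" "b \<in> Basis" for i b
      using a[OF that(1), of "(b, 0)"] that(2) by (simp add: Basis_prod_def inner_prod_def)
    have a2: "snd (a i) \<bullet> b \<in> \<rat>" if "i \<in> S" "b \<in> Basis" for i b
      using a[OF that(1), of "(0, b)"] that(2) by (simp add: Basis_prod_def inner_prod_def)
    have F1: "(\<lambda>x. F (x, y)) = pl S (\<lambda>i. fst (a i)) (\<lambda>i. c i + snd (a i) \<bullet> y)"
      and F2: "(\<lambda>y. F (x, y)) = pl S (\<lambda>i. snd (a i)) (\<lambda>i. c i + fst (a i) \<bullet> x)" for x y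
      unfolding F_def by (rule ext, rule pl_slice)+
    define E1 where "E1 y = excess P1 (\<lambda>x. F (x, y))" for y
    define E2 where "E2 x = excess P2 (\<lambda>y. F (x, y))" for x
    have conv: "convex_on UNIV (\<lambda>x. F (x, y))" "convex_on UNIV (\<lambda>y. F (x, y))" for x y
      unfolding F1 F2 by (rule pl_convex[OF I])+
    note Fs = continuous_slice[OF Fc]
    have Ec: "continuous_on UNIV E1" "continuous_on UNIV E2"
      unfolding E1_def[abs_def] E2_def[abs_def] excess_def
      using continuous_vol_int_param[OF K(1) Fs(1) conv(2)]
        continuous_vol_int_param[OF K(2) Fs(2) conv(1)] v Fs
      by (auto intro!: continuous_intros)
    have E0: "0 \<le> E1 y" "0 \<le> E2 x" for x y
      unfolding E1_def E2_def F1 F2 by (rule excess_pl_nonneg[OF _ I], rule D)+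
    have nn: "0 \<le> vol_int P1 E2" "0 \<le> vol_int P2 E1"
      using vol_int_mono[OF K(1) continuous_on_const Ec(2), of 0] E0 vol_int_const[OF K(1), of 0]
        vol_int_mono[OF K(2) continuous_on_const Ec(1), of 0] vol_int_const[OF K(2), of 0] by auto
    have s1: "\<delta>1 * E1 y \<le> bd_int P1 (\<lambda>x. F (x, y)) - vol_int P1 (\<lambda>x. h1 x * F (x, y))" for y
    proof -
      let ?g = "pl S (\<lambda>i. fst (a i)) (\<lambda>i. c i + snd (a i) \<bullet> y)"
      have "\<delta>1 * excess P1 ?g \<le> bd_int P1 ?g - vol_int P1 (\<lambda>x. h1 x * ?g x)"
        by (rule stable_real_constants[OF D(1) h1 \<delta>1 I]) (assumption, rule a1)
      then show ?thesis unfolding F1[symmetric] E1_def .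
    qed
    have s2: "\<delta>2 * E2 x \<le> bd_int P2 (\<lambda>y. F (x, y)) - vol_int P2 (\<lambda>y. h2 y * F (x, y))" for x
    proof -
      let ?g = "pl S (\<lambda>i. snd (a i)) (\<lambda>i. c i + fst (a i) \<bullet> x)"
      have "\<delta>2 * excess P2 ?g \<le> bd_int P2 ?g - vol_int P2 (\<lambda>y. h2 y * ?g y)"
        by (rule stable_real_constants[OF D(2) h2 \<delta>2 I]) (assumption, rule a2)
      then show ?thesis unfolding F2[symmetric] E2_def .
    qed
    have hF: "continuous_on UNIV (\<lambda>z. h1 (fst z) * F z)" "continuous_on UNIV (\<lambda>z. h2 (snd z) * F z)"
      by (intro continuous_on_mult Fc continuous_on_compose2[OF hc(1)] continuous_on_compose2[OF hc(2)]
          continuous_intros; simp)+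
    have t1: "\<delta>1 * vol_int P2 E1 \<le> vol_int P2 (\<lambda>y. bd_int P1 (\<lambda>x. F (x, y)))
        - vol_int P2 (\<lambda>y. vol_int P1 (\<lambda>x. h1 x * F (x, y)))"
      using set_integrable_vol_snd[OF K hF(1)]
      by (intro stable_average set_integrable_bd_int_fst[OF D(1) K(2) Fc] Ec K s1) simp
    have t2: "\<delta>2 * vol_int P1 E2 \<le> vol_int P1 (\<lambda>x. bd_int P2 (\<lambda>y. F (x, y)))
        - vol_int P1 (\<lambda>x. vol_int P2 (\<lambda>y. h2 y * F (x, y)))"
      using set_integrable_vol_fst[OF K hF(2)]
      by (intro stable_average set_integrable_bd_int_snd[OF K(1) D(2) Fc] Ec K s2) simp
    have "vol_int (P1 \<times> P2) (\<lambda>z. ?h z * F z) =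
        vol_int (P1 \<times> P2) (\<lambda>z. h1 (fst z) * F z) + vol_int (P1 \<times> P2) (\<lambda>z. h2 (snd z) * F z)"
      unfolding distrib_right
      by (rule linear_on_contD(1)[OF linear_vol_int_1 hF]) (intro compact_Times K)
    also have "\<dots> = vol_int P2 (\<lambda>y. vol_int P1 (\<lambda>x. h1 x * F (x, y)))
        + vol_int P1 (\<lambda>x. vol_int P2 (\<lambda>y. h2 y * F (x, y)))"
      using vol_int_Times_snd[OF K hF(1)] vol_int_Times_fst[OF K hF(2)] by simp
    moreover have "L_V (P1 \<times> P2) f = bd_int (P1 \<times> P2) F - vol_int (P1 \<times> P2) (\<lambda>z. ?h z * F z)"
      by (rule L_V_eq[OF D12 h Fc]) (simp only: fF F_def)
    ultimately have L: "\<delta>1 * vol_int P2 E1 + \<delta>2 * vol_int P1 E2 \<le> L_V (P1 \<times> P2) f"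
      using bd_int_Times[OF D Fc] t1 t2 by linarith
    have "\<delta> * J_norm (P1 \<times> P2) f \<le> \<delta> * excess (P1 \<times> P2) F"
      using J_norm_cong[of "P1 \<times> P2" f F] fF J_norm_le[OF D12 I, of a c] \<delta>(1) by (simp add: F_def)
    also have "\<dots> \<le> \<delta> * (c1 * vol_int P2 E1 + c2 * vol_int P1 E2)"
      using excess_Times_le[OF D I, of a c] \<delta>(1) unfolding F_def[symmetric] E1_def[abs_def, symmetric]
        E2_def[abs_def, symmetric] by (intro mult_left_mono) (simp_all add: c1_def c2_def algebra_simps)
    also have "\<dots> = (\<delta> * c1) * vol_int P2 E1 + (\<delta> * c2) * vol_int P1 E2" by (simp add: algebra_simps)
    \<comment> \<open>Both integrated excesses are nonnegative, so their coefficients may be raised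
      to \<delta>1 and \<delta>2.\<close>
    also have "\<dots> \<le> \<delta>1 * vol_int P2 E1 + \<delta>2 * vol_int P1 E2"
      using \<delta> nn by (intro add_mono mult_right_mono)
    also have "\<dots> \<le> L_V (P1 \<times> P2) f" by (rule L)
    finally show ?thesis .
  qed
  then show ?thesis
    unfolding uniformly_relatively_K_polystable_def using \<delta>(1) by blast
qed

end
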